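(* Consider the normal mean model $P_\theta=\mathcal N(\theta,1)$, $\theta\in\mathbb R$. (i) Let $h>0$ and let $\mathcal P([-h,h])$ be the set of all probability distributions supported on $[-h,h]$. There exist constants $c_0=c_0(h)>0$ and $n_0$ such that for all $n\ge n_0$, $$\mathsf{TotRegret}_n(\mathcal P([-h,h]))\ \ge\ c_0\left(\frac{\log n}{\log\log n}\right)^2 .$$ (ii) Let $s>0$ and let $\mathsf{SubG}(s)=\{G:\ G([-t,t]^c)\le 2e^{-t^2/(2s)}\ \ \forall t>0\}$ denote the set of all $s$-subgaussian probability distributions on $\mathbb R$. There exist constants $c_1=c_1(s)>0$ and $n_0$ such that for all $n\ge n_0$, $$\mathsf{TotRegret}_n(\mathsf{SubG}(s))\ \ge\ c_1\log^2 n .$$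
   Context: Empirical Bayes setting: given a prior $G$ on $\mathbb R$, let $\theta^n=(\theta_1,\dots,\theta_n)$ be i.i.d. from $G$, and conditionally on $\theta^n$ let $Y_1,\dots,Y_n$ be independent with $Y_i\sim P_{\theta_i}$. $\mathbb E_G$ denotes expectation over the joint law of $(\theta^n,Y^n)$. The Bayes risk is $\mathrm{mmse}(G)=\inf_{\hat\theta}\mathbb E_G[(\hat\theta(Y)-\theta)^2]$, where $\theta\sim G$, $Y\mid\theta\sim P_\theta$ is a single observation and the infimum is over all measurable functions $\hat\theta$. For a collection of priors $\mathcal G$, the total regret is $$\mathsf{TotRegret}_n(\mathcal G)=\inf_{\hat\theta^n}\sup_{G\in\mathcal G}\left\{\mathbb E_G\left[\|\hat\theta^n(Y_1,\dots,Y_n)-\theta^n\|^2\right]-n\cdot\mathrm{mmse}(G)\right\},$$ where $\|\cdot\|$ is the Euclidean norm and the infimum is over all estimators $\hat\theta^n$ (measurable $\mathbb R^n$-valued functions of $Y_1,\dots,Y_n$). *)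

theory Defs
  imports "HOL-Probability.Probability"
begin

text \<open>
  A model is a map \<^term>\<open>P :: real \<Rightarrow> real measure\<close>, \<^term>\<open>P \<theta>\<close> being the law of one observation given
  the parameter \<^term>\<open>\<theta>\<close>. Vectors of length \<^term>\<open>n\<close> are elements of the product space
  \<^term>\<open>\<Pi>\<^sub>M i\<in>{..<n}. (borel :: real measure)\<close>.
\<close>

abbreviation vec_space :: "nat \<Rightarrow> (nat \<Rightarrow> real) measure" where
  "vec_space n \<equiv> \<Pi>\<^sub>M i\<in>{..<n}. borel"

definition joint_law ::
  "(real \<Rightarrow> real measure) \<Rightarrow> real measure \<Rightarrow> (real \<times> real) measure" where
  "joint_law P G = do {
     \<theta> \<leftarrow> G;
     y \<leftarrow> P \<theta>;
     return (borel \<Otimes>\<^sub>M borel) (\<theta>, y)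
   }"

definition joint_law_n ::
  "(real \<Rightarrow> real measure) \<Rightarrow> nat \<Rightarrow> real measure \<Rightarrow> ((nat \<Rightarrow> real) \<times> (nat \<Rightarrow> real)) measure" where
  "joint_law_n P n G = do {
     \<theta> \<leftarrow> (\<Pi>\<^sub>M i\<in>{..<n}. G);
     y \<leftarrow> (\<Pi>\<^sub>M i\<in>{..<n}. P (\<theta> i));
     return (vec_space n \<Otimes>\<^sub>M vec_space n) (\<theta>, y)
   }"

definition mmse :: "(real \<Rightarrow> real measure) \<Rightarrow> real measure \<Rightarrow> ennreal" where
  "mmse P G =
     (INF f \<in> borel_measurable borel. \<integral>\<^sup>+ (\<theta>, y). ennreal ((f y - \<theta>)\<^sup>2) \<partial>joint_law P G)"

definition risk_n ::
  "(real \<Rightarrow> real measure) \<Rightarrow> nat \<Rightarrow> ((nat \<Rightarrow> real) \<Rightarrow> nat \<Rightarrow> real) \<Rightarrow> real measure \<Rightarrow> ennreal" where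
  "risk_n P n f G =
     (\<integral>\<^sup>+ (\<theta>, y). ennreal ((L2_set (\<lambda>i. f y i - \<theta> i) {..<n})\<^sup>2) \<partial>joint_law_n P n G)"

text \<open>
  The risk of a bad estimator may be infinite, so the regret lives in \<^typ>\<open>ereal\<close>. In \<^typ>\<open>ereal\<close>,
  \<^prop>\<open>\<infinity> - \<infinity> = (\<infinity> :: ereal)\<close>; this case arises only for priors of infinite \<^term>\<open>mmse P G\<close>, hence
  never in the normal mean model, where the estimator \<^term>\<open>\<lambda>y :: real. y\<close> has risk 1.
\<close>

definition tot_regret :: "(real \<Rightarrow> real measure) \<Rightarrow> nat \<Rightarrow> real measure set \<Rightarrow> ereal" where
  "tot_regret P n \<G> =
     (INF f \<in> vec_space n \<rightarrow>\<^sub>M vec_space n.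
        SUP G \<in> \<G>. enn2ereal (risk_n P n f G) - ereal (real n) * enn2ereal (mmse P G))"

definition normal_mean :: "real \<Rightarrow> real measure" where
  "normal_mean \<theta> = density lborel (\<lambda>y. ennreal (normal_density \<theta> 1 y))"

definition priors_on :: "real set \<Rightarrow> real measure set" where
  "priors_on S = {G. prob_space G \<and> sets G = sets borel \<and> measure G S = 1}"

definition SubG :: "real \<Rightarrow> real measure set" where
  "SubG s = {G. prob_space G \<and> sets G = sets borel \<and>
     (\<forall>t>0. measure G (- {-t..t}) \<le> 2 * exp (- t\<^sup>2 / (2 * s)))}"


text \<open>
  Giry-monadic bind is only meaningful for measurable kernels; the kernels above are measurable, and
  expectations under the joint laws are the expected iterated integrals.
\<close>

lemma prob_space_normal_mean: "prob_space (normal_mean \<theta>)"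
  unfolding normal_mean_def by (rule prob_space_normal_density) simp

lemma sets_normal_mean [simp, measurable_cong]: "sets (normal_mean \<theta>) = sets borel"
  by (simp add: normal_mean_def)

lemma space_normal_mean [simp]: "space (normal_mean \<theta>) = UNIV"
  by (simp add: normal_mean_def)

lemma borel_measurable_emeasure_normal_mean:
  assumes [measurable]: "A \<in> sets borel"
  shows "(\<lambda>\<theta>. emeasure (normal_mean \<theta>) A) \<in> borel_measurable borel"
proof -
  have "(\<lambda>\<theta>. \<integral>\<^sup>+ y. ennreal (normal_density \<theta> 1 y) * indicator A y \<partial>lborel) \<in> borel_measurable borel"
    unfolding normal_density_def by measurable
  then show ?thesis
    by (simp add: normal_mean_def emeasure_density)
qed

lemma measurable_normal_mean [measurable]: "normal_mean \<in> borel \<rightarrow>\<^sub>M prob_algebra borel"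
proof (rule measurable_prob_algebra_generated)
  show "sets borel = sigma_sets UNIV (sets (borel :: real measure))"
    using sets.sigma_sets_eq[of "borel :: real measure"] by simp
  show "Int_stable (sets (borel :: real measure))"
    by (rule sets.Int_stable)
qed (auto simp: prob_space_normal_mean borel_measurable_emeasure_normal_mean)

lemma measurable_normal_mean_n:
  "(\<lambda>\<theta>. \<Pi>\<^sub>M i\<in>{..<n}. normal_mean (\<theta> i)) \<in> vec_space n \<rightarrow>\<^sub>M prob_algebra (vec_space n)"
proof (rule measurable_prob_algebra_generated)
  show "sets (vec_space n) =
      sigma_sets (\<Pi>\<^sub>E i\<in>{..<n}. space borel) (prod_algebra {..<n} (\<lambda>_. borel :: real measure))"
    by (rule sets_PiM)
  show "Int_stable (prod_algebra {..<n} (\<lambda>_. borel :: real measure))"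
    by (rule Int_stable_prod_algebra)
  show "prod_algebra {..<n} (\<lambda>_. borel :: real measure) \<subseteq> Pow (\<Pi>\<^sub>E i\<in>{..<n}. space borel)"
    by (rule prod_algebra_sets_into_space)
  fix \<theta> :: "nat \<Rightarrow> real"
  show "prob_space (\<Pi>\<^sub>M i\<in>{..<n}. normal_mean (\<theta> i))"
    by (intro prob_space_PiM prob_space_normal_mean)
  show "sets (\<Pi>\<^sub>M i\<in>{..<n}. normal_mean (\<theta> i)) = sets (vec_space n)"
    by (intro sets_PiM_cong) auto
next
  fix A assume "A \<in> prod_algebra {..<n} (\<lambda>_. borel :: real measure)"
  then obtain F where A: "A = (\<Pi>\<^sub>E i\<in>{..<n}. F i)" and F: "\<And>i. i < n \<Longrightarrow> F i \<in> sets borel"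
    by (auto simp: prod_algebra_eq_finite)
  have "emeasure (\<Pi>\<^sub>M i\<in>{..<n}. normal_mean (\<theta> i)) A = (\<Prod>i<n. emeasure (normal_mean (\<theta> i)) (F i))" for \<theta>
  proof -
    interpret product_prob_space "\<lambda>i. normal_mean (\<theta> i)" "{..<n}"
      by (intro product_prob_spaceI prob_space_normal_mean)
    show ?thesis
      unfolding A by (intro emeasure_PiM) (auto simp: F)
  qed
  moreover have "(\<lambda>\<theta>. \<Prod>i<n. emeasure (normal_mean (\<theta> i)) (F i)) \<in> borel_measurable (vec_space n)"
    using F
    by (intro borel_measurable_prod_ennreal
        measurable_compose[OF _ borel_measurable_emeasure_normal_mean] measurable_component_singleton) auto
  ultimately show "(\<lambda>\<theta>. emeasure (\<Pi>\<^sub>M i\<in>{..<n}. normal_mean (\<theta> i)) A) \<in> borel_measurable (vec_space n)"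
    by simp
qed

lemma
  assumes G: "prob_space G" "sets G = sets borel"
  shows prob_space_joint_law: "prob_space (joint_law normal_mean G)"
    and nn_integral_joint_law:
      "f \<in> borel_measurable (borel \<Otimes>\<^sub>M borel) \<Longrightarrow>
        (\<integral>\<^sup>+ x. f x \<partial>joint_law normal_mean G) = (\<integral>\<^sup>+ \<theta>. \<integral>\<^sup>+ y. f (\<theta>, y) \<partial>normal_mean \<theta> \<partial>G)"
proof -
  note [measurable_cong] = G(2)
  have K: "(\<lambda>\<theta>. normal_mean \<theta> \<bind> (\<lambda>y. return (borel \<Otimes>\<^sub>M borel) (\<theta>, y)))
      \<in> G \<rightarrow>\<^sub>M prob_algebra (borel \<Otimes>\<^sub>M borel)"
    by measurable
  show "prob_space (joint_law normal_mean G)"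
    unfolding joint_law_def
    by (rule prob_space_bind'[OF _ K]) (simp add: space_prob_algebra G)
  assume f: "f \<in> borel_measurable (borel \<Otimes>\<^sub>M borel)"
  have R: "(\<lambda>y. return (borel \<Otimes>\<^sub>M borel) (\<theta>, y)) \<in> normal_mean \<theta> \<rightarrow>\<^sub>M subprob_algebra (borel \<Otimes>\<^sub>M borel)"
    for \<theta> :: real by measurable
  show "(\<integral>\<^sup>+ x. f x \<partial>joint_law normal_mean G) = (\<integral>\<^sup>+ \<theta>. \<integral>\<^sup>+ y. f (\<theta>, y) \<partial>normal_mean \<theta> \<partial>G)"
    unfolding joint_law_def nn_integral_bind[OF f measurable_prob_algebraD[OF K]] nn_integral_bind[OF f R]
    by (simp add: nn_integral_return f space_pair_measure)
qed

lemma
  assumes G: "prob_space G" "sets G = sets borel"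
  shows prob_space_joint_law_n: "prob_space (joint_law_n normal_mean n G)"
    and nn_integral_joint_law_n:
      "f \<in> borel_measurable (vec_space n \<Otimes>\<^sub>M vec_space n) \<Longrightarrow>
        (\<integral>\<^sup>+ x. f x \<partial>joint_law_n normal_mean n G) =
        (\<integral>\<^sup>+ \<theta>. \<integral>\<^sup>+ y. f (\<theta>, y) \<partial>(\<Pi>\<^sub>M i\<in>{..<n}. normal_mean (\<theta> i)) \<partial>(\<Pi>\<^sub>M i\<in>{..<n}. G))"
proof -
  let ?V = "vec_space n \<Otimes>\<^sub>M vec_space n"
  let ?Q = "\<lambda>\<theta>. \<Pi>\<^sub>M i\<in>{..<n}. normal_mean (\<theta> i)"
  have S: "sets (\<Pi>\<^sub>M i\<in>{..<n}. G) = sets (vec_space n)"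
    using G by (intro sets_PiM_cong) auto
  have SQ: "sets (?Q \<theta>) = sets (vec_space n)" for \<theta> :: "nat \<Rightarrow> real"
    by (intro sets_PiM_cong) auto
  have ret: "(\<lambda>y. return ?V (\<theta>, y)) \<in> ?Q \<theta> \<rightarrow>\<^sub>M subprob_algebra ?V"
    if "\<theta> \<in> space (vec_space n)" for \<theta>
    unfolding measurable_cong_sets[OF SQ refl]
    by (rule measurable_compose[OF measurable_Pair1'[OF that] return_measurable])
  have "(\<lambda>\<theta>. ?Q \<theta> \<bind> (\<lambda>y. return ?V (\<theta>, y))) \<in> vec_space n \<rightarrow>\<^sub>M prob_algebra ?V"
    by (rule measurable_bind_prob_space2[OF measurable_normal_mean_n]) measurable
  then have K: "(\<lambda>\<theta>. ?Q \<theta> \<bind> (\<lambda>y. return ?V (\<theta>, y))) \<in> (\<Pi>\<^sub>M i\<in>{..<n}. G) \<rightarrow>\<^sub>M prob_algebra ?V"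
    using S by (simp cong: measurable_cong_sets)
  show "prob_space (joint_law_n normal_mean n G)"
    unfolding joint_law_n_def
    by (rule prob_space_bind'[OF _ K]) (simp add: space_prob_algebra prob_space_PiM G)
  assume f: "f \<in> borel_measurable ?V"
  show "(\<integral>\<^sup>+ x. f x \<partial>joint_law_n normal_mean n G) =
      (\<integral>\<^sup>+ \<theta>. \<integral>\<^sup>+ y. f (\<theta>, y) \<partial>?Q \<theta> \<partial>(\<Pi>\<^sub>M i\<in>{..<n}. G))"
    unfolding joint_law_n_def nn_integral_bind[OF f measurable_prob_algebraD[OF K]]
  proof (rule nn_integral_cong)
    fix \<theta> assume "\<theta> \<in> space (\<Pi>\<^sub>M i\<in>{..<n}. G)"
    then have \<theta>: "\<theta> \<in> space (vec_space n)"
      using sets_eq_imp_space_eq[OF S] by simp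
    show "(\<integral>\<^sup>+ x. f x \<partial>(?Q \<theta> \<bind> (\<lambda>y. return ?V (\<theta>, y)))) = (\<integral>\<^sup>+ y. f (\<theta>, y) \<partial>?Q \<theta>)"
      unfolding nn_integral_bind[OF f ret[OF \<theta>]]
    proof (rule nn_integral_cong)
      fix y assume "y \<in> space (?Q \<theta>)"
      then have "(\<theta>, y) \<in> space ?V"
        using \<theta> sets_eq_imp_space_eq[OF SQ] by (simp add: space_pair_measure)
      then show "(\<integral>\<^sup>+ x. f x \<partial>return ?V (\<theta>, y)) = f (\<theta>, y)"
        by (rule nn_integral_return[OF _ f])
    qed
  qed
qed

end

theory Submission
  imports Defs "HOL-Computational_Algebra.Polynomial" "HOL-Real_Asymp.Real_Asymp"
begin

text \<open>
  Why the regret is this large. For a prior with finitely many atoms, the risk of an estimator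
  \<open>f\<close> exceeds \<open>n\<close> times the Bayes risk by the sum over \<open>i\<close> of the mean square of
  \<open>f\<^sub>i(Y) - T(Y\<^sub>i)\<close>, where \<open>T\<close> is the posterior mean under that prior (\<open>regret_ge_excess\<close>). So it
  suffices to exhibit priors whose posterior means are far apart in \<open>L\<^sup>2\<close> although \<open>n\<close> observations
  cannot tell the priors apart.

  Start from weights \<open>p\<close> on \<open>D + 1\<close> equally spaced points of \<open>[0, L]\<close>, with marginal density \<open>f0\<close>
  of an observation, and perturb them to \<open>p\<^sub>j (1 + R\<^sub>j)\<close>. Let \<open>E R\<close> be the posterior mean of \<open>R\<close> as
  a function of the observation. The marginal density becomes \<open>f0 (1 + E R)\<close>, so the statistical
  distance between two perturbations is governed by the norm of \<open>E R\<close> in \<open>L\<^sup>2(f0)\<close>. The posterior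
  mean of the parameter moves by \<open>(E R)' / (1 + E R)\<close>: in the normal mean model the derivative of a
  posterior mean is the posterior covariance with the parameter (\<open>DERIV_post\<close>). The whole gain lies
  in the ratio of the norms of \<open>(E R)'\<close> and \<open>E R\<close>. When \<open>E R\<close> vanishes on a grid of step
  \<open>1 / sqrt m\<close> that covers \<open>[-2 sqrt m, 2 sqrt m]\<close>, the ratio of the squared norms is at least a
  constant times \<open>m\<close> (\<open>poincare_grid\<close>). This costs \<open>4 m + 1\<close> linear conditions on \<open>R\<close>, so for
  \<open>D = 6 m\<close> there is room for \<open>m\<close> directions \<open>r\<^sub>k\<close> that satisfy them and have \<open>E r\<^sub>k\<close> orthonormal
  (\<open>exists_orthonormal_directions\<close>).

  The \<open>2^m\<close> perturbations \<open>\<delta> (\<plusminus> r\<^sub>0 \<dots> \<plusminus> r\<^bsub>m-1\<^esub>)\<close> with \<open>\<delta>\<close> of order \<open>1 / sqrt n\<close> form a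
  hypercube. Flipping one sign is hardly visible in \<open>n\<close> observations (\<open>chi_square_toggle\<close>), but it
  costs a squared distance of order \<open>m \<delta>\<^sup>2\<close> between posterior means (\<open>separation\<close>). Assouad's
  argument (\<open>assouad_product\<close>) yields a regret of order \<open>n \<cdot> m \<cdot> m \<delta>\<^sup>2\<close>, that is, of order \<open>m\<^sup>2\<close>
  (\<open>tot_regret_ge\<close>).

  It remains to see how large \<open>m\<close> may be. The perturbed weights must stay positive, so the
  amplitudes of the \<open>r\<^sub>k\<close> must stay below \<open>sqrt n\<close> up to powers of \<open>m\<close>. Up to a Gaussian factor, \<open>f0 \<cdot> E R\<close> is a
  polynomial in \<open>exp (L y / D)\<close> whose coefficients are multiples of the \<open>R\<^sub>j\<close>. Lagrange interpolation
  then bounds the amplitudes by the \<open>m\<close>-th power of a constant times \<open>(m / L\<^sup>2) ^ 7\<close>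
  (\<open>abs_coefficient_le_post_norm\<close>, \<open>amplitude_bound\<close>). On a bounded interval, \<open>L = h\<close> and this
  is \<open>exp (O(m log m))\<close>, which leads to \<open>m\<close> of order \<open>log n / log log n\<close>. Subgaussian priors may put a
  mass of order \<open>exp (- m / (2 s))\<close> on points up to \<open>L = sqrt m\<close>; the bound is then \<open>exp (O(m))\<close>, which
  leads to \<open>m\<close> of order \<open>log n\<close>.
\<close>

section \<open>Orthonormal families under linear constraints\<close>

text \<open>
  Gaussian elimination, one equation at a time: an equation with a nonzero coefficient is solved for
  that unknown, which is then substituted into the other equations.
\<close>

lemma homogeneous_system_nontrivial:
  fixes a :: "'e \<Rightarrow> 'i \<Rightarrow> real"
  assumes "finite E" "finite I" "card E < card I"
  shows "\<exists>w. (\<exists>i\<in>I. w i \<noteq> 0) \<and> (\<forall>e\<in>E. (\<Sum>i\<in>I. a e i * w i) = 0)"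
  using assms
proof (induction E arbitrary: I a rule: finite_induct)
  case empty
  then obtain i where "i \<in> I" by fastforce
  then show ?case by (intro exI[of _ "\<lambda>_. 1"]) auto
next
  case (insert e E)
  show ?case
  proof (cases "\<forall>i\<in>I. a e i = 0")
    case True
    from insert.IH[of I a] insert.prems insert.hyps
    obtain w where "\<exists>i\<in>I. w i \<noteq> 0" "\<forall>e\<in>E. (\<Sum>i\<in>I. a e i * w i) = 0" by auto
    then show ?thesis using True by (intro exI[of _ w]) auto
  next
    case False
    then obtain i0 where i0: "i0 \<in> I" "a e i0 \<noteq> 0" by blast
    define J where "J = I - {i0}"
    have J: "finite J" "I = insert i0 J" "i0 \<notin> J" using insert.prems i0 by (auto simp: J_def)
    have "card E < card J"
      using insert.prems insert.hyps J by simp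
    from insert.IH[OF J(1) this, of "\<lambda>f i. a f i - a f i0 * a e i / a e i0"]
    obtain w where w: "\<exists>i\<in>J. w i \<noteq> 0"
      and eq: "\<And>f. f \<in> E \<Longrightarrow> (\<Sum>i\<in>J. (a f i - a f i0 * a e i / a e i0) * w i) = 0"
      by blast
    define x where "x = - (\<Sum>i\<in>J. a e i * w i) / a e i0"
    define w' where "w' = w(i0 := x)"
    have sum_w': "(\<Sum>i\<in>I. a f i * w' i) = a f i0 * x + (\<Sum>i\<in>J. a f i * w i)" for f
    proof -
      have "(\<Sum>i\<in>J. a f i * w' i) = (\<Sum>i\<in>J. a f i * w i)"
        using J(3) by (intro sum.cong) (auto simp: w'_def)
      then show ?thesis
        unfolding J(2) using J by (simp add: w'_def)
    qed
    have "(\<Sum>i\<in>I. a f i * w' i) = 0" if "f \<in> insert e E" for f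
    proof (cases "f = e")
      case True
      then show ?thesis unfolding sum_w' using i0 by (simp add: x_def)
    next
      case False
      with that have "f \<in> E" by simp
      have "(\<Sum>i\<in>J. (a f i - a f i0 * a e i / a e i0) * w i) =
          (\<Sum>i\<in>J. a f i * w i - a f i0 / a e i0 * (a e i * w i))"
        by (intro sum.cong) (simp_all add: left_diff_distrib)
      also have "\<dots> = (\<Sum>i\<in>J. a f i * w i) - a f i0 / a e i0 * (\<Sum>i\<in>J. a e i * w i)"
        by (simp only: sum_subtractf sum_distrib_left)
      finally show ?thesis
        using eq[OF \<open>f \<in> E\<close>] unfolding sum_w' by (simp add: x_def)
    qed
    moreover have "\<exists>i\<in>I. w' i \<noteq> 0"
      using w J by (auto simp: w'_def)
    ultimately show ?thesis by blast
  qed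
qed

text \<open>
  Orthogonality to the vectors found so far is again a linear condition, so each new vector solves a
  homogeneous system that is still underdetermined. This replaces Gram-Schmidt on a subspace.
\<close>

lemma constrained_orthonormal_family:
  fixes \<Gamma> :: "'i \<Rightarrow> 'i \<Rightarrow> real" and a :: "'e \<Rightarrow> 'i \<Rightarrow> real" and I :: "'i set"
  defines "B \<equiv> \<lambda>v w. \<Sum>i\<in>I. \<Sum>j\<in>I. \<Gamma> i j * v i * w j"
  assumes fin: "finite E" "finite I" and card: "card E + m \<le> card I"
    and sym: "\<And>i j. \<Gamma> i j = \<Gamma> j i"
    and pos: "\<And>w. (\<exists>i\<in>I. w i \<noteq> 0) \<Longrightarrow> B w w > 0"
  shows "\<exists>r. (\<forall>k<m. \<forall>e\<in>E. (\<Sum>i\<in>I. a e i * r k i) = 0) \<and>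
             (\<forall>k<m. \<forall>l<m. B (r k) (r l) = (if k = l then 1 else 0))"
  using card
proof (induction m)
  case 0
  then show ?case by auto
next
  case (Suc m)
  have "card E + m \<le> card I" using Suc.prems by simp
  from Suc.IH[OF this] obtain r
    where "(\<forall>k<m. \<forall>e\<in>E. (\<Sum>i\<in>I. a e i * r k i) = 0) \<and>
      (\<forall>k<m. \<forall>l<m. B (r k) (r l) = (if k = l then 1 else 0))" ..
  then have r: "k < m \<Longrightarrow> e \<in> E \<Longrightarrow> (\<Sum>i\<in>I. a e i * r k i) = 0"
    and orth: "k < m \<Longrightarrow> l < m \<Longrightarrow> B (r k) (r l) = (if k = l then 1 else 0)" for k l e
    by blast+
  define a' where "a' = (\<lambda>x. case x of Inl e \<Rightarrow> a e | Inr k \<Rightarrow> (\<lambda>i. \<Sum>j\<in>I. \<Gamma> i j * r k j))"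
  have "card (E <+> {..<m}) < card I"
    using Suc.prems fin by (simp add: card_Plus)
  from homogeneous_system_nontrivial[OF _ fin(2) this, of a'] fin
  obtain w where w: "\<exists>i\<in>I. w i \<noteq> 0"
    and weq: "\<And>x. x \<in> E <+> {..<m} \<Longrightarrow> (\<Sum>i\<in>I. a' x i * w i) = 0"
    by auto
  have Bsym: "B v w = B w v" for v w
    unfolding B_def by (subst sum.swap) (simp add: sym mult_ac)
  have wa: "(\<Sum>i\<in>I. a e i * w i) = 0" if "e \<in> E" for e
    using weq[OF InlI[OF that]] by (simp add: a'_def)
  have wB: "B w (r k) = 0" if "k < m" for k
    using weq[OF InrI, of k] that by (simp add: a'_def B_def sum_distrib_left sum_distrib_right mult_ac)
  define c where "c = B w w"
  have c: "c > 0" using pos[OF w] by (simp add: c_def)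
  define z where "z = (\<lambda>i. w i / sqrt c)"
  have Bz: "B z v = B w v / sqrt c" for v
    unfolding B_def z_def by (simp add: sum_divide_distrib mult_ac)
  have zz: "B z z = 1"
    using Bz[of z] Bsym[of w z] Bz[of w] c by (simp add: c_def[symmetric])
  define r' where "r' = r(m := z)"
  show ?case
  proof (intro exI[of _ r'] conjI allI impI ballI)
    fix k e assume "k < Suc m" "e \<in> E"
    then show "(\<Sum>i\<in>I. a e i * r' k i) = 0"
      using r wa[of e] by (cases "k = m") (auto simp: r'_def z_def sum_divide_distrib[symmetric])
  next
    fix k l assume "k < Suc m" "l < Suc m"
    then show "B (r' k) (r' l) = (if k = l then 1 else 0)"
      using zz Bz[of "r l"] Bz[of "r k"] Bsym[of "r k" z] wB orth
      by (cases "k = m"; cases "l = m") (auto simp: r'_def)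
  qed
qed

section \<open>Coefficients of a polynomial from its values\<close>

lemma abs_coeff_prod_linear_le:
  fixes x :: "nat \<Rightarrow> real"
  assumes "finite S"
  shows "\<bar>coeff (\<Prod>k\<in>S. [:- x k, 1:]) j\<bar> \<le> (\<Prod>k\<in>S. 1 + \<bar>x k\<bar>)"
  using assms
proof (induction S arbitrary: j rule: finite_induct)
  case empty
  then show ?case by (simp add: coeff_1)
next
  case (insert a S)
  let ?q = "\<Prod>k\<in>S. [:- x k, 1:]" and ?M = "\<Prod>k\<in>S. 1 + \<bar>x k\<bar>"
  have "?M \<ge> 0" by (intro prod_nonneg) auto
  have "coeff ([:- x a, 1:] * ?q) j = - x a * coeff ?q j + (case j of 0 \<Rightarrow> 0 | Suc i \<Rightarrow> coeff ?q i)"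
    by (simp add: coeff_pCons split: nat.splits)
  also have "\<bar>\<dots>\<bar> \<le> \<bar>x a\<bar> * ?M + ?M"
    using insert.IH[of j] insert.IH[of "j - 1"] \<open>?M \<ge> 0\<close>
    by (intro order_trans[OF abs_triangle_ineq] add_mono)
       (auto simp: abs_mult intro!: mult_left_mono split: nat.splits)
  finally show ?case using insert.hyps by (simp add: algebra_simps)
qed

text \<open>
  Lagrange interpolation at the nodes \<open>x\<^sub>i\<close>: the basis polynomials have coefficients bounded by
  \<open>(1 + X) ^ D / W\<close>.
\<close>

lemma abs_coeff_le_values:
  fixes P :: "real poly" and x :: "nat \<Rightarrow> real"
  assumes deg: "degree P \<le> D" and inj: "inj_on x {..D}"
    and X: "\<And>i. i \<le> D \<Longrightarrow> \<bar>x i\<bar> \<le> X"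
    and M: "\<And>i. i \<le> D \<Longrightarrow> \<bar>poly P (x i)\<bar> \<le> M"
    and W: "W > 0" "\<And>i. i \<le> D \<Longrightarrow> (\<Prod>k\<in>{..D} - {i}. \<bar>x i - x k\<bar>) \<ge> W"
  shows "\<bar>coeff P j\<bar> \<le> real (D + 1) * (M * (1 + X) ^ D / W)"
proof -
  define l where "l = (\<lambda>i. \<Prod>k\<in>{..D} - {i}. [:- x k, 1:])"
  define w where "w = (\<lambda>i. \<Prod>k\<in>{..D} - {i}. x i - x k)"
  define Q where "Q = (\<Sum>i\<le>D. smult (poly P (x i) / w i) (l i))"
  have w0: "w i \<noteq> 0" if "i \<le> D" for i
    using that inj by (auto simp: w_def inj_on_def)
  have ll: "poly (l i) (x i') = (if i' = i then w i else 0)" if "i \<le> D" "i' \<le> D" for i i'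
    using that by (auto simp: l_def w_def poly_prod)
  have "P = Q"
  proof (rule poly_eqI_degree)
    fix z assume "z \<in> x ` {..D}"
    then obtain i where i: "i \<le> D" "z = x i" by auto
    have "poly Q z = (\<Sum>i'\<le>D. if i' = i then poly P (x i) else 0)"
      unfolding Q_def poly_sum poly_smult using i w0
      by (intro sum.cong) (auto simp: ll)
    then show "poly P z = poly Q z" using i by simp
  next
    have "degree (l i) \<le> D" if "i \<le> D" for i
      using that degree_prod_sum_le[of "{..D} - {i}" "\<lambda>k. [:- x k, 1:]"] by (simp add: l_def)
    then have "degree Q \<le> D"
      unfolding Q_def by (intro degree_sum_le) (auto intro: order_trans[OF degree_smult_le])
    then show "degree Q < card (x ` {..D})" using inj by (simp add: card_image)
    show "degree P < card (x ` {..D})" using inj deg by (simp add: card_image)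
  qed
  have lb: "\<bar>coeff (l i) j\<bar> \<le> (1 + X) ^ D" if "i \<le> D" for i
  proof -
    have "\<bar>coeff (l i) j\<bar> \<le> (\<Prod>k\<in>{..D} - {i}. 1 + \<bar>x k\<bar>)"
      unfolding l_def by (rule abs_coeff_prod_linear_le) auto
    also have "\<dots> \<le> (\<Prod>k\<in>{..D} - {i}. 1 + X)"
      using X by (intro prod_mono) auto
    finally show ?thesis using that by simp
  qed
  have "\<bar>coeff P j\<bar> = \<bar>\<Sum>i\<le>D. poly P (x i) / w i * coeff (l i) j\<bar>"
    by (subst \<open>P = Q\<close>) (simp add: Q_def coeff_sum)
  also have "\<dots> \<le> (\<Sum>i\<le>D. \<bar>poly P (x i) / w i * coeff (l i) j\<bar>)"
    by (rule sum_abs)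
  also have "\<dots> \<le> (\<Sum>i\<le>D. M / W * (1 + X) ^ D)"
  proof (intro sum_mono)
    fix i assume i: "i \<in> {..D}"
    have "\<bar>w i\<bar> \<ge> W" using W(2)[of i] i by (simp add: w_def abs_prod)
    then have "\<bar>poly P (x i)\<bar> / \<bar>w i\<bar> \<le> M / W"
      using M[of i] i W(1) by (intro frac_le) auto
    moreover have "M / W \<ge> 0" using M[of i] i W(1) by auto
    ultimately show "\<bar>poly P (x i) / w i * coeff (l i) j\<bar> \<le> M / W * (1 + X) ^ D"
      using lb[of i] i unfolding abs_mult abs_divide by (intro mult_mono) auto
  qed
  finally show ?thesis by (simp add: algebra_simps)
qed

lemma prod_abs_diff_atMost:
  assumes "i \<le> D"
  shows "(\<Prod>k\<in>{..D} - {i}. \<bar>real i - real k\<bar>) = fact i * fact (D - i)"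
proof -
  have split: "{..D} - {i} = {..<i} \<union> {Suc i..D}" using assms by auto
  have "(\<Prod>k<i. \<bar>real i - real k\<bar>) = (\<Prod>k<i. real (i - k))"
    by (intro prod.cong) (auto simp: of_nat_diff)
  also have "\<dots> = (\<Prod>k=1..i. real k)"
    by (rule prod.reindex_bij_witness[of _ "\<lambda>k. i - k" "\<lambda>k. i - k"]) auto
  also have "\<dots> = fact i" by (simp add: fact_prod)
  finally have 1: "(\<Prod>k<i. \<bar>real i - real k\<bar>) = fact i" .
  have "(\<Prod>k\<in>{Suc i..D}. \<bar>real i - real k\<bar>) = (\<Prod>k\<in>{Suc i..D}. real (k - i))"
    by (intro prod.cong) (auto simp: of_nat_diff)
  also have "\<dots> = (\<Prod>k=1..D - i. real k)"
    by (rule prod.reindex_bij_witness[of _ "\<lambda>k. k + i" "\<lambda>k. k - i"]) auto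
  also have "\<dots> = fact (D - i)" by (simp add: fact_prod)
  finally have 2: "(\<Prod>k\<in>{Suc i..D}. \<bar>real i - real k\<bar>) = fact (D - i)" .
  show ?thesis unfolding split by (subst prod.union_disjoint) (auto simp only: 1 2 finite_lessThan finite_atLeastAtMost, auto)
qed

text \<open>
  For equally spaced nodes the product is \<open>w ^ D i! (D - i)!\<close>, and this is at least
  \<open>w ^ D D! / 2 ^ D\<close>. The estimate \<open>D! \<ge> (D / e) ^ D\<close> matters: bounding every factor from below by the
  spacing \<open>w\<close> alone would lose a factor \<open>D ^ D\<close>, which is too much when \<open>D\<close> is of order \<open>log n\<close>.
\<close>

lemma prod_spaced_ge:
  fixes x :: "nat \<Rightarrow> real"
  assumes w: "w \<ge> 0" and i: "i \<le> D"
    and sp: "\<And>i k. i \<le> D \<Longrightarrow> k \<le> D \<Longrightarrow> w * \<bar>real i - real k\<bar> \<le> \<bar>x i - x k\<bar>"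
  shows "w ^ D * real D ^ D / (2 * exp 1) ^ D \<le> (\<Prod>k\<in>{..D} - {i}. \<bar>x i - x k\<bar>)"
proof -
  have "real (D choose i) \<le> 2 ^ D"
    using binomial_le_pow2[of D i] by (metis of_nat_le_iff of_nat_numeral of_nat_power)
  moreover have "real (D choose i) * (fact i * fact (D - i)) = fact D"
    using binomial_fact_lemma[OF i] by (metis of_nat_fact of_nat_mult mult.commute)
  moreover have "(fact i * fact (D - i) :: real) > 0" by simp
  ultimately have 1: "(fact D :: real) \<le> 2 ^ D * (fact i * fact (D - i))"
    by (metis mult_right_mono less_eq_real_def)
  have "real D ^ D / fact D \<le> exp (real D)"
    using sum_le_suminf[OF summable_exp_generic[of "real D"], of "{D}"]
    by (simp add: exp_def divide_inverse mult_ac)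
  then have "real D ^ D \<le> exp 1 ^ D * fact D"
    by (simp add: field_simps exp_of_nat_mult[symmetric])
  also have "\<dots> \<le> exp 1 ^ D * (2 ^ D * (fact i * fact (D - i)))"
    using 1 by simp
  finally have 2: "real D ^ D / (2 * exp 1) ^ D \<le> fact i * fact (D - i)"
    by (simp add: field_simps power_mult_distrib)
  have "w ^ D * (real D ^ D / (2 * exp 1) ^ D) \<le> w ^ D * (fact i * fact (D - i))"
    using 2 w by (intro mult_left_mono) auto
  also have "\<dots> = (\<Prod>k\<in>{..D} - {i}. w * \<bar>real i - real k\<bar>)"
    using i by (simp add: prod.distrib prod_abs_diff_atMost)
  also have "\<dots> \<le> (\<Prod>k\<in>{..D} - {i}. \<bar>x i - x k\<bar>)"
    using sp i w by (intro prod_mono) auto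
  finally show ?thesis by simp
qed

section \<open>Priors with finitely many atoms and densities of product measures\<close>

definition atoms :: "nat \<Rightarrow> (nat \<Rightarrow> real) \<Rightarrow> (nat \<Rightarrow> real) \<Rightarrow> real measure" where
  "atoms D t q = distr (point_measure {..D} (\<lambda>j. ennreal (q j))) borel t"

lemma sets_atoms [simp, measurable_cong]: "sets (atoms D t q) = sets borel"
  by (simp add: atoms_def)

lemma space_atoms [simp]: "space (atoms D t q) = UNIV"
  by (simp add: atoms_def)

lemma nn_integral_atoms:
  assumes "g \<in> borel_measurable borel"
  shows "(\<integral>\<^sup>+ \<theta>. g \<theta> \<partial>atoms D t q) = (\<Sum>j\<le>D. ennreal (q j) * g (t j))"
  unfolding atoms_def using assms
  by (subst nn_integral_distr) (auto simp: nn_integral_point_measure_finite)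

lemma emeasure_atoms:
  assumes "A \<in> sets borel"
  shows "emeasure (atoms D t q) A = (\<Sum>j\<le>D. ennreal (q j) * indicator A (t j))"
  using nn_integral_atoms[of "indicator A" D t q] assms by simp

lemma prob_space_atoms:
  assumes "\<And>j. j \<le> D \<Longrightarrow> q j \<ge> 0" "(\<Sum>j\<le>D. q j) = 1"
  shows "prob_space (atoms D t q)"
proof
  show "emeasure (atoms D t q) (space (atoms D t q)) = 1"
    using assms by (simp add: emeasure_atoms) (subst sum_ennreal, auto)
qed

lemma PiM_density_lborel:
  fixes d :: "'i \<Rightarrow> real \<Rightarrow> real"
  assumes I: "finite I" and [measurable]: "\<And>i. d i \<in> borel_measurable borel"
    and prob: "\<And>i. prob_space (density lborel (\<lambda>y. ennreal (d i y)))"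
  shows "(\<Pi>\<^sub>M i\<in>I. density lborel (\<lambda>y. ennreal (d i y))) =
    density (\<Pi>\<^sub>M i\<in>I. lborel) (\<lambda>y. \<Prod>i\<in>I. ennreal (d i (y i)))"
proof -
  interpret N: product_sigma_finite "\<lambda>i. density lborel (\<lambda>y. ennreal (d i y))"
    by (intro product_sigma_finite.intro prob_space_imp_sigma_finite prob)
  interpret lb: product_sigma_finite "\<lambda>_::'i. lborel :: real measure"
    by (intro product_sigma_finite.intro sigma_finite_lborel)
  show ?thesis
  proof (rule N.PiM_eqI[symmetric, OF I])
    show "sets (density (\<Pi>\<^sub>M i\<in>I. lborel) (\<lambda>y. \<Prod>i\<in>I. ennreal (d i (y i)))) =
        sets (\<Pi>\<^sub>M i\<in>I. density lborel (\<lambda>y. ennreal (d i y)))"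
      by (simp cong: sets_PiM_cong)
    fix A assume "\<And>i. i \<in> I \<Longrightarrow> A i \<in> sets (density lborel (\<lambda>y. ennreal (d i y)))"
    then have A: "\<And>i. i \<in> I \<Longrightarrow> A i \<in> sets lborel" by simp
    have meas: "(\<lambda>y. \<Prod>i\<in>I. ennreal (d i (y i))) \<in> borel_measurable (\<Pi>\<^sub>M i\<in>I. lborel)"
      by measurable
    have "emeasure (density (\<Pi>\<^sub>M i\<in>I. lborel) (\<lambda>y. \<Prod>i\<in>I. ennreal (d i (y i)))) (Pi\<^sub>E I A) =
        (\<integral>\<^sup>+ y. (\<Prod>i\<in>I. ennreal (d i (y i))) * indicator (Pi\<^sub>E I A) y \<partial>(\<Pi>\<^sub>M i\<in>I. lborel))"
      using A I by (intro emeasure_density meas sets_PiM_I_finite)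
    also have "\<dots> = (\<integral>\<^sup>+ y. (\<Prod>i\<in>I. ennreal (d i (y i)) * indicator (A i) (y i)) \<partial>(\<Pi>\<^sub>M i\<in>I. lborel))"
    proof (intro nn_integral_cong)
      fix y assume y: "y \<in> space (\<Pi>\<^sub>M i\<in>I. lborel :: real measure)"
      have "(\<Prod>i\<in>I. indicator (A i) (y i)) = (indicator (Pi\<^sub>E I A) y :: ennreal)"
      proof (cases "y \<in> Pi\<^sub>E I A")
        case True
        then show ?thesis by (auto simp: PiE_iff indicator_def intro!: prod.neutral)
      next
        case False
        then obtain i where "i \<in> I" "y i \<notin> A i" using y by (auto simp: space_PiM PiE_iff)
        then have "\<exists>i\<in>I. (indicator (A i) (y i) :: ennreal) = 0" by (intro bexI[of _ i]) simp_all
        then show ?thesis using False I by (simp add: prod_zero)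
      qed
      then show "(\<Prod>i\<in>I. ennreal (d i (y i))) * indicator (Pi\<^sub>E I A) y =
          (\<Prod>i\<in>I. ennreal (d i (y i)) * indicator (A i) (y i))"
        by (simp add: prod.distrib)
    qed
    also have "\<dots> = (\<Prod>i\<in>I. \<integral>\<^sup>+ y. ennreal (d i y) * indicator (A i) y \<partial>lborel)"
      using A I by (intro lb.product_nn_integral_prod) auto
    also have "\<dots> = (\<Prod>i\<in>I. emeasure (density lborel (\<lambda>y. ennreal (d i y))) (A i))"
      using A by (intro prod.cong) (auto simp: emeasure_density)
    finally show "emeasure (density (\<Pi>\<^sub>M i\<in>I. lborel) (\<lambda>y. \<Prod>i\<in>I. ennreal (d i (y i)))) (Pi\<^sub>E I A) =
        (\<Prod>i\<in>I. emeasure (density lborel (\<lambda>y. ennreal (d i y))) (A i))" .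
  qed
qed

lemma measure_atoms:
  assumes q: "\<And>j. j \<le> D \<Longrightarrow> q j \<ge> 0" and A: "A \<in> sets borel"
  shows "measure (atoms D t q) A = (\<Sum>j\<le>D. q j * indicator A (t j))"
proof -
  have "emeasure (atoms D t q) A = (\<Sum>j\<le>D. ennreal (q j * indicator A (t j)))"
    unfolding emeasure_atoms[OF A] using q by (intro sum.cong) (auto simp: ennreal_mult' indicator_def)
  also have "\<dots> = ennreal (\<Sum>j\<le>D. q j * indicator A (t j))"
    using q by (intro sum_ennreal) auto
  finally show ?thesis
    by (simp only: measure_def) (intro enn2real_ennreal sum_nonneg mult_nonneg_nonneg, auto intro: q)
qed

section \<open>Assouad's lemma\<close>

definition toggle :: "nat \<Rightarrow> nat set \<Rightarrow> nat set" where
  "toggle k u = (if k \<in> u then u - {k} else insert k u)"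

definition hamming :: "nat \<Rightarrow> nat set \<Rightarrow> nat set \<Rightarrow> real" where
  "hamming m u v = (\<Sum>k<m. of_bool ((k \<in> u) \<noteq> (k \<in> v)))"

lemma toggle_toggle [simp]: "toggle k (toggle k u) = u"
  by (auto simp: toggle_def)

lemma mem_toggle [simp]: "k \<in> toggle k u \<longleftrightarrow> k \<notin> u"
  by (auto simp: toggle_def)

lemma toggle_subset: "k < m \<Longrightarrow> u \<subseteq> {..<m} \<Longrightarrow> toggle k u \<subseteq> {..<m}"
  by (auto simp: toggle_def)

lemma sum_toggle:
  fixes g :: "nat set \<Rightarrow> 'a::comm_monoid_add"
  assumes "k < m"
  shows "(\<Sum>u\<in>Pow {..<m}. g (toggle k u)) = (\<Sum>u\<in>Pow {..<m}. g u)"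
  using toggle_subset[OF assms]
  by (intro sum.reindex_bij_witness[of _ "toggle k" "toggle k"]) auto

text \<open>
  The statistical content of Assouad's lemma, for a fixed value of the data, with likelihoods \<open>Z u\<close>
  and losses \<open>d u\<close>. Let \<open>w\<close> be a vertex of least loss. By \<open>sep\<close> the loss at \<open>u\<close> is at least half of
  \<open>\<kappa>\<close> times the number of coordinates in which \<open>u\<close> and \<open>w\<close> differ. In each coordinate \<open>w\<close> differs from
  exactly one of \<open>u\<close> and its neighbour, so the smaller of the two likelihoods is paid at least once.
  Arguing pointwise in the data avoids any question about the measurability of \<open>w\<close>.
\<close>

lemma assouad_pointwise:
  fixes Z d :: "nat set \<Rightarrow> ennreal"
  assumes \<kappa>: "\<kappa> \<ge> 0"
    and sep: "\<And>u v. u \<subseteq> {..<m} \<Longrightarrow> v \<subseteq> {..<m} \<Longrightarrow> ennreal (\<kappa> * hamming m u v) \<le> d u + d v"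
  shows "ennreal \<kappa> * (\<Sum>k<m. \<Sum>u\<in>Pow {..<m}. min (Z u) (Z (toggle k u)))
    \<le> 4 * (\<Sum>u\<in>Pow {..<m}. Z u * d u)"
proof -
  obtain w where w: "w \<subseteq> {..<m}" "\<And>u. u \<subseteq> {..<m} \<Longrightarrow> d w \<le> d u"
  proof -
    have "Min (d ` Pow {..<m}) \<in> d ` Pow {..<m}" by (intro Min_in) auto
    then obtain w where "w \<in> Pow {..<m}" "Min (d ` Pow {..<m}) = d w" by auto
    then show ?thesis using that[of w] Min_le[of "d ` Pow {..<m}"] by force
  qed
  define b :: "nat \<Rightarrow> nat set \<Rightarrow> ennreal" where "b = (\<lambda>k u. of_bool ((k \<in> u) \<noteq> (k \<in> w)))"
  have ham: "ennreal \<kappa> * (\<Sum>k<m. b k u) \<le> 2 * d u" if "u \<subseteq> {..<m}" for u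
  proof -
    have "(\<Sum>k<m. b k u) = ennreal (hamming m u w)"
    proof -
      have "b k u = ennreal (of_bool ((k \<in> u) \<noteq> (k \<in> w)))" for k by (simp add: b_def)
      then show ?thesis by (simp only: hamming_def) (subst sum_ennreal, auto)
    qed
    then have "ennreal \<kappa> * (\<Sum>k<m. b k u) = ennreal (\<kappa> * hamming m u w)"
      using \<kappa> by (simp add: ennreal_mult hamming_def sum_nonneg)
    also have "\<dots> \<le> d u + d u"
      using sep[OF that w(1)] w(2)[OF that] by (meson add_left_mono order_trans)
    finally show ?thesis by (simp add: mult_2)
  qed
  have coord: "(\<Sum>u\<in>Pow {..<m}. min (Z u) (Z (toggle k u))) \<le> 2 * (\<Sum>u\<in>Pow {..<m}. Z u * b k u)"
    if "k < m" for k
  proof -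
    have "(\<Sum>u\<in>Pow {..<m}. min (Z u) (Z (toggle k u)))
        \<le> (\<Sum>u\<in>Pow {..<m}. Z u * b k u + Z (toggle k u) * b k (toggle k u))"
      by (intro sum_mono) (auto simp: b_def)
    also have "\<dots> = 2 * (\<Sum>u\<in>Pow {..<m}. Z u * b k u)"
      using sum_toggle[OF that, of "\<lambda>u. Z u * b k u"] by (simp add: sum.distrib mult_2)
    finally show ?thesis .
  qed
  have "ennreal \<kappa> * (\<Sum>k<m. \<Sum>u\<in>Pow {..<m}. min (Z u) (Z (toggle k u)))
      \<le> ennreal \<kappa> * (\<Sum>k<m. 2 * (\<Sum>u\<in>Pow {..<m}. Z u * b k u))"
    using coord by (intro mult_left_mono sum_mono) auto
  also have "\<dots> = 2 * (\<Sum>u\<in>Pow {..<m}. Z u * (ennreal \<kappa> * (\<Sum>k<m. b k u)))"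
    by (simp add: sum_distrib_left mult_ac) (subst sum.swap, simp)
  also have "\<dots> \<le> 2 * (\<Sum>u\<in>Pow {..<m}. Z u * (2 * d u))"
    using ham by (intro mult_left_mono sum_mono) auto
  also have "\<dots> = 4 * (\<Sum>u\<in>Pow {..<m}. Z u * d u)"
    by (simp add: sum_distrib_left mult_ac)
  finally show ?thesis .
qed

lemma ennreal_half_le_of_one_le:
  assumes "1 \<le> a + ennreal (1 / 2)"
  shows "ennreal (1 / 2) \<le> a"
proof (cases a)
  case (real r)
  have "ennreal 1 \<le> ennreal r + ennreal (1 / 2)" using assms real by (simp only: ennreal_1)
  also have "\<dots> = ennreal (r + 1 / 2)" using real by (intro ennreal_plus[symmetric]) auto
  finally have "1 / 2 \<le> r" using real by (subst (asm) ennreal_le_iff) auto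
  then show ?thesis unfolding real by (rule ennreal_leI)
qed auto

text \<open>
  Observation \<open>i\<close> is the one at which the regression function is evaluated; the observations in \<open>I\<close>
  serve to identify \<open>u\<close>. Given the latter, the estimator is a function of observation \<open>i\<close> alone and
  its loss is a squared distance in \<open>L\<^sup>2(g)\<close>, to which \<open>assouad_pointwise\<close> applies. Neighbouring
  likelihoods overlap by at least \<open>1/2\<close>, because \<open>min a b \<ge> a - a\<^sup>2 / (4 b)\<close> and the integral of \<open>a\<^sup>2 / b\<close>
  factorises over the observations.
\<close>

lemma assouad_product:
  fixes dens T :: "nat set \<Rightarrow> real \<Rightarrow> real" and e :: "('i \<Rightarrow> real) \<Rightarrow> real"
  assumes [measurable]: "\<And>u. dens u \<in> borel_measurable borel" "\<And>u. T u \<in> borel_measurable borel"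
      "g \<in> borel_measurable borel"
    and pos: "\<And>u x. u \<subseteq> {..<m} \<Longrightarrow> dens u x > 0"
    and one: "\<And>u. u \<subseteq> {..<m} \<Longrightarrow> (\<integral>\<^sup>+ x. ennreal (dens u x) \<partial>lborel) = 1"
    and g: "\<And>x. g x \<ge> 0" "\<And>u x. u \<subseteq> {..<m} \<Longrightarrow> g x \<le> 2 * dens u x"
    and \<kappa>: "\<kappa> \<ge> 0"
    and sep: "\<And>u v. u \<subseteq> {..<m} \<Longrightarrow> v \<subseteq> {..<m} \<Longrightarrow>
      ennreal (\<kappa> * hamming m u v) \<le> (\<integral>\<^sup>+ x. ennreal (g x * (T u x - T v x)\<^sup>2) \<partial>lborel)"
    and I: "finite I" "i \<notin> I"
    and chi: "\<And>u k. u \<subseteq> {..<m} \<Longrightarrow> k < m \<Longrightarrow>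
      (\<integral>\<^sup>+ x. ennreal ((dens u x)\<^sup>2 / dens (toggle k u) x) \<partial>lborel) ^ card I \<le> 2"
    and e [measurable]: "e \<in> borel_measurable (\<Pi>\<^sub>M k\<in>insert i I. lborel)"
  shows "ennreal (2 ^ m * real m * \<kappa> / 32) \<le> (\<Sum>u\<in>Pow {..<m}.
    \<integral>\<^sup>+ y. (\<Prod>k\<in>insert i I. ennreal (dens u (y k))) * ennreal ((e y - T u (y i))\<^sup>2)
      \<partial>(\<Pi>\<^sub>M k\<in>insert i I. lborel))"
proof -
  interpret lb: product_sigma_finite "\<lambda>_::'i. lborel :: real measure"
    by (intro product_sigma_finite.intro sigma_finite_lborel)
  let ?P = "\<Pi>\<^sub>M k\<in>I. lborel :: real measure"
  define Z where "Z = (\<lambda>u y. \<Prod>k\<in>I. ennreal (dens u (y k)))"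
  define d where "d = (\<lambda>u (y::'i \<Rightarrow> real). \<integral>\<^sup>+ x. ennreal (g x * (e (y(i := x)) - T u x)\<^sup>2) \<partial>lborel)"
  define loss where "loss = (\<lambda>u. \<integral>\<^sup>+ y. (\<Prod>k\<in>insert i I. ennreal (dens u (y k))) *
    ennreal ((e y - T u (y i))\<^sup>2) \<partial>(\<Pi>\<^sub>M k\<in>insert i I. lborel))"
  have [measurable]: "Z u \<in> borel_measurable ?P" for u
    unfolding Z_def by measurable
  have [measurable]: "(\<lambda>(y, x). e (y(i := x))) \<in> borel_measurable (?P \<Otimes>\<^sub>M lborel)"
    using measurable_comp[OF measurable_add_dim[of i I "\<lambda>_. lborel"] e] by (simp add: comp_def case_prod_beta)
  have e_section: "(\<lambda>x. e (y(i := x))) \<in> borel_measurable lborel" if "y \<in> space ?P" for y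
    using measurable_Pair2[OF \<open>(\<lambda>(y, x). e (y(i := x))) \<in> borel_measurable (?P \<Otimes>\<^sub>M lborel)\<close> that] by simp
  have [measurable]: "d u \<in> borel_measurable ?P" for u
    unfolding d_def by measurable
  have loss: "(\<integral>\<^sup>+ y. Z u y * d u y \<partial>?P) \<le> 2 * loss u" if u: "u \<subseteq> {..<m}" for u
  proof -
    have "loss u = (\<integral>\<^sup>+ y. \<integral>\<^sup>+ x. (\<Prod>k\<in>insert i I. ennreal (dens u ((y(i := x)) k))) *
        ennreal ((e (y(i := x)) - T u ((y(i := x)) i))\<^sup>2) \<partial>lborel \<partial>?P)"
      unfolding loss_def by (rule lb.product_nn_integral_insert[OF I]) measurable
    also have "\<dots> = (\<integral>\<^sup>+ y. \<integral>\<^sup>+ x. Z u y * ennreal (dens u x * (e (y(i := x)) - T u x)\<^sup>2) \<partial>lborel \<partial>?P)"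
    proof (intro nn_integral_cong)
      fix y x
      have "(\<Prod>k\<in>I. ennreal (dens u ((y(i := x)) k))) = Z u y"
        unfolding Z_def using I by (intro prod.cong) auto
      then show "(\<Prod>k\<in>insert i I. ennreal (dens u ((y(i := x)) k))) *
          ennreal ((e (y(i := x)) - T u ((y(i := x)) i))\<^sup>2) =
          Z u y * ennreal (dens u x * (e (y(i := x)) - T u x)\<^sup>2)"
        using I pos[OF u, of x] by (simp add: ennreal_mult mult_ac del: fun_upd_apply) simp
    qed
    finally have eq: "loss u = (\<integral>\<^sup>+ y. \<integral>\<^sup>+ x. Z u y * ennreal (dens u x * (e (y(i := x)) - T u x)\<^sup>2) \<partial>lborel \<partial>?P)" .
    have "(\<integral>\<^sup>+ y. Z u y * d u y \<partial>?P)
        \<le> (\<integral>\<^sup>+ y. 2 * (\<integral>\<^sup>+ x. Z u y * ennreal (dens u x * (e (y(i := x)) - T u x)\<^sup>2) \<partial>lborel) \<partial>?P)"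
    proof (intro nn_integral_mono)
      fix y assume y: "y \<in> space ?P"
      note [measurable] = e_section[OF y]
      have "Z u y * d u y = (\<integral>\<^sup>+ x. Z u y * ennreal (g x * (e (y(i := x)) - T u x)\<^sup>2) \<partial>lborel)"
        unfolding d_def by (subst nn_integral_cmult) auto
      also have "\<dots> \<le> (\<integral>\<^sup>+ x. 2 * (Z u y * ennreal (dens u x * (e (y(i := x)) - T u x)\<^sup>2)) \<partial>lborel)"
      proof (intro nn_integral_mono)
        fix x
        have "ennreal (g x * (e (y(i := x)) - T u x)\<^sup>2) \<le> ennreal (2 * (dens u x * (e (y(i := x)) - T u x)\<^sup>2))"
          using mult_right_mono[OF g(2)[OF u, of x] zero_le_power2[of "e (y(i := x)) - T u x"]]
          by (intro ennreal_leI) simp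
        also have "\<dots> = 2 * ennreal (dens u x * (e (y(i := x)) - T u x)\<^sup>2)"
          using pos[OF u, of x] by (subst ennreal_mult) auto
        finally show "Z u y * ennreal (g x * (e (y(i := x)) - T u x)\<^sup>2)
            \<le> 2 * (Z u y * ennreal (dens u x * (e (y(i := x)) - T u x)\<^sup>2))"
          unfolding mult.left_commute[of 2] by (rule mult_left_mono) simp
      qed
      also have "\<dots> = 2 * (\<integral>\<^sup>+ x. Z u y * ennreal (dens u x * (e (y(i := x)) - T u x)\<^sup>2) \<partial>lborel)"
        by (rule nn_integral_cmult) measurable
      finally show "Z u y * d u y \<le> 2 * (\<integral>\<^sup>+ x. Z u y * ennreal (dens u x * (e (y(i := x)) - T u x)\<^sup>2) \<partial>lborel)" .
    qed
    also have "\<dots> = 2 * loss u"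
      unfolding eq by (rule nn_integral_cmult) measurable
    finally show ?thesis .
  qed
  have tri: "ennreal (\<kappa> * hamming m u v) \<le> 2 * d u y + 2 * d v y"
    if uv: "u \<subseteq> {..<m}" "v \<subseteq> {..<m}" and y: "y \<in> space ?P" for u v y
  proof -
    note [measurable] = e_section[OF y]
    have "(\<integral>\<^sup>+ x. ennreal (g x * (T u x - T v x)\<^sup>2) \<partial>lborel)
        \<le> (\<integral>\<^sup>+ x. ennreal (2 * (g x * (e (y(i := x)) - T u x)\<^sup>2)) +
            ennreal (2 * (g x * (e (y(i := x)) - T v x)\<^sup>2)) \<partial>lborel)"
    proof (intro nn_integral_mono)
      fix x
      define a b where "a = e (y(i := x)) - T u x" and "b = e (y(i := x)) - T v x"
      have "(T u x - T v x)\<^sup>2 = (b - a)\<^sup>2" by (simp add: a_def b_def)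
      also have "\<dots> \<le> 2 * a\<^sup>2 + 2 * b\<^sup>2"
        using zero_le_power2[of "a + b"] by (simp add: power2_eq_square algebra_simps)
      finally have "g x * (T u x - T v x)\<^sup>2 \<le> g x * (2 * a\<^sup>2 + 2 * b\<^sup>2)"
        using g(1) by (intro mult_left_mono)
      then show "ennreal (g x * (T u x - T v x)\<^sup>2) \<le> ennreal (2 * (g x * (e (y(i := x)) - T u x)\<^sup>2)) +
            ennreal (2 * (g x * (e (y(i := x)) - T v x)\<^sup>2))"
      proof -
        assume le: "g x * (T u x - T v x)\<^sup>2 \<le> g x * (2 * a\<^sup>2 + 2 * b\<^sup>2)"
        have "ennreal (g x * (2 * a\<^sup>2 + 2 * b\<^sup>2)) = ennreal (2 * (g x * a\<^sup>2) + 2 * (g x * b\<^sup>2))"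
          by (simp add: algebra_simps)
        also have "\<dots> = ennreal (2 * (g x * a\<^sup>2)) + ennreal (2 * (g x * b\<^sup>2))"
          using g(1)[of x] by (intro ennreal_plus) auto
        finally show ?thesis using ennreal_leI[OF le] by (simp only: a_def b_def)
      qed
    qed
    also have "\<dots> = 2 * d u y + 2 * d v y"
      using g(1) unfolding d_def by (simp add: nn_integral_add nn_integral_cmult ennreal_mult)
    finally show ?thesis using sep[OF uv] by (rule order_trans[rotated])
  qed
  have overlap: "ennreal (1 / 2) \<le> (\<integral>\<^sup>+ y. min (Z u y) (Z (toggle k u) y) \<partial>?P)"
    if u: "u \<subseteq> {..<m}" and k: "k < m" for u k
  proof -
    define v where "v = toggle k u"
    have v: "v \<subseteq> {..<m}" using toggle_subset[OF k u] by (simp add: v_def)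
    define X where "X = (\<lambda>y. \<Prod>j\<in>I. ennreal ((dens u (y j))\<^sup>2 / dens v (y j)))"
    have [measurable]: "X \<in> borel_measurable ?P" unfolding X_def by measurable
    have total: "(\<integral>\<^sup>+ y. Z u y \<partial>?P) = 1"
      unfolding Z_def using I one[OF u] by (subst lb.product_nn_integral_prod) auto
    have split: "(\<integral>\<^sup>+ y. Z u y \<partial>?P) \<le> (\<integral>\<^sup>+ y. min (Z u y) (Z v y) + ennreal (1 / 4) * X y \<partial>?P)"
    proof (intro nn_integral_mono)
      fix y
      define a b where "a = (\<Prod>j\<in>I. dens u (y j))" and "b = (\<Prod>j\<in>I. dens v (y j))"
      have ab: "a > 0" "b > 0" unfolding a_def b_def using pos[OF u] pos[OF v] by (auto intro: prod_pos)
      have Z: "Z u y = ennreal a" "Z v y = ennreal b"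
        unfolding Z_def a_def b_def using pos[OF u] pos[OF v]
        by (auto intro!: prod_ennreal less_imp_le)
      have "X y = ennreal (\<Prod>j\<in>I. (dens u (y j))\<^sup>2 / dens v (y j))"
        unfolding X_def using pos[OF v] by (intro prod_ennreal divide_nonneg_nonneg) (auto intro: less_imp_le)
      also have "(\<Prod>j\<in>I. (dens u (y j))\<^sup>2 / dens v (y j)) = a\<^sup>2 / b"
        by (simp add: a_def b_def prod_dividef prod_power_distrib)
      finally have X: "X y = ennreal (a\<^sup>2 / b)" .
      have "a \<le> min a b + 1 / 4 * (a\<^sup>2 / b)"
      proof (cases "a \<le> b")
        case False
        \<comment> \<open>Completing the square: \<open>b\<^sup>2 - a b + a\<^sup>2 / 4 = (b - a / 2)\<^sup>2\<close>.\<close>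
        have "0 \<le> (b - a / 2)\<^sup>2 / b" using ab by simp
        also have "\<dots> = b - a + 1 / 4 * (a\<^sup>2 / b)"
          using ab by (simp add: field_simps power2_eq_square)
        finally show ?thesis using False by simp
      qed (use ab in auto)
      then have "ennreal a \<le> ennreal (min a b + 1 / 4 * (a\<^sup>2 / b))" by (rule ennreal_leI)
      also have "\<dots> = ennreal (min a b) + ennreal (1 / 4) * ennreal (a\<^sup>2 / b)"
        using ab by (subst ennreal_mult[symmetric]) (auto intro!: ennreal_plus)
      also have "ennreal (min a b) = min (ennreal a) (ennreal b)"
        using ab by (simp add: min_def ennreal_le_iff)
      finally show "Z u y \<le> min (Z u y) (Z v y) + ennreal (1 / 4) * X y"
        unfolding Z X .
    qed
    have sum: "(\<integral>\<^sup>+ y. min (Z u y) (Z v y) + ennreal (1 / 4) * X y \<partial>?P) =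
        (\<integral>\<^sup>+ y. min (Z u y) (Z v y) \<partial>?P) + ennreal (1 / 4) * (\<integral>\<^sup>+ y. X y \<partial>?P)"
      by (simp add: nn_integral_add nn_integral_cmult)
    have "(\<integral>\<^sup>+ y. X y \<partial>?P) = (\<integral>\<^sup>+ x. ennreal ((dens u x)\<^sup>2 / dens v x) \<partial>lborel) ^ card I"
      unfolding X_def using I by (subst lb.product_nn_integral_prod) auto
    then have "ennreal (1 / 4) * (\<integral>\<^sup>+ y. X y \<partial>?P) \<le> ennreal (1 / 4) * ennreal 2"
      using chi[OF u k] by (intro mult_left_mono) (auto simp: v_def)
    then have "ennreal (1 / 4) * (\<integral>\<^sup>+ y. X y \<partial>?P) \<le> ennreal (1 / 4 * 2)"
      by (simp only: ennreal_mult[of "1 / 4" 2])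
    then have quarter: "ennreal (1 / 4) * (\<integral>\<^sup>+ y. X y \<partial>?P) \<le> ennreal (1 / 2)" by simp
    have "1 \<le> (\<integral>\<^sup>+ y. min (Z u y) (Z v y) \<partial>?P) + ennreal (1 / 4) * (\<integral>\<^sup>+ y. X y \<partial>?P)"
      using split unfolding total sum .
    also have "\<dots> \<le> (\<integral>\<^sup>+ y. min (Z u y) (Z v y) \<partial>?P) + ennreal (1 / 2)"
      using quarter by (rule add_left_mono)
    finally have "1 \<le> (\<integral>\<^sup>+ y. min (Z u y) (Z v y) \<partial>?P) + ennreal (1 / 2)" .
    then show ?thesis unfolding v_def by (rule ennreal_half_le_of_one_le)
  qed
  have "ennreal \<kappa> * (\<Sum>k<m. \<Sum>u\<in>Pow {..<m}. ennreal (1 / 2))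
      \<le> ennreal \<kappa> * (\<Sum>k<m. \<Sum>u\<in>Pow {..<m}. \<integral>\<^sup>+ y. min (Z u y) (Z (toggle k u) y) \<partial>?P)"
    using overlap by (intro mult_left_mono sum_mono) auto
  also have "\<dots> = (\<integral>\<^sup>+ y. ennreal \<kappa> * (\<Sum>k<m. \<Sum>u\<in>Pow {..<m}. min (Z u y) (Z (toggle k u) y)) \<partial>?P)"
    by (simp add: nn_integral_sum nn_integral_cmult)
  also have "\<dots> \<le> (\<integral>\<^sup>+ y. 4 * (\<Sum>u\<in>Pow {..<m}. Z u y * (2 * d u y)) \<partial>?P)"
    using \<kappa> tri by (intro nn_integral_mono assouad_pointwise) auto
  also have "\<dots> = (\<integral>\<^sup>+ y. 8 * (\<Sum>u\<in>Pow {..<m}. Z u y * d u y) \<partial>?P)"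
  proof (intro nn_integral_cong)
    fix y
    have "(\<Sum>u\<in>Pow {..<m}. Z u y * (2 * d u y)) = 2 * (\<Sum>u\<in>Pow {..<m}. Z u y * d u y)"
      by (simp only: sum_distrib_left mult.left_commute)
    then show "4 * (\<Sum>u\<in>Pow {..<m}. Z u y * (2 * d u y)) = 8 * (\<Sum>u\<in>Pow {..<m}. Z u y * d u y)"
      by (simp add: mult.assoc[symmetric])
  qed
  also have "\<dots> = 8 * (\<Sum>u\<in>Pow {..<m}. \<integral>\<^sup>+ y. Z u y * d u y \<partial>?P)"
    by (simp add: nn_integral_sum nn_integral_cmult)
  also have "\<dots> \<le> 8 * (\<Sum>u\<in>Pow {..<m}. 2 * loss u)"
    using loss by (intro mult_left_mono sum_mono) auto
  also have "\<dots> = 16 * (\<Sum>u\<in>Pow {..<m}. loss u)"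
    by (simp add: sum_distrib_left[symmetric] mult.assoc[symmetric])
  finally have *: "ennreal \<kappa> * (\<Sum>k<m. \<Sum>u\<in>Pow {..<m}. ennreal (1 / 2)) \<le> 16 * (\<Sum>u\<in>Pow {..<m}. loss u)" .
  have "ennreal \<kappa> * (\<Sum>k<m. \<Sum>u\<in>Pow {..<m}. ennreal (1 / 2)) = ennreal (16 * (2 ^ m * real m * \<kappa> / 32))"
  proof -
    have "ennreal \<kappa> * (\<Sum>k<m. \<Sum>u\<in>Pow {..<m}. ennreal (1 / 2)) =
        ennreal \<kappa> * (ennreal (real m) * (ennreal (real (2 ^ m)) * ennreal (1 / 2)))"
      by (simp only: sum_constant card_lessThan card_Pow finite_lessThan ennreal_of_nat_eq_real_of_nat)
    also have "\<dots> = ennreal (\<kappa> * (real m * (real (2 ^ m) * (1 / 2))))"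
      by (simp only: ennreal_mult \<kappa> of_nat_0_le_iff mult_nonneg_nonneg zero_le_divide_1_iff zero_le_numeral)
    also have "\<kappa> * (real m * (real (2 ^ m) * (1 / 2))) = 16 * (2 ^ m * real m * \<kappa> / 32)" by simp
    finally show ?thesis .
  qed
  also have "\<dots> = 16 * ennreal (2 ^ m * real m * \<kappa> / 32)"
    using \<kappa> by (subst ennreal_mult) simp_all
  finally have "16 * ennreal (2 ^ m * real m * \<kappa> / 32) \<le> 16 * (\<Sum>u\<in>Pow {..<m}. loss u)"
    using * by simp
  then show ?thesis
    unfolding loss_def[symmetric] by (subst (asm) ennreal_mult_le_mult_iff) auto
qed

section \<open>Finite mixtures of unit Gaussians\<close>

definition mix :: "nat \<Rightarrow> (nat \<Rightarrow> real) \<Rightarrow> (nat \<Rightarrow> real) \<Rightarrow> real \<Rightarrow> real" where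
  "mix D t a y = (\<Sum>j\<le>D. a j * normal_density (t j) 1 y)"

text \<open>
  Posterior mean of \<open>r\<close> given the observation \<open>y\<close>, for the prior with weight \<open>p j\<close> at the atom \<open>t j\<close>;
  functions of the parameter are represented by their values on the atoms. In particular
  \<open>post D t p t\<close> is the Bayes estimator.
\<close>

definition post :: "nat \<Rightarrow> (nat \<Rightarrow> real) \<Rightarrow> (nat \<Rightarrow> real) \<Rightarrow> (nat \<Rightarrow> real) \<Rightarrow> real \<Rightarrow> real" where
  "post D t p r y = mix D t (\<lambda>j. p j * r j) y / mix D t p y"

definition post_cov :: "nat \<Rightarrow> (nat \<Rightarrow> real) \<Rightarrow> (nat \<Rightarrow> real) \<Rightarrow> (nat \<Rightarrow> real) \<Rightarrow> real \<Rightarrow> real" where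
  "post_cov D t p r y = post D t p (\<lambda>j. t j * r j) y - post D t p t y * post D t p r y"

lemma continuous_on_mix [continuous_intros]: "continuous_on S (mix D t a)"
  unfolding mix_def normal_density_def by (intro continuous_intros) auto

lemma borel_measurable_mix [measurable]: "mix D t a \<in> borel_measurable borel"
  by (rule borel_measurable_continuous_onI[OF continuous_on_mix])

lemma has_bochner_integral_mix: "has_bochner_integral lborel (mix D t a) (\<Sum>j\<le>D. a j)"
proof -
  have "has_bochner_integral lborel (\<lambda>y. a j * normal_density (t j) 1 y) (a j * 1)" for j
    using integrable_normal_density[of 1 "t j"] integral_normal_density[of 1 "t j"]
    by (intro has_bochner_integral_mult_right) (simp add: has_bochner_integral_iff)
  then show ?thesis
    unfolding mix_def by (intro has_bochner_integral_sum) simp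
qed

lemma mix_nonneg: "(\<And>j. j \<le> D \<Longrightarrow> a j \<ge> 0) \<Longrightarrow> mix D t a y \<ge> 0"
  unfolding mix_def by (intro sum_nonneg mult_nonneg_nonneg) auto

lemma mix_sum: "mix D t (\<lambda>j. \<Sum>k\<in>K. c k * a k j) y = (\<Sum>k\<in>K. c k * mix D t (a k) y)"
  unfolding mix_def by (simp add: sum_distrib_right sum_distrib_left mult.assoc) (rule sum.swap)

lemma DERIV_normal_density:
  "((\<lambda>y. normal_density s 1 y) has_real_derivative (s - y) * normal_density s 1 y) (at y)"
proof -
  have "((\<lambda>y. exp (- (y - s)\<^sup>2 / 2)) has_real_derivative exp (- (y - s)\<^sup>2 / 2) * (s - y)) (at y)"
    by (auto intro!: derivative_eq_intros simp: field_simps)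
  from DERIV_cmult[OF this, of "1 / sqrt (2 * pi)"]
  show ?thesis by (simp add: normal_density_def algebra_simps diff_divide_distrib)
qed

lemma DERIV_mix:
  "(mix D t a has_real_derivative mix D t (\<lambda>j. a j * t j) y - y * mix D t a y) (at y)"
proof -
  have "(mix D t a has_real_derivative (\<Sum>j\<le>D. a j * ((t j - y) * normal_density (t j) 1 y))) (at y)"
    unfolding mix_def by (intro DERIV_sum DERIV_cmult DERIV_normal_density)
  moreover have "(\<Sum>j\<le>D. a j * ((t j - y) * normal_density (t j) 1 y)) =
      mix D t (\<lambda>j. a j * t j) y - y * mix D t a y"
    by (simp add: mix_def sum_distrib_left sum_subtractf algebra_simps)
  ultimately show ?thesis by simp
qed

lemma normal_density_le_1: "normal_density s 1 y \<le> 1"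
proof -
  have "sqrt (2 * pi) \<ge> sqrt 1" using pi_ge_two by (intro real_sqrt_le_mono) auto
  then have "1 / sqrt (2 * pi) * exp (- (y - s)\<^sup>2 / 2) \<le> 1 * 1"
    by (intro mult_mono) auto
  then show ?thesis by (simp add: normal_density_def)
qed

locale gaussian_mixture =
  fixes D :: nat and t p :: "nat \<Rightarrow> real" and L :: real
  assumes p_pos: "j \<le> D \<Longrightarrow> p j > 0" and p_sum: "(\<Sum>j\<le>D. p j) = 1"
    and t_nonneg: "j \<le> D \<Longrightarrow> t j \<ge> 0" and t_le: "j \<le> D \<Longrightarrow> t j \<le> L"
begin

abbreviation "f0 \<equiv> mix D t p"
abbreviation "E \<equiv> post D t p"
abbreviation "E' \<equiv> post_cov D t p"

lemma f0_pos: "f0 y > 0"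
  unfolding mix_def using p_pos by (intro sum_pos mult_pos_pos normal_density_pos) auto

lemma f0_le_1: "f0 y \<le> 1"
proof -
  have "f0 y \<le> (\<Sum>j\<le>D. p j * 1)"
    unfolding mix_def using p_pos
    by (intro sum_mono mult_left_mono normal_density_le_1) (auto intro: less_imp_le)
  then show ?thesis by (simp add: p_sum)
qed

lemma L_nonneg: "L \<ge> 0"
  using t_nonneg[of 0] t_le[of 0] by simp

lemma post_sum: "E (\<lambda>j. \<Sum>k\<in>K. c k * r k j) y = (\<Sum>k\<in>K. c k * E (r k) y)"
proof -
  have "mix D t (\<lambda>j. p j * (\<Sum>k\<in>K. c k * r k j)) y = mix D t (\<lambda>j. \<Sum>k\<in>K. c k * (p j * r k j)) y"
    by (intro arg_cong[where f = "\<lambda>a. mix D t a y"] ext) (simp add: sum_distrib_left mult_ac)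
  then show ?thesis by (simp add: post_def mix_sum sum_divide_distrib)
qed

lemma post_cov_sum: "E' (\<lambda>j. \<Sum>k\<in>K. c k * r k j) y = (\<Sum>k\<in>K. c k * E' (r k) y)"
proof -
  have "E (\<lambda>j. t j * (\<Sum>k\<in>K. c k * r k j)) y = E (\<lambda>j. \<Sum>k\<in>K. c k * (t j * r k j)) y"
    by (intro arg_cong[where f = "\<lambda>a. E a y"] ext) (simp add: sum_distrib_left mult_ac)
  then show ?thesis
    by (simp add: post_cov_def post_sum right_diff_distrib sum_subtractf sum_distrib_left mult_ac)
qed

lemma abs_post_le:
  assumes "\<And>j. j \<le> D \<Longrightarrow> \<bar>r j\<bar> \<le> B"
  shows "\<bar>E r y\<bar> \<le> B"
proof -
  have "\<bar>mix D t (\<lambda>j. p j * r j) y\<bar> \<le> (\<Sum>j\<le>D. \<bar>p j * r j * normal_density (t j) 1 y\<bar>)"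
    unfolding mix_def by (rule sum_abs)
  also have "\<dots> \<le> (\<Sum>j\<le>D. B * (p j * normal_density (t j) 1 y))"
  proof (intro sum_mono)
    fix j assume "j \<in> {..D}"
    then have "p j * normal_density (t j) 1 y \<ge> 0" "\<bar>r j\<bar> \<le> B"
      using p_pos[of j] assms[of j] by auto
    then have "\<bar>r j\<bar> * (p j * normal_density (t j) 1 y) \<le> B * (p j * normal_density (t j) 1 y)"
      by (intro mult_right_mono) auto
    then show "\<bar>p j * r j * normal_density (t j) 1 y\<bar> \<le> B * (p j * normal_density (t j) 1 y)"
      using p_pos[of j] \<open>j \<in> {..D}\<close> by (simp add: abs_mult mult_ac)
  qed
  also have "\<dots> = B * f0 y" by (simp add: mix_def sum_distrib_left)
  finally show ?thesis using f0_pos[of y] by (simp add: post_def abs_divide divide_le_eq)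
qed

lemma post_t_bounds: "0 \<le> E t y" "E t y \<le> L"
proof -
  have "mix D t (\<lambda>j. p j * t j) y \<ge> 0"
    using p_pos t_nonneg by (intro mix_nonneg mult_nonneg_nonneg) (auto intro: less_imp_le)
  then show "0 \<le> E t y" using f0_pos[of y] by (simp add: post_def)
  have "\<bar>E t y\<bar> \<le> L"
    using t_nonneg t_le by (intro abs_post_le) auto
  then show "E t y \<le> L" by simp
qed

lemma abs_post_cov_le:
  assumes r: "\<And>j. j \<le> D \<Longrightarrow> \<bar>r j\<bar> \<le> B"
  shows "\<bar>E' r y\<bar> \<le> 2 * L * B"
proof -
  have "\<bar>t j * r j\<bar> \<le> L * B" if "j \<le> D" for j
    unfolding abs_mult using that r t_nonneg t_le L_nonneg by (intro mult_mono) auto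
  then have "\<bar>E (\<lambda>j. t j * r j) y\<bar> \<le> L * B"
    by (rule abs_post_le)
  moreover have "\<bar>E t y * E r y\<bar> \<le> L * B"
    unfolding abs_mult using abs_post_le[of r B y, OF r] post_t_bounds[of y] L_nonneg
    by (intro mult_mono) auto
  ultimately show ?thesis unfolding post_cov_def by linarith
qed

text \<open>
  The Gaussian kernel satisfies \<open>\<partial>\<^sub>y \<phi>(y - t) = (t - y) \<phi>(y - t)\<close>. Under the posterior mean the term with
  \<open>y\<close> cancels and the covariance with the parameter is left.
\<close>

lemma DERIV_post: "(E r has_real_derivative E' r y) (at y)"
proof -
  let ?n = "mix D t (\<lambda>j. p j * r j)"
  let ?d = "((mix D t (\<lambda>j. p j * r j * t j) y - y * ?n y) * f0 y -
        ?n y * (mix D t (\<lambda>j. p j * t j) y - y * f0 y)) / (f0 y * f0 y)"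
  have "((\<lambda>y. ?n y / f0 y) has_real_derivative ?d) (at y)"
    using f0_pos[of y] by (intro DERIV_divide DERIV_mix) auto
  moreover have "(\<lambda>j. p j * r j * t j) = (\<lambda>j. p j * (t j * r j))"
    by (simp add: mult_ac)
  then have "?d = E' r y"
    using f0_pos[of y] by (simp add: post_cov_def post_def field_simps)
  ultimately show ?thesis unfolding post_def[abs_def] by simp
qed

lemma DERIV_f0: "(f0 has_real_derivative (E t y - y) * f0 y) (at y)"
  using DERIV_mix[of D t p y] f0_pos[of y]
  by (simp add: post_def left_diff_distrib)

lemma continuous_on_post [continuous_intros]: "continuous_on S (E r)"
  using DERIV_post by (intro DERIV_continuous_on) (auto intro: DERIV_subset)

lemma continuous_on_post_cov [continuous_intros]: "continuous_on S (E' r)"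
  unfolding post_cov_def by (intro continuous_intros)

lemma borel_measurable_post [measurable]: "E r \<in> borel_measurable borel"
  by (rule borel_measurable_continuous_onI[OF continuous_on_post])

lemma borel_measurable_post_cov [measurable]: "E' r \<in> borel_measurable borel"
  by (rule borel_measurable_continuous_onI[OF continuous_on_post_cov])

lemma integrable_bounded_times_f0:
  assumes [measurable]: "g \<in> borel_measurable borel" and "\<And>y. \<bar>g y\<bar> \<le> B"
  shows "integrable lborel (\<lambda>y. g y * f0 y)"
proof (rule Bochner_Integration.integrable_bound)
  show "integrable lborel (\<lambda>y. B * f0 y)"
    using has_bochner_integral_mix[of D t p] by (auto simp: has_bochner_integral_iff)
  show "AE y in lborel. norm (g y * f0 y) \<le> norm (B * f0 y)"
    using assms(2) f0_pos by (auto simp: abs_mult intro!: AE_I2 mult_right_mono order_trans[OF assms(2)])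
qed measurable

lemma bounded_on_atoms: "\<exists>B. \<forall>j\<le>D. \<bar>r j :: real\<bar> \<le> B"
  by (intro exI[of _ "\<Sum>j\<le>D. \<bar>r j\<bar>"] allI impI member_le_sum) auto

lemma integrable_post_times_post: "integrable lborel (\<lambda>y. E r y * E r' y * f0 y)"
proof -
  obtain B B' where B: "\<And>j. j \<le> D \<Longrightarrow> \<bar>r j\<bar> \<le> B" "\<And>j. j \<le> D \<Longrightarrow> \<bar>r' j\<bar> \<le> B'"
    using bounded_on_atoms[of r] bounded_on_atoms[of r'] by blast
  have "B \<ge> 0" using B(1)[of 0] by simp
  have "\<bar>E r y * E r' y\<bar> \<le> B * B'" for y
    unfolding abs_mult using abs_post_le[of r B y, OF B(1)] abs_post_le[of r' B' y, OF B(2)] \<open>B \<ge> 0\<close>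
    by (intro mult_mono) auto
  then show ?thesis by (intro integrable_bounded_times_f0) measurable
qed

lemma integrable_post_cov_sq: "integrable lborel (\<lambda>y. (E' r y)\<^sup>2 * f0 y)"
proof -
  obtain B where B: "\<And>j. j \<le> D \<Longrightarrow> \<bar>r j\<bar> \<le> B"
    using bounded_on_atoms[of r] by blast
  have "\<bar>(E' r y)\<^sup>2\<bar> \<le> (2 * L * B)\<^sup>2" for y
    using power_mono[OF abs_post_cov_le[of r B y, OF B] abs_ge_zero, of 2] by simp
  then show ?thesis by (intro integrable_bounded_times_f0) measurable
qed

end

section \<open>A Poincare inequality for functions that vanish on a grid\<close>

context gaussian_mixture
begin

text \<open>
  Integrate the derivative of \<open>H = g\<^sup>2 f0 \<rho>\<close> with \<open>g = E r\<close>. Since \<open>f0' = (E t y - y) f0\<close>, the condition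
  \<open>drift\<close> says that \<open>(f0 \<rho>)' \<le> - W f0\<close>, so \<open>W\<close> times the integral of \<open>g\<^sup>2 f0\<close> is controlled by the mixed
  term \<open>2 g g' f0 \<rho>\<close>. That term splits by the inequality between the arithmetic and geometric means.
  The zero of \<open>g\<close> at one end gives the increment of \<open>H\<close> the right sign.
\<close>

lemma poincare_interval:
  assumes ab: "a \<le> b" and W: "W > 0"
    and \<rho>: "\<And>y. (\<rho> has_real_derivative \<rho>' y) (at y)"
    and bound: "\<And>y. y \<in> {a..b} \<Longrightarrow> \<bar>\<rho> y\<bar> \<le> C"
    and drift: "\<And>y. y \<in> {a..b} \<Longrightarrow> \<rho>' y + \<rho> y * (E t y - y) \<le> - W"
    and bdry: "\<rho> a \<ge> 0 \<and> \<rho> b \<ge> 0 \<and> E r a = 0 \<or> \<rho> a \<le> 0 \<and> \<rho> b \<le> 0 \<and> E r b = 0"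
  shows "0 \<le> integral {a..b} (\<lambda>y. (4 * C\<^sup>2 / W\<^sup>2 * (E' r y)\<^sup>2 - (E r y)\<^sup>2) * f0 y)"
proof -
  define H where "H = (\<lambda>y. (E r y)\<^sup>2 * f0 y * \<rho> y)"
  define h where "h = (\<lambda>y. (2 * E r y * E' r y * \<rho> y + (E r y)\<^sup>2 * (\<rho>' y + \<rho> y * (E t y - y))) * f0 y)"
  define k where "k = (\<lambda>y. (4 * C\<^sup>2 / W\<^sup>2 * (E' r y)\<^sup>2 - (E r y)\<^sup>2) * f0 y)"
  have "(H has_real_derivative h y) (at y)" for y
    unfolding H_def h_def
    by (rule DERIV_cong[OF DERIV_mult[OF DERIV_mult[OF DERIV_power[OF DERIV_post, where n = 2] DERIV_f0] \<rho>]])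
       (simp add: algebra_simps power2_eq_square)
  then have "(h has_integral H b - H a) {a..b}"
    using ab by (intro fundamental_theorem_of_calculus)
      (auto simp: has_real_derivative_iff_has_vector_derivative[symmetric] intro: DERIV_subset)
  moreover have "(k has_integral integral {a..b} k) {a..b}"
    unfolding k_def by (intro integrable_integral integrable_continuous_interval continuous_intros)
  then have "((\<lambda>y. W / 2 * k y) has_integral W / 2 * integral {a..b} k) {a..b}"
    by (rule has_integral_mult_right)
  ultimately have "H b - H a \<le> W / 2 * integral {a..b} k"
  proof (rule has_integral_le)
    fix y assume y: "y \<in> {a..b}"
    define u v where "u = E r y" and "v = E' r y"
    have "C \<ge> 0" using bound[OF y] by simp
    have "2 * u * v * \<rho> y \<le> 2 * \<bar>u\<bar> * \<bar>v\<bar> * C"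
    proof -
      have "2 * u * v * \<rho> y \<le> 2 * \<bar>u\<bar> * \<bar>v\<bar> * \<bar>\<rho> y\<bar>"
        using abs_ge_self[of "2 * u * v * \<rho> y"] by (simp add: abs_mult)
      also have "\<dots> \<le> 2 * \<bar>u\<bar> * \<bar>v\<bar> * C"
        using bound[OF y] by (intro mult_left_mono) auto
      finally show ?thesis .
    qed
    also have "\<dots> \<le> W / 2 * u\<^sup>2 + 2 * C\<^sup>2 / W * v\<^sup>2"
    proof -
      have "0 \<le> (W * \<bar>u\<bar> - 2 * C * \<bar>v\<bar>)\<^sup>2" by simp
      then have "4 * W * C * \<bar>u\<bar> * \<bar>v\<bar> \<le> W\<^sup>2 * u\<^sup>2 + 4 * C\<^sup>2 * v\<^sup>2"
        by (simp add: power2_diff power_mult_distrib algebra_simps)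
      then show ?thesis using W by (simp add: field_simps power2_eq_square)
    qed
    finally have "2 * u * v * \<rho> y \<le> W / 2 * u\<^sup>2 + 2 * C\<^sup>2 / W * v\<^sup>2" .
    moreover have "u\<^sup>2 * (\<rho>' y + \<rho> y * (E t y - y)) \<le> u\<^sup>2 * (- W)"
      using drift[OF y] by (intro mult_left_mono) auto
    ultimately have "2 * u * v * \<rho> y + u\<^sup>2 * (\<rho>' y + \<rho> y * (E t y - y))
        \<le> (W / 2 * u\<^sup>2 + 2 * C\<^sup>2 / W * v\<^sup>2) + u\<^sup>2 * (- W)"
      by (rule add_mono)
    also have "\<dots> = W / 2 * (4 * C\<^sup>2 / W\<^sup>2 * v\<^sup>2 - u\<^sup>2)"
      using W by (simp add: field_simps power2_eq_square)
    finally have "2 * u * v * \<rho> y + u\<^sup>2 * (\<rho>' y + \<rho> y * (E t y - y))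
        \<le> W / 2 * (4 * C\<^sup>2 / W\<^sup>2 * v\<^sup>2 - u\<^sup>2)" .
    from mult_right_mono[OF this less_imp_le[OF f0_pos[of y]]]
    show "h y \<le> W / 2 * k y"
      unfolding h_def k_def u_def v_def by (simp add: mult.assoc)
  qed
  moreover have "H a \<le> H b"
    using bdry f0_pos[of a] f0_pos[of b]
    by (auto simp: H_def mult_nonneg_nonneg mult_nonneg_nonpos less_imp_le)
  ultimately have "0 \<le> W / 2 * integral {a..b} k" by linarith
  then show ?thesis using W by (simp add: k_def zero_le_mult_iff)
qed

text \<open>
  The drift \<open>E t y - y\<close> lies between \<open>-3 sqrt m\<close> and \<open>3 sqrt m\<close> for \<open>\<bar>y\<bar> \<le> 2 sqrt m\<close>. On a grid cell of
  length \<open>1 / sqrt m\<close> a weight \<open>\<rho>\<close> that decays at rate \<open>4 sqrt m\<close> overcomes it and stays between \<open>1\<close> and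
  \<open>exp 4\<close>. Beyond the grid the drift itself points towards the origin with strength at least \<open>sqrt m\<close>,
  so that constant weights \<open>1\<close> and \<open>-1\<close> suffice.
\<close>

lemma poincare_grid:
  assumes m: "m > 0" and L: "L \<le> sqrt m"
    and zero: "\<And>j. j \<le> 4 * m \<Longrightarrow> E r ((real j - 2 * real m) / sqrt m) = 0"
  shows "(\<integral>y. (E r y)\<^sup>2 * f0 y \<partial>lborel) \<le> 4 * exp 8 / m * (\<integral>y. (E' r y)\<^sup>2 * f0 y \<partial>lborel)"
proof -
  define s where "s = sqrt (real m)"
  define \<gamma> where "\<gamma> = (\<lambda>j::nat. (real j - 2 * real m) / s)"
  define k where "k = (\<lambda>y. (4 * exp 8 / real m * (E' r y)\<^sup>2 - (E r y)\<^sup>2) * f0 y)"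
  have s: "s > 0" "s\<^sup>2 = real m" "s * s = real m" using m by (auto simp: s_def)
  have zero': "E r (\<gamma> j) = 0" if "j \<le> 4 * m" for j
    using zero[OF that] by (simp add: \<gamma>_def s_def)
  have \<gamma>0: "\<gamma> 0 = - 2 * s" and \<gamma>m: "\<gamma> (4 * m) = 2 * s"
    using s by (auto simp: \<gamma>_def field_simps)
  have e8: "(exp 4 :: real)\<^sup>2 = exp 8"
    by (simp add: power2_eq_square exp_add[symmetric])
  have Et: "0 \<le> E t y" "E t y \<le> s" for y
    using post_t_bounds[of y] L by (auto simp: s_def)
  have kint: "k integrable_on {a..b}" for a b
    unfolding k_def by (intro integrable_continuous_interval continuous_intros)
  have piece: "0 \<le> integral {a..b} k"
    if "a \<le> b" "\<And>y. (\<rho> has_real_derivative \<rho>' y) (at y)"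
      "\<And>y. y \<in> {a..b} \<Longrightarrow> \<bar>\<rho> y\<bar> \<le> exp 4"
      "\<And>y. y \<in> {a..b} \<Longrightarrow> \<rho>' y + \<rho> y * (E t y - y) \<le> - s"
      "\<rho> a \<ge> 0 \<and> \<rho> b \<ge> 0 \<and> E r a = 0 \<or> \<rho> a \<le> 0 \<and> \<rho> b \<le> 0 \<and> E r b = 0" for a b \<rho> \<rho>'
    using poincare_interval[OF that(1) s(1) that(2-5)] by (simp add: k_def s e8)
  have right: "0 \<le> integral {2 * s..R} k" if "R \<ge> 2 * s" for R
  proof (rule piece[of _ _ "\<lambda>_. 1" "\<lambda>_. 0"])
    show "0 + 1 * (E t y - y) \<le> - s" if "y \<in> {2 * s..R}" for y
      using that Et(2)[of y] by simp
  qed (use that zero'[of "4 * m"] \<gamma>m in auto)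
  have left: "0 \<le> integral {-R..- 2 * s} k" if "R \<ge> 2 * s" for R
  proof (rule piece[of _ _ "\<lambda>_. - 1" "\<lambda>_. 0"])
    show "0 + - 1 * (E t y - y) \<le> - s" if "y \<in> {-R..- 2 * s}" for y
      using that Et(1)[of y] s(1) by simp
  qed (use that zero'[of 0] \<gamma>0 in auto)
  \<comment> \<open>A positive weight needs the zero of \<open>E r\<close> at the left end of the cell.\<close>
  have inner: "0 \<le> integral {\<gamma> j..\<gamma> (Suc j)} k" if j: "j < 4 * m" for j
  proof (rule piece[of _ _ "\<lambda>y. exp (4 * s * (\<gamma> (Suc j) - y))" "\<lambda>y. - 4 * s * exp (4 * s * (\<gamma> (Suc j) - y))"])
    have d: "\<gamma> (Suc j) - \<gamma> j = 1 / s" by (simp add: \<gamma>_def diff_divide_distrib[symmetric])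
    show "\<gamma> j \<le> \<gamma> (Suc j)" using d s(1) by (smt (verit) zero_less_divide_1_iff)
    show "((\<lambda>y. exp (4 * s * (\<gamma> (Suc j) - y))) has_real_derivative
        - 4 * s * exp (4 * s * (\<gamma> (Suc j) - y))) (at y)" for y
      by (auto intro!: derivative_eq_intros)
    show "0 \<le> exp (4 * s * (\<gamma> (Suc j) - \<gamma> j)) \<and> 0 \<le> exp (4 * s * (\<gamma> (Suc j) - \<gamma> (Suc j))) \<and> E r (\<gamma> j) = 0 \<or>
        exp (4 * s * (\<gamma> (Suc j) - \<gamma> j)) \<le> 0 \<and> exp (4 * s * (\<gamma> (Suc j) - \<gamma> (Suc j))) \<le> 0 \<and> E r (\<gamma> (Suc j)) = 0"
      using zero'[of j] j by simp
    fix y assume y: "y \<in> {\<gamma> j..\<gamma> (Suc j)}"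
    have "4 * s * (\<gamma> (Suc j) - y) \<le> 4 * s * (1 / s)"
      using y d s(1) by (intro mult_left_mono) auto
    then show "\<bar>exp (4 * s * (\<gamma> (Suc j) - y))\<bar> \<le> exp 4" using s(1) by simp
    have "\<gamma> 0 \<le> \<gamma> j" using s(1) by (simp add: \<gamma>_def field_simps)
    then have "E t y - y \<le> 3 * s" using y \<gamma>0 Et(2)[of y] by auto
    moreover define e where "e = exp (4 * s * (\<gamma> (Suc j) - y))"
    moreover have "e \<ge> 1" using y s(1) by (auto simp: e_def)
    ultimately have "e * (E t y - y) \<le> e * (3 * s)" "s * 1 \<le> s * e"
      using s(1) by (intro mult_left_mono; simp)+
    then show "- 4 * s * exp (4 * s * (\<gamma> (Suc j) - y)) + exp (4 * s * (\<gamma> (Suc j) - y)) * (E t y - y) \<le> - s"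
      unfolding e_def[symmetric] by (simp add: algebra_simps)
  qed
  have mid: "0 \<le> integral {\<gamma> 0..\<gamma> j} k" if "j \<le> 4 * m" for j
    using that
  proof (induction j)
    case (Suc j)
    have "\<gamma> 0 \<le> \<gamma> j" "\<gamma> j \<le> \<gamma> (Suc j)" using s(1) by (simp_all add: \<gamma>_def field_simps)
    from Henstock_Kurzweil_Integration.integral_combine[OF this kint]
    show ?case using Suc inner[of j] by simp
  qed simp
  have all: "0 \<le> integral {-R..R} k" if R: "R \<ge> 2 * s" for R
  proof -
    have "integral {-R..- 2 * s} k + integral {- 2 * s..R} k = integral {-R..R} k"
      using R s(1) by (intro Henstock_Kurzweil_Integration.integral_combine kint) auto
    moreover have "integral {- 2 * s..2 * s} k + integral {2 * s..R} k = integral {- 2 * s..R} k"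
      using R s(1) by (intro Henstock_Kurzweil_Integration.integral_combine kint) auto
    ultimately show ?thesis
      using left[OF R] right[OF R] mid[of "4 * m"] \<gamma>0 \<gamma>m by simp
  qed
  have sq: "integrable lborel (\<lambda>y. (E r y)\<^sup>2 * f0 y)"
    using integrable_post_times_post[of r r] by (simp add: power2_eq_square)
  have kk: "integrable lborel k"
    unfolding k_def left_diff_distrib
    using sq integrable_mult_right[OF integrable_post_cov_sq[of r], of "4 * exp 8 / real m"]
    by (intro Bochner_Integration.integrable_diff) (simp_all add: mult.assoc)
  have "(\<lambda>n. \<integral>y. k y * indicator {- real n..real n} y \<partial>lborel) \<longlonglongrightarrow> (\<integral>y. k y \<partial>lborel)"
  proof (rule integral_dominated_convergence[where w = "\<lambda>y. \<bar>k y\<bar>"])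
    have [measurable]: "k \<in> borel_measurable borel" unfolding k_def by measurable
    show "k \<in> borel_measurable lborel" by simp
    show "(\<lambda>y. k y * indicator {- real n..real n} y) \<in> borel_measurable lborel" for n by simp
    show "integrable lborel (\<lambda>y. \<bar>k y\<bar>)" using kk by simp
    show "AE y in lborel. (\<lambda>n. k y * indicator {- real n..real n} y) \<longlonglongrightarrow> k y"
    proof (intro AE_I2 tendsto_eventually)
      fix y
      show "\<forall>\<^sub>F n in sequentially. k y * indicator {- real n..real n} y = k y"
        using eventually_ge_at_top[of "nat \<lceil>\<bar>y\<bar>\<rceil>"]
      proof eventually_elim
        case (elim n)
        then have "\<bar>y\<bar> \<le> real n" by (simp add: nat_le_iff ceiling_le_iff)
        then show ?case by (auto simp: indicator_def)
      qed
    qed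
    show "AE y in lborel. norm (k y * indicator {- real n..real n} y) \<le> \<bar>k y\<bar>" for n
      by (auto simp: indicator_def)
  qed
  moreover have "\<forall>\<^sub>F n in sequentially. 0 \<le> (\<integral>y. k y * indicator {- real n..real n} y \<partial>lborel)"
    using eventually_ge_at_top[of "nat \<lceil>2 * s\<rceil>"]
  proof eventually_elim
    case (elim n)
    then have "2 * s \<le> real n" by (simp add: nat_le_iff ceiling_le_iff)
    have "set_integrable lborel {- real n..real n} k"
      unfolding set_integrable_def by (rule integrable_mult_indicator[OF _ kk]) simp
    from set_borel_integral_eq_integral(2)[OF this] all[OF \<open>2 * s \<le> real n\<close>]
    show ?case by (simp add: set_lebesgue_integral_def mult.commute)
  qed
  ultimately have "0 \<le> (\<integral>y. k y \<partial>lborel)"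
    by (rule tendsto_lowerbound) simp
  also have "(\<integral>y. k y \<partial>lborel) = 4 * exp 8 / real m * (\<integral>y. (E' r y)\<^sup>2 * f0 y \<partial>lborel) - (\<integral>y. (E r y)\<^sup>2 * f0 y \<partial>lborel)"
    unfolding k_def left_diff_distrib
    using sq integrable_mult_right[OF integrable_post_cov_sq[of r], of "4 * exp 8 / real m"]
    by (subst Bochner_Integration.integral_diff) (simp_all add: mult.assoc)
  finally show ?thesis by simp
qed

end

section \<open>Amplitudes of the perturbations\<close>

text \<open>
  Equal spacing of the atoms is what turns the mixture into a polynomial, because
  \<open>\<phi>(y - t) = \<phi>(y) exp (- t\<^sup>2 / 2) exp (t y)\<close>.
\<close>

lemma mix_eq_poly:
  assumes "\<And>j. j \<le> D \<Longrightarrow> t j = real j * \<eta>"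
  shows "mix D t a y = normal_density 0 1 y *
    poly (\<Sum>j\<le>D. monom (a j * exp (- (t j)\<^sup>2 / 2)) j) (exp (\<eta> * y))"
proof -
  have step: "a j * normal_density (t j) 1 y =
      normal_density 0 1 y * (a j * exp (- (t j)\<^sup>2 / 2) * exp (\<eta> * y) ^ j)" if "j \<le> D" for j
  proof -
    have "exp (- (y - t j)\<^sup>2 / 2) = exp (- y\<^sup>2 / 2) * exp (- (t j)\<^sup>2 / 2) * exp (real j * (\<eta> * y))"
      unfolding exp_add[symmetric] assms[OF that] by (simp add: power2_eq_square algebra_simps diff_divide_distrib add_divide_distrib)
    then show ?thesis by (simp add: normal_density_def exp_of_nat_mult)
  qed
  show ?thesis
    unfolding mix_def poly_sum poly_monom sum_distrib_left by (intro sum.cong refl step) simp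
qed

context gaussian_mixture
begin

text \<open>
  A minimum over the interval is at most the average. The factor \<open>f0\<close> costs nothing, since
  \<open>f0 \<le> 1\<close> makes \<open>(f0 \<cdot> E r)\<^sup>2 \<le> (E r)\<^sup>2 f0\<close>.
\<close>

lemma exists_point_le_average:
  assumes ab: "a < b"
  shows "\<exists>y\<in>{a..b}. (mix D t (\<lambda>j. p j * r j) y)\<^sup>2 * (b - a) \<le> (\<integral>y. (E r y)\<^sup>2 * f0 y \<partial>lborel)"
proof -
  define A where "A = mix D t (\<lambda>j. p j * r j)"
  have "continuous_on {a..b} (\<lambda>y. (A y)\<^sup>2)"
    unfolding A_def by (intro continuous_intros)
  then obtain y where y: "y \<in> {a..b}" "\<And>z. z \<in> {a..b} \<Longrightarrow> (A y)\<^sup>2 \<le> (A z)\<^sup>2"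
    using continuous_attains_inf[of "{a..b}" "\<lambda>y. (A y)\<^sup>2"] ab by auto
  have A: "(A z)\<^sup>2 \<le> (E r z)\<^sup>2 * f0 z" for z
  proof -
    have "(A z)\<^sup>2 = (E r z)\<^sup>2 * f0 z * f0 z"
      using f0_pos[of z] by (simp add: post_def A_def power2_eq_square)
    also have "\<dots> \<le> (E r z)\<^sup>2 * f0 z * 1"
      using f0_le_1[of z] f0_pos[of z] by (intro mult_left_mono) auto
    finally show ?thesis by simp
  qed
  have "(A y)\<^sup>2 * (b - a) = (\<integral>z. (A y)\<^sup>2 * indicator {a..b} z \<partial>lborel)"
    using ab by simp
  also have "\<dots> \<le> (\<integral>z. (E r z)\<^sup>2 * f0 z \<partial>lborel)"
  proof (intro integral_mono)
    show "integrable lborel (\<lambda>z. (A y)\<^sup>2 * indicator {a..b} z)"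
      by (intro integrable_mult_right) (use ab in \<open>simp add: integrable_indicator_iff\<close>)
    show "integrable lborel (\<lambda>z. (E r z)\<^sup>2 * f0 z)"
      using integrable_post_times_post[of r r] by (simp add: power2_eq_square)
    show "(A y)\<^sup>2 * indicator {a..b} z \<le> (E r z)\<^sup>2 * f0 z" for z
      using y(2)[of z] A[of z] f0_pos[of z] by (auto simp: indicator_def intro: order_trans)
  qed
  finally show ?thesis using y(1) by (auto simp: A_def)
qed

text \<open>
  Quantitative injectivity of \<open>E\<close>. On \<open>[0, L]\<close> choose one point in every second of \<open>2 D + 2\<close> intervals of
  length \<open>l\<close>, such that \<open>f0 \<cdot> E r\<close> is small there. The interpolation nodes \<open>exp (\<eta> y)\<close> are then separated by
  \<open>\<eta> l\<close> times the difference of their indices, and the coefficients of the polynomial in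
  \<open>mix_eq_poly\<close> are bounded by its values there.
\<close>

lemma abs_coefficient_le_post_norm:
  assumes D: "D > 0" and L: "L > 0" and t: "\<And>j. j \<le> D \<Longrightarrow> t j = real j * (L / D)"
    and pmin: "pmin > 0" "\<And>j. j \<le> D \<Longrightarrow> p j \<ge> pmin" and j: "j \<le> D"
  defines "l \<equiv> L / (2 * real D + 2)"
  shows "\<bar>r j\<bar> \<le> (real D + 1) * (3 * exp (L\<^sup>2) * (1 + exp (L\<^sup>2 / D)) ^ D * (2 * exp 1 / (L * l)) ^ D / pmin)
    * sqrt ((\<integral>y. (E r y)\<^sup>2 * f0 y \<partial>lborel) / l)"
proof -
  define N where "N = (\<integral>y. (E r y)\<^sup>2 * f0 y \<partial>lborel)"
  define \<eta> where "\<eta> = L / real D"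
  define A where "A = mix D t (\<lambda>j. p j * r j)"
  have \<eta>: "\<eta> > 0" and l: "l > 0" "l * (2 * real D + 2) = L" using D L by (auto simp: \<eta>_def l_def)
  have "\<exists>y\<in>{2 * real i * l..(2 * real i + 1) * l}. (A y)\<^sup>2 * l \<le> N" for i
    using exists_point_le_average[of "2 * real i * l" "(2 * real i + 1) * l" r] l
    by (simp add: A_def N_def algebra_simps)
  then obtain y where y: "\<And>i. y i \<in> {2 * real i * l..(2 * real i + 1) * l}"
    and Ay: "\<And>i. (A (y i))\<^sup>2 * l \<le> N" by metis
  have y0: "y i \<ge> 0" for i using order_trans[of 0 "2 * real i * l" "y i"] y[of i] l by simp
  have yL: "y i \<le> L" if "i \<le> D" for i
  proof -
    have "y i \<le> (2 * real i + 1) * l" using y[of i] by simp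
    also have "\<dots> \<le> (2 * real D + 2) * l" using that l by (intro mult_right_mono) auto
    finally show ?thesis using l by (simp add: mult.commute)
  qed
  define x where "x = (\<lambda>i. exp (\<eta> * y i))"
  define P where "P = (\<Sum>j\<le>D. monom (p j * r j * exp (- (t j)\<^sup>2 / 2)) j)"
  define M where "M = 3 * exp (L\<^sup>2 / 2) * sqrt (N / l)"
  have dist1: "\<eta> * l * (real i - real k) \<le> x i - x k" if "k < i" for i k
  proof -
    have "l * (real i - real k) \<le> 2 * real i * l - (2 * real k + 1) * l"
    proof -
      have "l * 1 \<le> l * (real i - real k)" using that l by (intro mult_left_mono) auto
      then show ?thesis by (simp add: algebra_simps)
    qed
    also have "\<dots> \<le> y i - y k" using y[of i] y[of k] by auto
    finally have *: "l * (real i - real k) \<le> y i - y k" .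
    have "0 \<le> l * (real i - real k)" using that l by (intro mult_nonneg_nonneg) auto
    then have yy: "y i - y k \<ge> 0" using * by linarith
    have "\<eta> * (l * (real i - real k)) \<le> \<eta> * (y i - y k)" using * \<eta> by (intro mult_left_mono) auto
    also have "\<dots> \<le> exp (\<eta> * (y i - y k)) - 1" using exp_ge_add_one_self[of "\<eta> * (y i - y k)"] by linarith
    also have "\<dots> \<le> x k * (exp (\<eta> * (y i - y k)) - 1)"
    proof -
      have "1 * (exp (\<eta> * (y i - y k)) - 1) \<le> x k * (exp (\<eta> * (y i - y k)) - 1)"
        using \<eta> y0[of k] yy by (intro mult_right_mono) (auto simp: x_def)
      then show ?thesis by simp
    qed
    also have "\<dots> = x i - x k"
      by (simp add: x_def right_diff_distrib exp_add[symmetric])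
    finally show ?thesis by (simp add: mult_ac)
  qed
  have dist: "\<eta> * l * \<bar>real i - real k\<bar> \<le> \<bar>x i - x k\<bar>" for i k
    using dist1[of k i] dist1[of i k] by (cases i k rule: linorder_cases) auto
  have bound: "\<bar>coeff P j\<bar> \<le> real (D + 1) * (M * (1 + exp (L\<^sup>2 / D)) ^ D / ((\<eta> * l) ^ D * real D ^ D / (2 * exp 1) ^ D))"
  proof (rule abs_coeff_le_values)
    show "degree P \<le> D"
      unfolding P_def by (intro degree_sum_le) (auto intro: order_trans[OF degree_monom_le])
    show "inj_on x {..D}"
    proof (rule inj_onI)
      fix i k assume "x i = x k"
      then have "\<eta> * l * \<bar>real i - real k\<bar> \<le> 0" using dist[of i k] by simp
      then show "i = k" using \<eta> l by (auto simp: mult_le_0_iff not_le)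
    qed
    show "\<bar>x i\<bar> \<le> exp (L\<^sup>2 / D)" if "i \<le> D" for i
    proof -
      have "\<eta> * y i \<le> \<eta> * L" using yL[OF that] \<eta> by (intro mult_left_mono) auto
      then show ?thesis by (simp add: x_def \<eta>_def power2_eq_square)
    qed
    show "\<bar>poly P (x i)\<bar> \<le> M" if "i \<le> D" for i
    proof -
      have "A (y i) = normal_density 0 1 (y i) * poly P (x i)"
        unfolding A_def P_def x_def using t by (intro mix_eq_poly) (simp add: \<eta>_def)
      then have "\<bar>poly P (x i)\<bar> = \<bar>A (y i)\<bar> * (1 / normal_density 0 1 (y i))"
        using normal_density_pos[of 1 0 "y i"] by (simp add: abs_mult)
      moreover have "1 / normal_density 0 1 (y i) \<le> 3 * exp (L\<^sup>2 / 2)"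
      proof -
        have "sqrt (2 * pi) \<le> sqrt (3\<^sup>2)" using pi_less_4 by (intro real_sqrt_le_mono) simp
        moreover have "exp ((y i)\<^sup>2 / 2) \<le> exp (L\<^sup>2 / 2)"
          using y0[of i] yL[OF that] by (simp add: power_mono)
        ultimately have "sqrt (2 * pi) * exp ((y i)\<^sup>2 / 2) \<le> 3 * exp (L\<^sup>2 / 2)"
          by (intro mult_mono) auto
        then show ?thesis by (simp add: normal_density_def exp_minus field_simps)
      qed
      moreover have "\<bar>A (y i)\<bar> \<le> sqrt (N / l)"
        using Ay[of i] l by (intro real_le_rsqrt) (simp add: field_simps)
      moreover have "0 \<le> N / l"
        using order_trans[OF _ Ay[of i], of 0] l by simp
      ultimately have "\<bar>poly P (x i)\<bar> \<le> sqrt (N / l) * (3 * exp (L\<^sup>2 / 2))"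
        by (simp only:) (intro mult_mono, auto)
      then show ?thesis by (simp add: M_def mult_ac)
    qed
    show "(\<eta> * l) ^ D * real D ^ D / (2 * exp 1) ^ D > 0" using \<eta> l D by simp
    show "(\<eta> * l) ^ D * real D ^ D / (2 * exp 1) ^ D \<le> (\<Prod>k\<in>{..D} - {i}. \<bar>x i - x k\<bar>)" if "i \<le> D" for i
      using \<eta> l dist that by (intro prod_spaced_ge) auto
  qed
  have W: "(\<eta> * l) ^ D * real D ^ D / (2 * exp 1) ^ D = 1 / (2 * exp 1 / (L * l)) ^ D"
    using D L l by (simp add: \<eta>_def power_mult_distrib power_divide)
  have P_j: "coeff P j = p j * r j * exp (- (t j)\<^sup>2 / 2)"
    using j by (simp add: P_def coeff_sum coeff_monom)
  have main: "p j * \<bar>r j\<bar> * exp (- (t j)\<^sup>2 / 2) \<le>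
      (real D + 1) * (M * (1 + exp (L\<^sup>2 / D)) ^ D * (2 * exp 1 / (L * l)) ^ D)" (is "_ \<le> ?K")
    using bound p_pos[OF j] unfolding W P_j by (simp add: abs_mult add.commute)
  have "(t j)\<^sup>2 \<le> L\<^sup>2" using t_nonneg[OF j] t_le[OF j] by (intro power_mono)
  then have "exp (- L\<^sup>2 / 2) \<le> exp (- (t j)\<^sup>2 / 2)" by simp
  then have "\<bar>r j\<bar> * (pmin * exp (- L\<^sup>2 / 2)) \<le> \<bar>r j\<bar> * (p j * exp (- (t j)\<^sup>2 / 2))"
    using pmin(1) pmin(2)[OF j] by (intro mult_left_mono mult_mono) auto
  also have "\<dots> \<le> ?K" using main by (simp add: mult_ac)
  finally have "\<bar>r j\<bar> \<le> ?K / (pmin * exp (- L\<^sup>2 / 2))"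
    using pmin by (simp add: le_divide_eq)
  also have "\<dots> = ?K * exp (L\<^sup>2 / 2) / pmin"
    by (simp add: exp_minus field_simps)
  also have "\<dots> = (real D + 1) * (3 * exp (L\<^sup>2) * (1 + exp (L\<^sup>2 / D)) ^ D * (2 * exp 1 / (L * l)) ^ D / pmin)
    * sqrt (N / l)"
  proof -
    have "exp (L\<^sup>2) = exp (L\<^sup>2 / 2) * exp (L\<^sup>2 / 2)" by (simp add: exp_add[symmetric])
    then show ?thesis by (simp add: M_def mult_ac)
  qed
  finally show ?thesis by (simp add: N_def)
qed

end

context gaussian_mixture
begin

lemma post_eq_sum_unit: "E r y = (\<Sum>i\<le>D. r i * E (\<lambda>j. of_bool (i = j)) y)"
proof -
  have "E (\<lambda>j. \<Sum>i\<le>D. r i * of_bool (i = j)) y = E r y"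
    unfolding post_def mix_def
    by (intro arg_cong2[where f = "(/)"] sum.cong refl) (simp add: of_bool_def if_distrib cong: if_cong)
  then show ?thesis by (simp only: post_sum)
qed

text \<open>
  There are \<open>6 m + 1\<close> unknown weights. The grid takes \<open>4 m + 1\<close> conditions, the preservation of the
  total mass one, and orthonormality of \<open>m\<close> vectors at most \<open>m - 1\<close> further ones at each step.
  Positive definiteness of the form and the bound on the amplitudes both come from
  \<open>abs_coefficient_le_post_norm\<close>.
\<close>

lemma exists_orthonormal_directions:
  assumes m: "m > 0" and D: "D = 6 * m" and L: "L > 0"
    and t: "\<And>j. j \<le> D \<Longrightarrow> t j = real j * (L / D)"
    and pmin: "pmin > 0" "\<And>j. j \<le> D \<Longrightarrow> p j \<ge> pmin"
  defines "l \<equiv> L / (2 * real D + 2)"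
  defines "\<Lambda> \<equiv> (real D + 1) * (3 * exp (L\<^sup>2) * (1 + exp (L\<^sup>2 / D)) ^ D * (2 * exp 1 / (L * l)) ^ D / pmin) * sqrt (1 / l)"
  shows "\<exists>r. (\<forall>k<m. (\<Sum>j\<le>D. p j * r k j) = 0) \<and>
    (\<forall>k<m. \<forall>i\<le>4 * m. E (r k) ((real i - 2 * real m) / sqrt m) = 0) \<and>
    (\<forall>k<m. \<forall>k'<m. (\<integral>y. E (r k) y * E (r k') y * f0 y \<partial>lborel) = (if k = k' then 1 else 0)) \<and>
    (\<forall>k<m. \<forall>j\<le>D. \<bar>r k j\<bar> \<le> \<Lambda>)"
proof -
  define e :: "nat \<Rightarrow> nat \<Rightarrow> real" where "e = (\<lambda>i j. of_bool (i = j))"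
  define \<Gamma> where "\<Gamma> = (\<lambda>i j. \<integral>y. E (e i) y * E (e j) y * f0 y \<partial>lborel)"
  define x where "x = (\<lambda>i::nat. (real i - 2 * real m) / sqrt m)"
  \<comment> \<open>Row \<open>i \<le> 4 m\<close> is the zero of \<open>E r\<close> at the grid point \<open>x i\<close>; the row \<open>4 m + 1\<close> preserves the total mass.\<close>
  define a where "a = (\<lambda>i j. if i \<le> 4 * m then p j * normal_density (t j) 1 (x i) else p j)"
  have expand: "E r y = (\<Sum>i\<le>D. r i * E (e i) y)" for r y
    unfolding e_def by (rule post_eq_sum_unit)
  have form: "(\<Sum>i\<le>D. \<Sum>j\<le>D. \<Gamma> i j * v i * w j) = (\<integral>y. E v y * E w y * f0 y \<partial>lborel)" for v w
  proof -
    have "(\<lambda>y. E v y * E w y * f0 y) = (\<lambda>y. \<Sum>i\<le>D. \<Sum>j\<le>D. (v i * w j) * (E (e i) y * E (e j) y * f0 y))"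
    proof
      fix y
      have "E v y * E w y * f0 y = (\<Sum>i\<le>D. \<Sum>j\<le>D. (v i * E (e i) y) * (w j * E (e j) y)) * f0 y"
        by (simp only: expand[of v] expand[of w] sum_product)
      then show "E v y * E w y * f0 y = (\<Sum>i\<le>D. \<Sum>j\<le>D. (v i * w j) * (E (e i) y * E (e j) y * f0 y))"
        by (simp only: sum_distrib_right) (intro sum.cong refl, simp only: mult_ac)
    qed
    then have "(\<integral>y. E v y * E w y * f0 y \<partial>lborel) = (\<Sum>i\<le>D. \<Sum>j\<le>D. (v i * w j) * \<Gamma> i j)"
      unfolding \<Gamma>_def by (simp add: Bochner_Integration.integral_sum integrable_post_times_post)
    then show ?thesis by (simp add: mult_ac)
  qed
  have coefficient: "\<bar>w j\<bar> \<le> \<Lambda> * sqrt (\<integral>y. (E w y)\<^sup>2 * f0 y \<partial>lborel)" if "j \<le> D" for w :: "nat \<Rightarrow> real" and j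
  proof -
    define N where "N = (\<integral>y. (E w y)\<^sup>2 * f0 y \<partial>lborel)"
    define A where "A = (real D + 1) * (3 * exp (L\<^sup>2) * (1 + exp (L\<^sup>2 / D)) ^ D * (2 * exp 1 / (L * l)) ^ D / pmin)"
    have "\<bar>w j\<bar> \<le> A * sqrt (N / l)"
      using abs_coefficient_le_post_norm[OF _ L t pmin that, of w] m
      unfolding A_def N_def l_def D by simp
    also have "sqrt (N / l) = sqrt (1 / l) * sqrt N" by (simp add: real_sqrt_divide)
    finally show ?thesis by (simp add: \<Lambda>_def A_def N_def mult.assoc)
  qed
  have "\<exists>r. (\<forall>k<m. \<forall>i\<in>{..4 * m + 1}. (\<Sum>j\<in>{..D}. a i j * r k j) = 0) \<and>
      (\<forall>k<m. \<forall>k'<m. (\<Sum>i\<in>{..D}. \<Sum>j\<in>{..D}. \<Gamma> i j * r k i * r k' j) = (if k = k' then 1 else 0))"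
  proof (rule constrained_orthonormal_family)
    show "card {..4 * m + 1} + m \<le> card {..D}" using m by (simp add: D)
    show "\<Gamma> i j = \<Gamma> j i" for i j by (simp add: \<Gamma>_def mult_ac)
    fix w :: "nat \<Rightarrow> real" assume "\<exists>i\<in>{..D}. w i \<noteq> 0"
    then obtain i where i: "i \<le> D" "w i \<noteq> 0" by auto
    have "(\<integral>y. (E w y)\<^sup>2 * f0 y \<partial>lborel) \<noteq> 0" using coefficient[OF i(1), of w] i(2) by auto
    moreover have "(\<integral>y. (E w y)\<^sup>2 * f0 y \<partial>lborel) \<ge> 0"
      by (intro Bochner_Integration.integral_nonneg mult_nonneg_nonneg zero_le_power2 less_imp_le f0_pos)
    ultimately show "(\<Sum>i\<in>{..D}. \<Sum>j\<in>{..D}. \<Gamma> i j * w i * w j) > 0"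
      unfolding form by (simp add: power2_eq_square)
  qed auto
  then obtain r where r: "\<forall>k<m. \<forall>i\<in>{..4 * m + 1}. (\<Sum>j\<in>{..D}. a i j * r k j) = 0"
      "\<forall>k<m. \<forall>k'<m. (\<Sum>i\<in>{..D}. \<Sum>j\<in>{..D}. \<Gamma> i j * r k i * r k' j) = (if k = k' then 1 else 0)"
    by (elim exE conjE) (rule that)
  have constr: "(\<Sum>j\<le>D. a i j * r k j) = 0" if "k < m" "i \<le> 4 * m + 1" for k i
    using r(1) that by simp
  have orth: "(\<integral>y. E (r k) y * E (r k') y * f0 y \<partial>lborel) = (if k = k' then 1 else 0)"
    if "k < m" "k' < m" for k k'
    using r(2)[rule_format, OF that] unfolding form .
  have "(\<Sum>j\<le>D. p j * r k j) = 0" if "k < m" for k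
    using constr[OF that, of "4 * m + 1"] by (simp add: a_def)
  moreover have "E (r k) (x i) = 0" if "k < m" "i \<le> 4 * m" for k i
    using constr[OF that(1), of i] that(2) by (simp add: a_def post_def mix_def mult_ac)
  moreover have "\<bar>r k j\<bar> \<le> \<Lambda>" if "k < m" "j \<le> D" for k j
    using coefficient[OF that(2), of "r k"] orth[OF that(1) that(1)] by (simp add: power2_eq_square)
  ultimately show ?thesis unfolding x_def using orth by blast
qed

end

text \<open>
  The base of the exponential bound on the amplitudes. What matters is that it does not depend on
  \<open>m\<close> and \<open>L\<close>.
\<close>

definition growth :: "real \<Rightarrow> real" where
  "growth s = 3528 * (84 * exp 1) ^ 6 * exp (6 + 1 / (2 * s))"

text \<open>
  The left side is \<open>m\<^sup>2\<close> times the amplitude bound of \<open>exists_orthonormal_directions\<close>, for a prior whose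
  smallest weight is \<open>pmin\<close>. Every factor is at most \<open>exp (O(m))\<close> times a power of \<open>m / L\<^sup>2 \<ge> 1\<close>, and the
  exponents of these powers add up to \<open>6 m + 1 \<le> 7 m\<close>.
\<close>

lemma amplitude_bound:
  fixes m :: nat and L s :: real
  assumes m: "m > 0" and L: "L > 0" "L\<^sup>2 \<le> m" and s: "s > 0"
  defines "D \<equiv> 6 * m"
  defines "l \<equiv> L / (2 * real D + 2)" and "pmin \<equiv> exp (- L\<^sup>2 / (2 * s)) / (2 * real D)"
  shows "(real m)\<^sup>2 * ((real D + 1) * (3 * exp (L\<^sup>2) * (1 + exp (L\<^sup>2 / D)) ^ D * (2 * exp 1 / (L * l)) ^ D / pmin) * sqrt (1 / l))
    \<le> (growth s * (m / L\<^sup>2) ^ 7) ^ m"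
proof -
  define \<rho> where "\<rho> = m / L\<^sup>2"
  have m1: "real m \<ge> 1" using m by simp
  have \<rho>: "\<rho> \<ge> 1" using L by (simp add: \<rho>_def le_divide_eq)
  have Lm: "L \<le> m"
  proof -
    have "real m * 1 \<le> real m * real m" using m1 by (intro mult_left_mono) auto
    then have "L\<^sup>2 \<le> (real m)\<^sup>2" using L(2) by (simp only: power2_eq_square)
    then show ?thesis by (rule power2_le_imp_le) simp
  qed
  have 1: "real D + 1 \<le> 7 * real m" using m1 by (simp add: D_def)
  have 2: "exp (L\<^sup>2) \<le> exp 1 ^ m"
    using L by (simp add: exp_of_nat_mult[symmetric])
  have 3: "(1 + exp (L\<^sup>2 / D)) ^ D \<le> (3 ^ 6) ^ m"
  proof -
    have "L\<^sup>2 / D \<le> 1 / 2" using L m1 by (simp add: D_def field_simps)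
    then have "exp (L\<^sup>2 / D) \<le> exp (1 / 2)" by simp
    also have "\<dots> \<le> 2" by (rule exp_half_le2)
    finally have "(1 + exp (L\<^sup>2 / D)) ^ D \<le> 3 ^ D" by (intro power_mono) (auto intro: add_nonneg_nonneg)
    then show ?thesis by (simp add: D_def power_mult)
  qed
  have 4: "(2 * exp 1 / (L * l)) ^ D \<le> ((28 * exp 1 * \<rho>) ^ 6) ^ m"
  proof -
    have "2 * exp 1 / (L * l) = 2 * exp 1 * (2 * real D + 2) / L\<^sup>2"
      using L by (simp add: l_def power2_eq_square)
    also have "\<dots> \<le> 2 * exp 1 * (14 * real m) / L\<^sup>2"
      using m1 L by (intro divide_right_mono mult_left_mono) (auto simp: D_def)
    finally have "2 * exp 1 / (L * l) \<le> 28 * exp 1 * \<rho>" by (simp add: \<rho>_def)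
    moreover have "0 \<le> 2 * exp 1 / (L * l)" using L by (simp add: l_def)
    ultimately have "(2 * exp 1 / (L * l)) ^ D \<le> (28 * exp 1 * \<rho>) ^ D" by (intro power_mono)
    then show ?thesis by (simp add: D_def power_mult)
  qed
  have 5: "1 / pmin \<le> 12 * real m * exp (1 / (2 * s)) ^ m"
  proof -
    have "L\<^sup>2 / (2 * s) \<le> m / (2 * s)" using L s by (intro divide_right_mono) auto
    then have "exp (L\<^sup>2 / (2 * s)) \<le> exp (1 / (2 * s)) ^ m"
      by (simp add: exp_of_nat_mult[symmetric])
    then have "12 * real m * exp (L\<^sup>2 / (2 * s)) \<le> 12 * real m * exp (1 / (2 * s)) ^ m"
      by (intro mult_left_mono) auto
    moreover have "1 / pmin = 12 * real m * exp (L\<^sup>2 / (2 * s))"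
      by (simp add: pmin_def D_def exp_minus field_simps)
    ultimately show ?thesis by simp
  qed
  have 6: "sqrt (1 / l) \<le> 14 * real m * \<rho>"
  proof -
    have l1: "1 / l = (12 * real m + 2) / L" by (simp add: l_def D_def)
    have "1 \<le> 1 / l" unfolding l1 using L Lm by (simp add: le_divide_eq)
    then have "sqrt (1 / l) \<le> 1 / l"
    proof (intro real_le_lsqrt)
      assume z: "1 \<le> 1 / l"
      have "1 / l * 1 \<le> 1 / l * (1 / l)" by (intro mult_left_mono) (use z in linarith)+
      then show "1 / l \<le> (1 / l)\<^sup>2" by (simp only: power2_eq_square mult_1_right)
    qed (use L in \<open>simp add: l_def\<close>)
    also have "\<dots> \<le> 14 * real m * (1 / L)" unfolding l1 using m1 L by (simp add: divide_right_mono)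
    also have "1 / L \<le> \<rho>" using Lm L by (simp add: \<rho>_def field_simps power2_eq_square)
    finally show ?thesis by (simp add: mult_left_mono)
  qed
  have l: "l > 0" and pm: "pmin > 0" using L m by (auto simp: l_def pmin_def D_def)
  have m5: "real m ^ 5 \<le> (exp 1 ^ 5) ^ m"
  proof -
    have "real m \<le> exp (real m)" using exp_ge_add_one_self[of "real m"] by linarith
    then have "real m \<le> exp 1 ^ m" by (simp add: exp_of_nat_mult[symmetric])
    then have "real m ^ 5 \<le> (exp 1 ^ m) ^ 5" by (intro power_mono) auto
    then show ?thesis by (simp add: power_mult[symmetric] mult.commute)
  qed
  have "(real m)\<^sup>2 * ((real D + 1) * (3 * exp (L\<^sup>2) * (1 + exp (L\<^sup>2 / D)) ^ D * (2 * exp 1 / (L * l)) ^ D / pmin) * sqrt (1 / l))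
    = (real m)\<^sup>2 * ((real D + 1) * (3 * exp (L\<^sup>2) * (1 + exp (L\<^sup>2 / D)) ^ D * (2 * exp 1 / (L * l)) ^ D * (1 / pmin)) * sqrt (1 / l))"
    by simp
  also have "\<dots> \<le> (real m)\<^sup>2 * ((7 * real m) * (3 * exp 1 ^ m * (3 ^ 6) ^ m * ((28 * exp 1 * \<rho>) ^ 6) ^ m * (12 * real m * exp (1 / (2 * s)) ^ m)) * (14 * real m * \<rho>))"
  proof -
    have "\<rho> \<ge> 0" "l \<ge> 0" "L \<ge> 0" "pmin \<ge> 0" using \<rho> l L pm by auto
    then show ?thesis
      by (intro mult_mono mult_nonneg_nonneg 1 2 3 4 5 6 order_refl zero_le_power add_nonneg_nonneg) simp_all
  qed
  also have "\<dots> = 3528 * real m ^ 5 * \<rho> * (exp 1 * 3 ^ 6 * (28 * exp 1 * \<rho>) ^ 6 * exp (1 / (2 * s))) ^ m"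
  proof -
    have "M\<^sup>2 * ((7 * M) * (3 * a ^ m * b ^ m * c ^ m * (12 * M * d ^ m)) * (14 * M * \<rho>)) =
        3528 * M ^ 5 * \<rho> * (a * b * c * d) ^ m" for M a b c d :: real
      unfolding power_mult_distrib by (simp add: eval_nat_numeral)
    then show ?thesis .
  qed
  also have "\<dots> \<le> 3528 ^ m * (exp 1 ^ 5) ^ m * \<rho> ^ m * (exp 1 * 3 ^ 6 * (28 * exp 1 * \<rho>) ^ 6 * exp (1 / (2 * s))) ^ m"
  proof (intro mult_right_mono mult_mono m5)
    show "(3528::real) \<le> 3528 ^ m" by (rule self_le_power) (use m in auto)
    show "\<rho> \<le> \<rho> ^ m" by (rule self_le_power) (use m \<rho> in auto)
  qed (use \<rho> in auto)
  also have "\<dots> = (3528 * exp 1 ^ 5 * \<rho> * (exp 1 * 3 ^ 6 * (28 * exp 1 * \<rho>) ^ 6 * exp (1 / (2 * s)))) ^ m"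
    by (simp only: power_mult_distrib)
  also have "3528 * exp 1 ^ 5 * \<rho> * (exp 1 * 3 ^ 6 * (28 * exp 1 * \<rho>) ^ 6 * exp (1 / (2 * s))) = growth s * \<rho> ^ 7"
  proof -
    have e1: "exp (6 + 1 / (2 * s)) = exp 1 ^ 5 * exp 1 * exp (1 / (2 * s))"
      by (simp add: exp_of_nat_mult[symmetric] exp_add[symmetric])
    have e2: "(84 * exp 1) ^ 6 * \<rho> ^ 7 = \<rho> * (3 ^ 6 * (28 * exp 1 * \<rho>) ^ 6)"
      using power_Suc[of \<rho> 6] by (simp add: power_mult_distrib)
    have e3: "3528 * exp 1 ^ 5 * \<rho> * (exp 1 * 3 ^ 6 * (28 * exp 1 * \<rho>) ^ 6 * exp (1 / (2 * s))) =
        3528 * (\<rho> * (3 ^ 6 * (28 * exp 1 * \<rho>) ^ 6)) * (exp 1 ^ 5 * exp 1 * exp (1 / (2 * s)))"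
      by (simp only: mult_ac)
    have e4: "3528 * ((84 * exp 1) ^ 6 * \<rho> ^ 7) * exp (6 + 1 / (2 * s)) = growth s * \<rho> ^ 7"
      by (simp only: growth_def mult_ac)
    show ?thesis using e3 e4 unfolding e1 e2 by (rule trans)
  qed
  finally show ?thesis unfolding \<rho>_def .
qed

section \<open>Regret as excess risk\<close>

context gaussian_mixture
begin

definition post_var :: "real \<Rightarrow> real" where
  "post_var x = (\<Sum>j\<le>D. p j * normal_density (t j) 1 x * (E t x - t j)\<^sup>2)"

text \<open>
  Pythagoras for the posterior distribution: the posterior mean of the squared error of the guess \<open>a\<close>
  is the squared distance to the posterior mean plus the posterior variance, here multiplied by the
  marginal density.
\<close>

lemma bias_variance:
  "(\<Sum>j\<le>D. p j * normal_density (t j) 1 x * (a - t j)\<^sup>2) = f0 x * (a - E t x)\<^sup>2 + post_var x"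
proof -
  define T where "T = E t x"
  define w where "w = (\<lambda>j. p j * normal_density (t j) 1 x)"
  have w: "(\<Sum>j\<le>D. w j) = f0 x" by (simp add: w_def mix_def)
  have "(\<Sum>j\<le>D. w j * t j) = mix D t (\<lambda>j. p j * t j) x" by (simp add: w_def mix_def mult_ac)
  then have wt: "(\<Sum>j\<le>D. w j * t j) = T * f0 x" using f0_pos[of x] by (simp add: T_def post_def)
  have "(\<Sum>j\<le>D. w j * (a - t j)\<^sup>2) =
      (\<Sum>j\<le>D. (a\<^sup>2 - T\<^sup>2) * w j - 2 * (a - T) * (w j * t j) + w j * (T - t j)\<^sup>2)"
    by (intro sum.cong) (simp_all add: power2_eq_square algebra_simps)
  also have "\<dots> = (a\<^sup>2 - T\<^sup>2) * (\<Sum>j\<le>D. w j) - 2 * (a - T) * (\<Sum>j\<le>D. w j * t j) + (\<Sum>j\<le>D. w j * (T - t j)\<^sup>2)"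
    by (simp only: sum.distrib sum_subtractf sum_distrib_left)
  also have "\<dots> = f0 x * (a - T)\<^sup>2 + (\<Sum>j\<le>D. w j * (T - t j)\<^sup>2)"
    unfolding w wt by (simp add: power2_eq_square algebra_simps)
  finally show ?thesis by (simp add: post_var_def w_def T_def)
qed

lemma post_var_nonneg: "post_var x \<ge> 0"
  unfolding post_var_def using p_pos by (intro sum_nonneg mult_nonneg_nonneg) (auto intro: less_imp_le)

lemma borel_measurable_post_var [measurable]: "post_var \<in> borel_measurable borel"
  unfolding post_var_def normal_density_def by measurable

lemma nn_integral_f0: "(\<integral>\<^sup>+ x. ennreal (f0 x) \<partial>lborel) = 1"
  using has_bochner_integral_mix[of D t p] f0_pos p_sum
  by (subst nn_integral_eq_integral) (auto simp: has_bochner_integral_iff less_imp_le)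

lemma nn_integral_post_var_finite: "(\<integral>\<^sup>+ x. ennreal (post_var x) \<partial>lborel) < \<infinity>"
proof -
  have "post_var x \<le> L\<^sup>2 * f0 x" for x
  proof -
    have "post_var x \<le> (\<Sum>j\<le>D. p j * normal_density (t j) 1 x * (0 - t j)\<^sup>2)"
      unfolding bias_variance using f0_pos[of x] by simp
    also have "\<dots> \<le> (\<Sum>j\<le>D. p j * normal_density (t j) 1 x * L\<^sup>2)"
      using p_pos t_nonneg t_le by (intro sum_mono mult_left_mono) (auto intro!: power_mono simp: less_imp_le)
    finally show ?thesis by (simp add: mix_def sum_distrib_left mult_ac)
  qed
  then have "(\<integral>\<^sup>+ x. ennreal (post_var x) \<partial>lborel) \<le> (\<integral>\<^sup>+ x. ennreal (L\<^sup>2) * ennreal (f0 x) \<partial>lborel)"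
    using f0_pos by (intro nn_integral_mono) (auto simp: ennreal_mult[symmetric] less_imp_le intro!: ennreal_leI)
  also have "\<dots> = ennreal (L\<^sup>2)" by (simp add: nn_integral_cmult nn_integral_f0)
  finally show ?thesis by (auto simp: ennreal_less_top intro: le_less_trans)
qed

lemma prob_space_prior: "prob_space (atoms D t p)"
  using p_pos p_sum by (intro prob_space_atoms) (auto intro: less_imp_le)

lemma mmse_le: "mmse normal_mean (atoms D t p) \<le> (\<integral>\<^sup>+ x. ennreal (post_var x) \<partial>lborel)"
proof -
  have eq: "(\<integral>\<^sup>+ y. ennreal ((E t y - \<theta>)\<^sup>2) \<partial>normal_mean \<theta>) =
      (\<integral>\<^sup>+ y. ennreal (normal_density \<theta> 1 y) * ennreal ((E t y - \<theta>)\<^sup>2) \<partial>lborel)" for \<theta>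
    unfolding normal_mean_def by (subst nn_integral_density) auto
  have "mmse normal_mean (atoms D t p) \<le>
      (\<integral>\<^sup>+ (\<theta>, y). ennreal ((E t y - \<theta>)\<^sup>2) \<partial>joint_law normal_mean (atoms D t p))"
    unfolding mmse_def by (rule INF_lower) measurable
  also have "\<dots> = (\<integral>\<^sup>+ \<theta>. \<integral>\<^sup>+ y. ennreal (normal_density \<theta> 1 y) * ennreal ((E t y - \<theta>)\<^sup>2) \<partial>lborel \<partial>atoms D t p)"
    by (subst nn_integral_joint_law[OF prob_space_prior]) (auto simp: eq case_prod_beta')
  also have "\<dots> = (\<Sum>j\<le>D. ennreal (p j) * (\<integral>\<^sup>+ y. ennreal (normal_density (t j) 1 y) * ennreal ((E t y - t j)\<^sup>2) \<partial>lborel))"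
    unfolding normal_density_def by (rule nn_integral_atoms) measurable
  also have "\<dots> = (\<integral>\<^sup>+ y. (\<Sum>j\<le>D. ennreal (p j) * (ennreal (normal_density (t j) 1 y) * ennreal ((E t y - t j)\<^sup>2))) \<partial>lborel)"
    by (subst nn_integral_sum) (auto simp: nn_integral_cmult)
  also have "\<dots> = (\<integral>\<^sup>+ x. ennreal (post_var x) \<partial>lborel)"
  proof (intro nn_integral_cong)
    fix y
    have "(\<Sum>j\<le>D. ennreal (p j) * (ennreal (normal_density (t j) 1 y) * ennreal ((E t y - t j)\<^sup>2))) =
        (\<Sum>j\<le>D. ennreal (p j * normal_density (t j) 1 y * (E t y - t j)\<^sup>2))"
      using p_pos by (intro sum.cong) (auto simp: ennreal_mult mult_ac less_imp_le)
    also have "\<dots> = ennreal (post_var y)"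
      unfolding post_var_def using p_pos by (intro sum_ennreal) (auto simp: less_imp_le)
    finally show "(\<Sum>j\<le>D. ennreal (p j) * (ennreal (normal_density (t j) 1 y) * ennreal ((E t y - t j)\<^sup>2))) =
        ennreal (post_var y)" .
  qed
  finally show ?thesis .
qed

text \<open>
  Mean squared distance of the estimator from the Bayes estimator in coordinate \<open>i\<close>, with the \<open>n\<close>
  observations drawn independently from the marginal density \<open>f0\<close>.
\<close>

definition excess :: "nat \<Rightarrow> ((nat \<Rightarrow> real) \<Rightarrow> nat \<Rightarrow> real) \<Rightarrow> nat \<Rightarrow> ennreal" where
  "excess n f i = (\<integral>\<^sup>+ y. (\<Prod>k<n. ennreal (f0 (y k))) * ennreal ((f y i - E t (y i))\<^sup>2) \<partial>(\<Pi>\<^sub>M k\<in>{..<n}. lborel))"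

text \<open>
  For fixed data, the loss in coordinate \<open>i\<close> depends on \<open>\<theta> i\<close> only. After an exchange of the integrals the
  integral over the parameters factorises: the coordinates other than \<open>i\<close> contribute their marginal
  densities, and coordinate \<open>i\<close> is treated by \<open>bias_variance\<close>.
\<close>

lemma coordinate_risk:
  assumes i: "i < n" and f [measurable]: "(\<lambda>y. f y i) \<in> borel_measurable (\<Pi>\<^sub>M k\<in>{..<n}. lborel)"
  shows "(\<integral>\<^sup>+ \<theta>. \<integral>\<^sup>+ y. ennreal ((f y i - \<theta> i)\<^sup>2) \<partial>(\<Pi>\<^sub>M k\<in>{..<n}. normal_mean (\<theta> k)) \<partial>(\<Pi>\<^sub>M k\<in>{..<n}. atoms D t p)) =
    excess n f i + (\<integral>\<^sup>+ x. ennreal (post_var x) \<partial>lborel)"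
proof -
  interpret G: prob_space "atoms D t p" by (rule prob_space_prior)
  interpret lb: product_sigma_finite "\<lambda>_::nat. lborel :: real measure"
    by (intro product_sigma_finite.intro sigma_finite_lborel)
  interpret lbn: finite_product_sigma_finite "\<lambda>_::nat. lborel :: real measure" "{..<n}"
    by standard simp
  interpret Gs: product_sigma_finite "\<lambda>_::nat. atoms D t p"
    by (intro product_sigma_finite.intro G.sigma_finite_measure_axioms)
  interpret Gn: finite_product_sigma_finite "\<lambda>_::nat. atoms D t p" "{..<n}"
    by standard simp
  let ?L = "\<Pi>\<^sub>M k\<in>{..<n}. lborel :: real measure" and ?G = "\<Pi>\<^sub>M k\<in>{..<n}. atoms D t p"
  interpret P: pair_sigma_finite ?L ?G
    by (intro pair_sigma_finite.intro lbn.sigma_finite_measure_axioms Gn.sigma_finite_measure_axioms)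
  define R where "R = (\<integral>\<^sup>+ x. ennreal (post_var x) \<partial>lborel)"
  \<comment> \<open>Attaching the loss to factor \<open>i\<close> makes the integrand a product over the coordinates.\<close>
  define h where "h = (\<lambda>y \<theta> k. ennreal (normal_density (\<theta> :: real) 1 (y k)) * (if k = i then ennreal ((f y i - \<theta>)\<^sup>2) else 1))"
  have dens: "(\<integral>\<^sup>+ y. ennreal ((f y i - \<theta> i)\<^sup>2) \<partial>(\<Pi>\<^sub>M k\<in>{..<n}. normal_mean (\<theta> k))) =
      (\<integral>\<^sup>+ y. (\<Prod>k<n. h y (\<theta> k) k) \<partial>?L)" for \<theta>
  proof -
    have "(\<Pi>\<^sub>M k\<in>{..<n}. normal_mean (\<theta> k)) =
        density ?L (\<lambda>y. \<Prod>k<n. ennreal (normal_density (\<theta> k) 1 (y k)))"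
      unfolding normal_mean_def
      by (intro PiM_density_lborel prob_space_normal_density) auto
    moreover have "(\<Prod>k<n. h y (\<theta> k) k) = (\<Prod>k<n. ennreal (normal_density (\<theta> k) 1 (y k))) * ennreal ((f y i - \<theta> i)\<^sup>2)" for y
      using i by (simp add: h_def prod.distrib)
    ultimately show ?thesis
      by (simp add: nn_integral_density)
  qed
  have "(\<integral>\<^sup>+ \<theta>. \<integral>\<^sup>+ y. ennreal ((f y i - \<theta> i)\<^sup>2) \<partial>(\<Pi>\<^sub>M k\<in>{..<n}. normal_mean (\<theta> k)) \<partial>?G) =
      (\<integral>\<^sup>+ \<theta>. \<integral>\<^sup>+ y. (\<Prod>k<n. h y (\<theta> k) k) \<partial>?L \<partial>?G)"
    by (simp only: dens)
  also have "\<dots> = (\<integral>\<^sup>+ y. \<integral>\<^sup>+ \<theta>. (\<Prod>k<n. h y (\<theta> k) k) \<partial>?G \<partial>?L)"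
  proof (rule P.Fubini')
    show "(\<lambda>(y, \<theta>). \<Prod>k<n. h y (\<theta> k) k) \<in> borel_measurable (?L \<Otimes>\<^sub>M ?G)"
      unfolding h_def normal_density_def by measurable
  qed
  also have "\<dots> = (\<integral>\<^sup>+ y. (\<Prod>k<n. ennreal (f0 (y k))) * ennreal ((f y i - E t (y i))\<^sup>2) +
      (\<Prod>k<n. ennreal (if k = i then post_var (y k) else f0 (y k))) \<partial>?L)"
  proof (intro nn_integral_cong)
    fix y assume y: "y \<in> space ?L"
    have mix: "(\<integral>\<^sup>+ \<theta>. h y \<theta> k \<partial>atoms D t p) = ennreal (f0 (y k))" if "k \<noteq> i" for k
    proof -
      have "(\<integral>\<^sup>+ \<theta>. h y \<theta> k \<partial>atoms D t p) = (\<Sum>j\<le>D. ennreal (p j) * h y (t j) k)"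
        unfolding h_def normal_density_def by (rule nn_integral_atoms) measurable
      also have "\<dots> = (\<Sum>j\<le>D. ennreal (p j * normal_density (t j) 1 (y k)))"
        using that p_pos by (intro sum.cong) (auto simp: h_def ennreal_mult less_imp_le)
      also have "\<dots> = ennreal (f0 (y k))"
        unfolding mix_def using p_pos by (intro sum_ennreal) (auto simp: less_imp_le)
      finally show ?thesis .
    qed
    have special: "(\<integral>\<^sup>+ \<theta>. h y \<theta> i \<partial>atoms D t p) = ennreal (f0 (y i) * (f y i - E t (y i))\<^sup>2 + post_var (y i))"
    proof -
      have "(\<integral>\<^sup>+ \<theta>. h y \<theta> i \<partial>atoms D t p) = (\<Sum>j\<le>D. ennreal (p j) * h y (t j) i)"
        unfolding h_def normal_density_def by (rule nn_integral_atoms) measurable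
      also have "\<dots> = (\<Sum>j\<le>D. ennreal (p j * normal_density (t j) 1 (y i) * (f y i - t j)\<^sup>2))"
        using p_pos by (intro sum.cong) (auto simp: h_def ennreal_mult less_imp_le mult_ac)
      also have "\<dots> = ennreal (\<Sum>j\<le>D. p j * normal_density (t j) 1 (y i) * (f y i - t j)\<^sup>2)"
        using p_pos by (intro sum_ennreal) (auto simp: less_imp_le)
      finally show ?thesis by (simp only: bias_variance)
    qed
    have "(\<integral>\<^sup>+ \<theta>. (\<Prod>k<n. h y (\<theta> k) k) \<partial>?G) = (\<Prod>k<n. \<integral>\<^sup>+ \<theta>. h y \<theta> k \<partial>atoms D t p)"
      unfolding h_def normal_density_def by (rule Gs.product_nn_integral_prod) auto
    also have "\<dots> = (\<integral>\<^sup>+ \<theta>. h y \<theta> i \<partial>atoms D t p) * (\<Prod>k\<in>{..<n} - {i}. \<integral>\<^sup>+ \<theta>. h y \<theta> k \<partial>atoms D t p)"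
      using i by (intro prod.remove) auto
    also have "(\<Prod>k\<in>{..<n} - {i}. \<integral>\<^sup>+ \<theta>. h y \<theta> k \<partial>atoms D t p) = (\<Prod>k\<in>{..<n} - {i}. ennreal (f0 (y k)))"
      by (intro prod.cong) (auto simp: mix)
    also have "(\<integral>\<^sup>+ \<theta>. h y \<theta> i \<partial>atoms D t p) * \<dots> =
        ennreal (f0 (y i)) * (\<Prod>k\<in>{..<n} - {i}. ennreal (f0 (y k))) * ennreal ((f y i - E t (y i))\<^sup>2) +
        ennreal (post_var (y i)) * (\<Prod>k\<in>{..<n} - {i}. ennreal (f0 (y k)))"
      unfolding special using f0_pos[of "y i"] post_var_nonneg[of "y i"]
      by (simp add: ennreal_mult ennreal_plus less_imp_le distrib_left distrib_right mult_ac)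
    also have "ennreal (f0 (y i)) * (\<Prod>k\<in>{..<n} - {i}. ennreal (f0 (y k))) = (\<Prod>k<n. ennreal (f0 (y k)))"
      using i by (intro prod.remove[symmetric]) auto
    also have "ennreal (post_var (y i)) * (\<Prod>k\<in>{..<n} - {i}. ennreal (f0 (y k))) =
        (\<Prod>k<n. ennreal (if k = i then post_var (y k) else f0 (y k)))"
      using i by (subst prod.remove[of "{..<n}" i]) (auto intro!: arg_cong2[where f = "(*)"] prod.cong)
    finally show "(\<integral>\<^sup>+ \<theta>. (\<Prod>k<n. h y (\<theta> k) k) \<partial>?G) =
      (\<Prod>k<n. ennreal (f0 (y k))) * ennreal ((f y i - E t (y i))\<^sup>2) +
      (\<Prod>k<n. ennreal (if k = i then post_var (y k) else f0 (y k)))" .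
  qed
  also have "\<dots> = excess n f i + (\<integral>\<^sup>+ y. (\<Prod>k<n. ennreal (if k = i then post_var (y k) else f0 (y k))) \<partial>?L)"
    unfolding excess_def using i by (intro nn_integral_add) measurable
  also have "(\<integral>\<^sup>+ y. (\<Prod>k<n. ennreal (if k = i then post_var (y k) else f0 (y k))) \<partial>?L) =
      (\<Prod>k<n. \<integral>\<^sup>+ x. ennreal (if k = i then post_var x else f0 x) \<partial>lborel)"
    by (rule lb.product_nn_integral_prod) auto
  also have "\<dots> = R"
    using i by (subst prod.remove[of _ i]) (auto simp: R_def nn_integral_f0 intro!: prod.neutral)
  finally show ?thesis unfolding R_def .
qed

text \<open>
  The Bayes risk is at most the integrated posterior variance, and this is finite, so the
  subtraction in the extended reals is harmless, even for an estimator of infinite risk.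
\<close>

lemma regret_ge_excess:
  assumes f: "f \<in> vec_space n \<rightarrow>\<^sub>M vec_space n"
  shows "enn2ereal (\<Sum>i<n. excess n f i) \<le>
    enn2ereal (risk_n normal_mean n f (atoms D t p)) - ereal (real n) * enn2ereal (mmse normal_mean (atoms D t p))"
proof -
  define R where "R = (\<integral>\<^sup>+ x. ennreal (post_var x) \<partial>lborel)"
  define X where "X = (\<Sum>i<n. excess n f i)"
  let ?G = "\<Pi>\<^sub>M k\<in>{..<n}. atoms D t p" and ?V = "vec_space n"
  have setsG: "sets ?G = sets ?V" by (intro sets_PiM_cong) auto
  have setsL: "sets (\<Pi>\<^sub>M k\<in>{..<n}. lborel :: real measure) = sets ?V" by (intro sets_PiM_cong) auto
  have fi [measurable]: "(\<lambda>y. f y i) \<in> borel_measurable ?V" if "i < n" for i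
    using measurable_compose[OF f measurable_component_singleton, of i] that by simp
  have L2: "ennreal ((L2_set (\<lambda>i. f y i - \<theta> i) {..<n})\<^sup>2) = (\<Sum>i<n. ennreal ((f y i - \<theta> i)\<^sup>2))" for y \<theta> :: "nat \<Rightarrow> real"
    by (subst sum_ennreal) (auto simp: L2_set_def sum_nonneg)
  have meas: "(\<lambda>(\<theta>, y). ennreal ((f y i - \<theta> i)\<^sup>2)) \<in> borel_measurable (?V \<Otimes>\<^sub>M ?V)" if "i < n" for i
  proof -
    have [measurable]: "(\<lambda>y. f y i) \<in> borel_measurable ?V" "i \<in> {..<n}" using fi that by auto
    show ?thesis by measurable
  qed
  have "risk_n normal_mean n f (atoms D t p) =
      (\<integral>\<^sup>+ x. (\<Sum>i<n. (\<lambda>(\<theta>, y). ennreal ((f y i - \<theta> i)\<^sup>2)) x) \<partial>joint_law_n normal_mean n (atoms D t p))"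
    unfolding risk_n_def by (intro nn_integral_cong) (auto simp: L2)
  also have "\<dots> = (\<Sum>i<n. \<integral>\<^sup>+ x. (\<lambda>(\<theta>, y). ennreal ((f y i - \<theta> i)\<^sup>2)) x \<partial>joint_law_n normal_mean n (atoms D t p))"
  proof (rule nn_integral_sum)
    fix i assume "i \<in> {..<n}"
    have "sets (joint_law_n normal_mean n (atoms D t p)) = sets (?V \<Otimes>\<^sub>M ?V)"
    proof -
      have "emeasure (joint_law_n normal_mean n (atoms D t p)) (space (joint_law_n normal_mean n (atoms D t p))) = 1"
        using prob_space_joint_law_n[OF prob_space_prior, of n] by (simp add: prob_space.emeasure_space_1)
      show ?thesis
        unfolding joint_law_n_def
        by (intro sets_bind) (auto simp: space_PiM)
    qed
    with meas \<open>i \<in> {..<n}\<close>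
    show "(\<lambda>x. (\<lambda>(\<theta>, y). ennreal ((f y i - \<theta> i)\<^sup>2)) x) \<in> borel_measurable (joint_law_n normal_mean n (atoms D t p))"
      by (auto cong: measurable_cong_sets)
  qed
  also have "\<dots> = (\<Sum>i<n. \<integral>\<^sup>+ \<theta>. \<integral>\<^sup>+ y. ennreal ((f y i - \<theta> i)\<^sup>2) \<partial>(\<Pi>\<^sub>M k\<in>{..<n}. normal_mean (\<theta> k)) \<partial>?G)"
    using meas by (intro sum.cong refl, subst nn_integral_joint_law_n[OF prob_space_prior]) auto
  also have "\<dots> = (\<Sum>i<n. excess n f i + R)"
  proof (intro sum.cong refl)
    fix i assume "i \<in> {..<n}"
    then show "(\<integral>\<^sup>+ \<theta>. \<integral>\<^sup>+ y. ennreal ((f y i - \<theta> i)\<^sup>2) \<partial>(\<Pi>\<^sub>M k\<in>{..<n}. normal_mean (\<theta> k)) \<partial>?G) = excess n f i + R"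
      unfolding R_def using fi[of i] by (intro coordinate_risk) (simp_all add: measurable_cong_sets[OF setsL refl])
  qed
  also have "\<dots> = X + of_nat n * R" by (simp add: sum.distrib X_def)
  finally have risk: "risk_n normal_mean n f (atoms D t p) = X + of_nat n * R" .
  obtain r where r: "R = ennreal r" "r \<ge> 0"
    using nn_integral_post_var_finite unfolding R_def[symmetric] by (cases R) auto
  obtain \<mu> where \<mu>: "mmse normal_mean (atoms D t p) = ennreal \<mu>" "\<mu> \<ge> 0" "\<mu> \<le> r"
    using mmse_le r unfolding R_def[symmetric]
    by (cases "mmse normal_mean (atoms D t p)") (auto simp: ennreal_le_iff top_unique)
  have nR: "of_nat n * R = ennreal (real n * r)"
    by (simp add: r ennreal_of_nat_eq_real_of_nat ennreal_mult)
  show ?thesis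
  proof (cases X)
    case (real x)
    then have "risk_n normal_mean n f (atoms D t p) = ennreal (x + real n * r)"
      unfolding risk nR using r by simp
    then have "enn2ereal (risk_n normal_mean n f (atoms D t p)) = ereal (x + real n * r)"
      using real r by (simp add: enn2ereal_ennreal del: ennreal_plus)
    moreover have "real n * \<mu> \<le> real n * r" using \<mu> by (intro mult_left_mono) auto
    ultimately show ?thesis
      unfolding X_def[symmetric] \<mu>(1) real using real r \<mu> by (simp add: enn2ereal_ennreal)
  next
    case top
    then have "risk_n normal_mean n f (atoms D t p) = \<infinity>" unfolding risk by simp
    then show ?thesis
      unfolding \<mu>(1) using \<mu> by (simp add: enn2ereal_ennreal)
  qed
qed

end

section \<open>Hypercubes of perturbed mixtures\<close>

text \<open>
  The condition \<open>small\<close> keeps all perturbed weights between \<open>1/2\<close> and \<open>3/2\<close> of the original ones and the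
  displacement of the Bayes estimator below a constant; the first makes them priors, the second lets
  the nonlinear terms in \<open>separation\<close> be absorbed.
\<close>

locale perturbed_mixture = gaussian_mixture D t p L for D t p L +
  fixes m :: nat and r :: "nat \<Rightarrow> nat \<Rightarrow> real" and B \<delta> :: real
  assumes m_pos: "m > 0" and L_le: "L \<le> sqrt m"
    and mean_zero: "\<And>k. k < m \<Longrightarrow> (\<Sum>j\<le>D. p j * r k j) = 0"
    and grid_zero: "\<And>k i. k < m \<Longrightarrow> i \<le> 4 * m \<Longrightarrow> E (r k) ((real i - 2 * real m) / sqrt m) = 0"
    and orthonormal: "\<And>k l. k < m \<Longrightarrow> l < m \<Longrightarrow>
      (\<integral>y. E (r k) y * E (r l) y * f0 y \<partial>lborel) = (if k = l then 1 else 0)"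
    and r_le: "\<And>k j. k < m \<Longrightarrow> j \<le> D \<Longrightarrow> \<bar>r k j\<bar> \<le> B"
    and \<delta>_pos: "\<delta> > 0" and small: "2 * (real m)\<^sup>2 * B * \<delta> \<le> 1"
begin

definition direction :: "(nat \<Rightarrow> real) \<Rightarrow> nat \<Rightarrow> real" where
  "direction c j = (\<Sum>k<m. c k * r k j)"

definition signed_step :: "nat set \<Rightarrow> nat \<Rightarrow> real" where
  "signed_step u k = (if k \<in> u then \<delta> else - \<delta>)"

abbreviation "R u \<equiv> direction (signed_step u)"

definition q :: "nat set \<Rightarrow> nat \<Rightarrow> real" where
  "q u j = p j * (1 + R u j)"

lemma B_nonneg: "B \<ge> 0"
  using r_le[OF m_pos, of 0] by simp

lemma post_direction: "E (direction c) y = (\<Sum>k<m. c k * E (r k) y)"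
  unfolding direction_def[abs_def] by (rule post_sum)

lemma post_cov_direction: "E' (direction c) y = (\<Sum>k<m. c k * E' (r k) y)"
  unfolding direction_def[abs_def] by (rule post_cov_sum)

lemma norm_direction: "(\<integral>y. (E (direction c) y)\<^sup>2 * f0 y \<partial>lborel) = (\<Sum>k<m. (c k)\<^sup>2)"
proof -
  have "(\<lambda>y. (E (direction c) y)\<^sup>2 * f0 y) = (\<lambda>y. \<Sum>k<m. \<Sum>l<m. c k * c l * (E (r k) y * E (r l) y * f0 y))"
  proof
    fix y
    have "(E (direction c) y)\<^sup>2 * f0 y = (\<Sum>k<m. \<Sum>l<m. (c k * E (r k) y) * (c l * E (r l) y)) * f0 y"
      by (simp only: post_direction power2_eq_square sum_product)
    then show "(E (direction c) y)\<^sup>2 * f0 y = (\<Sum>k<m. \<Sum>l<m. c k * c l * (E (r k) y * E (r l) y * f0 y))"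
      by (simp only: sum_distrib_right) (intro sum.cong refl, simp only: mult_ac)
  qed
  then have "(\<integral>y. (E (direction c) y)\<^sup>2 * f0 y \<partial>lborel) =
      (\<Sum>k<m. \<Sum>l<m. c k * c l * (\<integral>y. E (r k) y * E (r l) y * f0 y \<partial>lborel))"
    by (simp add: Bochner_Integration.integral_sum integrable_post_times_post)
  also have "\<dots> = (\<Sum>k<m. \<Sum>l<m. if k = l then c k * c k else 0)"
    by (intro sum.cong refl) (simp add: orthonormal)
  also have "\<dots> = (\<Sum>k<m. (c k)\<^sup>2)" by (simp add: power2_eq_square)
  finally show ?thesis .
qed

lemma poincare_direction:
  "m / (4 * exp 8) * (\<Sum>k<m. (c k)\<^sup>2) \<le> (\<integral>y. (E' (direction c) y)\<^sup>2 * f0 y \<partial>lborel)"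
proof -
  have "(\<Sum>k<m. (c k)\<^sup>2) \<le> 4 * exp 8 / m * (\<integral>y. (E' (direction c) y)\<^sup>2 * f0 y \<partial>lborel)"
    unfolding norm_direction[symmetric]
    by (rule poincare_grid[OF m_pos L_le]) (simp add: post_direction grid_zero)
  then show ?thesis using m_pos by (simp add: field_simps)
qed

lemma abs_direction_le:
  assumes c: "\<And>k. k < m \<Longrightarrow> \<bar>c k\<bar> \<le> \<delta>" and j: "j \<le> D"
  shows "\<bar>direction c j\<bar> \<le> real m * B * \<delta>"
proof -
  have "\<bar>direction c j\<bar> \<le> (\<Sum>k<m. \<bar>c k * r k j\<bar>)"
    unfolding direction_def by (rule sum_abs)
  also have "\<dots> \<le> (\<Sum>k<m. \<delta> * B)"
    unfolding abs_mult using c r_le j \<delta>_pos by (intro sum_mono mult_mono) auto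
  finally show ?thesis by (simp add: mult_ac)
qed

lemma abs_signed_step: "\<bar>signed_step u k\<bar> \<le> \<delta>"
  using \<delta>_pos by (simp add: signed_step_def)

lemma perturbation_le_half: "real m * B * \<delta> \<le> 1 / 2"
proof -
  have "1 * (real m * B * \<delta>) \<le> real m * (real m * B * \<delta>)"
    using m_pos B_nonneg \<delta>_pos by (intro mult_right_mono) auto
  then show ?thesis using small by (simp add: power2_eq_square mult_ac)
qed

lemma abs_R_le: "j \<le> D \<Longrightarrow> \<bar>R u j\<bar> \<le> 1 / 2"
  using abs_direction_le[of "signed_step u" j] abs_signed_step perturbation_le_half by (auto intro: order_trans)

lemma abs_post_R_le: "\<bar>E (R u) y\<bar> \<le> 1 / 2"
  by (rule abs_post_le) (rule abs_R_le)

lemma abs_post_cov_R_le: "\<bar>E' (R u) y\<bar> \<le> 1"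
proof -
  have "\<bar>E' (R u) y\<bar> \<le> 2 * L * (real m * B * \<delta>)"
    using abs_direction_le[of "signed_step u"] abs_signed_step by (intro abs_post_cov_le) auto
  also have "\<dots> \<le> 2 * real m * (real m * B * \<delta>)"
  proof -
    have "sqrt (real m) \<le> real m"
      using m_pos by (intro real_le_lsqrt) (auto simp: power2_eq_square)
    then show ?thesis
      using L_le B_nonneg \<delta>_pos by (intro mult_right_mono) auto
  qed
  finally show ?thesis using small by (simp add: power2_eq_square mult_ac)
qed

lemma mix_q: "mix D t (q u) y = f0 y * (1 + E (R u) y)"
proof -
  have "mix D t (q u) y = f0 y + mix D t (\<lambda>j. p j * R u j) y"
    by (simp add: mix_def q_def sum.distrib[symmetric] algebra_simps)
  then show ?thesis using f0_pos[of y] by (simp add: post_def field_simps)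
qed

text \<open>
  The displacement of the Bayes estimator is the logarithmic derivative of \<open>1 + E (R u)\<close>, the ratio of
  the perturbed to the original marginal density.
\<close>

lemma post_q: "post D t (q u) t y = E t y + E' (R u) y / (1 + E (R u) y)"
proof -
  have "mix D t (\<lambda>j. q u j * t j) y = mix D t (\<lambda>j. p j * t j) y + mix D t (\<lambda>j. p j * (t j * R u j)) y"
    by (simp add: mix_def q_def sum.distrib[symmetric] algebra_simps)
  also have "\<dots> = f0 y * (E t y + E (\<lambda>j. t j * R u j) y)"
    using f0_pos[of y] by (simp add: post_def field_simps)
  finally have "post D t (q u) t y = (E t y + E (\<lambda>j. t j * R u j) y) / (1 + E (R u) y)"
    using f0_pos[of y] by (simp add: post_def[of D t "q u"] mix_q)
  moreover have "1 + E (R u) y \<noteq> 0" using abs_post_R_le[of u y] by auto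
  ultimately show ?thesis by (simp add: post_cov_def field_simps)
qed

lemma q_pos: "j \<le> D \<Longrightarrow> q u j > 0"
  using p_pos[of j] abs_R_le[of j u] by (simp add: q_def)

lemma q_le: "j \<le> D \<Longrightarrow> q u j \<le> 2 * p j"
  using p_pos[of j] abs_R_le[of j u] by (simp add: q_def)

lemma q_sum: "(\<Sum>j\<le>D. q u j) = 1"
proof -
  have "(\<Sum>j\<le>D. p j * R u j) = (\<Sum>j\<le>D. \<Sum>k<m. signed_step u k * (p j * r k j))"
    by (simp add: direction_def sum_distrib_left mult_ac)
  also have "\<dots> = (\<Sum>k<m. signed_step u k * (\<Sum>j\<le>D. p j * r k j))"
    by (subst sum.swap) (simp add: sum_distrib_left)
  also have "\<dots> = 0" by (simp add: mean_zero)
  finally show ?thesis by (simp add: q_def distrib_left sum.distrib p_sum)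
qed

lemma gaussian_mixture_q: "gaussian_mixture D t (q u) L"
  by unfold_locales (auto simp: q_pos q_sum t_nonneg t_le)

lemma sum_signed_step_diff: "(\<Sum>k<m. (signed_step u k - signed_step v k)\<^sup>2) = 4 * \<delta>\<^sup>2 * hamming m u v"
  unfolding hamming_def sum_distrib_left
  by (intro sum.cong) (auto simp: signed_step_def power2_eq_square)

lemma direction_diff:
  "E (R u) y - E (R v) y = E (direction (\<lambda>k. signed_step u k - signed_step v k)) y"
  "E' (R u) y - E' (R v) y = E' (direction (\<lambda>k. signed_step u k - signed_step v k)) y"
  by (simp_all add: post_direction post_cov_direction left_diff_distrib sum_subtractf)

text \<open>
  To first order the displacement is \<open>E' (R u)\<close>, which is linear in the signs, and
  \<open>poincare_direction\<close> bounds the norm of differences from below by \<open>m\<close> times that of \<open>E (R u)\<close>. The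
  correction due to the denominators is at most the norm of a difference of \<open>E (R u)\<close> itself; it is
  smaller by a factor of order \<open>m\<close>, which is where \<open>m \<ge> 64 exp 8\<close> enters.
\<close>

lemma separation:
  assumes m: "real m \<ge> 64 * exp 8"
  shows "ennreal (\<delta>\<^sup>2 * m / (81 * exp 8) * hamming m u v) \<le>
    (\<integral>\<^sup>+ y. ennreal (f0 y * (post D t (q u) t y - post D t (q v) t y)\<^sup>2) \<partial>lborel)"
proof -
  define c where "c = (\<lambda>k. signed_step u k - signed_step v k)"
  define g where "g = (\<lambda>y. 2 / 81 * ((E' (direction c) y)\<^sup>2 * f0 y) - 16 / 81 * ((E (direction c) y)\<^sup>2 * f0 y))"
  have int: "integrable lborel (\<lambda>y. (E (direction c) y)\<^sup>2 * f0 y)"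
    using integrable_post_times_post[of "direction c" "direction c"] by (simp add: power2_eq_square)
  have "\<delta>\<^sup>2 * m / (81 * exp 8) * hamming m u v = 4 * \<delta>\<^sup>2 * hamming m u v * (m / (324 * exp 8))"
    by (simp add: field_simps)
  also have "\<dots> \<le> 4 * \<delta>\<^sup>2 * hamming m u v * (2 / 81 * (m / (4 * exp 8)) - 16 / 81)"
  proof (rule mult_left_mono)
    show "m / (324 * exp 8) \<le> 2 / 81 * (m / (4 * exp 8)) - 16 / 81"
      using m by (simp add: field_simps)
    show "0 \<le> 4 * \<delta>\<^sup>2 * hamming m u v" by (simp add: hamming_def sum_nonneg)
  qed
  also have "\<dots> = 2 / 81 * (m / (4 * exp 8) * (\<Sum>k<m. (c k)\<^sup>2)) - 16 / 81 * (\<Sum>k<m. (c k)\<^sup>2)"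
    unfolding c_def sum_signed_step_diff by (simp add: algebra_simps)
  also have "\<dots> \<le> 2 / 81 * (\<integral>y. (E' (direction c) y)\<^sup>2 * f0 y \<partial>lborel) - 16 / 81 * (\<integral>y. (E (direction c) y)\<^sup>2 * f0 y \<partial>lborel)"
    using poincare_direction[of c] by (simp add: norm_direction)
  also have "\<dots> = (\<integral>y. g y \<partial>lborel)"
    unfolding g_def using int integrable_post_cov_sq[of "direction c"]
    by (subst Bochner_Integration.integral_diff) auto
  finally have "ennreal (\<delta>\<^sup>2 * m / (81 * exp 8) * hamming m u v) \<le> ennreal (\<integral>y. g y \<partial>lborel)"
    by (rule ennreal_leI)
  also have "\<dots> \<le> (\<integral>\<^sup>+ y. ennreal (g y) \<partial>lborel)"
  proof -
    have "integrable lborel g"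
      unfolding g_def using int integrable_post_cov_sq[of "direction c"] by auto
    then have "(\<integral>y. g y \<partial>lborel) \<le> (\<integral>y. max 0 (g y) \<partial>lborel)" "integrable lborel (\<lambda>y. max 0 (g y))"
      by (auto intro!: integral_mono)
    moreover from this(2) have "ennreal (\<integral>y. max 0 (g y) \<partial>lborel) = (\<integral>\<^sup>+ y. ennreal (max 0 (g y)) \<partial>lborel)"
      by (intro nn_integral_eq_integral[symmetric]) auto
    ultimately show ?thesis
      by (metis (no_types, lifting) ennreal_leI nn_integral_cong ennreal_max_0)
  qed
  also have "\<dots> \<le> (\<integral>\<^sup>+ y. ennreal (f0 y * (post D t (q u) t y - post D t (q v) t y)\<^sup>2) \<partial>lborel)"
  proof (intro nn_integral_mono ennreal_leI)
    fix y
    define a a' b b' where "a = E' (R u) y" "a' = E' (R v) y" "b = E (R u) y" "b' = E (R v) y"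
    note ab = this
    have b: "\<bar>b\<bar> \<le> 1 / 2" "\<bar>b'\<bar> \<le> 1 / 2" "\<bar>a'\<bar> \<le> 1"
      unfolding ab by (rule abs_post_R_le abs_post_cov_R_le)+
    \<comment> \<open>The linear part \<open>X\<close> and the correction \<open>Y\<close> of the difference of two displacements.\<close>
    define X Y where "X = (a - a') * (1 + b')" and "Y = a' * (b - b')"
    have eq: "post D t (q u) t y - post D t (q v) t y = (X - Y) / ((1 + b) * (1 + b'))"
      unfolding post_q ab[symmetric] X_def Y_def using b by (simp add: field_simps) 
    have "1 / 4 * (a - a')\<^sup>2 \<le> X\<^sup>2"
    proof -
      have "(1 / 2)\<^sup>2 \<le> (1 + b')\<^sup>2" using b by (intro power_mono) auto
      then have "(1 / 2)\<^sup>2 * (a - a')\<^sup>2 \<le> (1 + b')\<^sup>2 * (a - a')\<^sup>2" by (rule mult_right_mono) simp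
      then show ?thesis by (simp add: X_def power_mult_distrib power2_eq_square mult_ac)
    qed
    moreover have "Y\<^sup>2 \<le> (b - b')\<^sup>2"
    proof -
      have "a'\<^sup>2 \<le> 1" using power_mono[OF b(3), of 2] by simp
      then have "a'\<^sup>2 * (b - b')\<^sup>2 \<le> 1 * (b - b')\<^sup>2" by (rule mult_right_mono) simp
      then show ?thesis by (simp add: Y_def power_mult_distrib)
    qed
    moreover have "X\<^sup>2 / 2 - Y\<^sup>2 \<le> (X - Y)\<^sup>2"
      using zero_le_power2[of "X - 2 * Y"] by (simp add: power2_eq_square algebra_simps)
    ultimately have num: "1 / 8 * (a - a')\<^sup>2 - (b - b')\<^sup>2 \<le> (X - Y)\<^sup>2" by linarith
    have den: "0 < ((1 + b) * (1 + b'))\<^sup>2" "((1 + b) * (1 + b'))\<^sup>2 \<le> 81 / 16"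
    proof -
      have "0 < (1 + b) * (1 + b')" using b by (intro mult_pos_pos) auto
      moreover have "(1 + b) * (1 + b') \<le> 3 / 2 * (3 / 2)" using b by (intro mult_mono) auto
      ultimately show "0 < ((1 + b) * (1 + b'))\<^sup>2" "((1 + b) * (1 + b'))\<^sup>2 \<le> 81 / 16"
        using power_mono[of "(1 + b) * (1 + b')" "9 / 4" 2] by (auto simp: power2_eq_square)
    qed
    have "16 / 81 * (1 / 8 * (a - a')\<^sup>2 - (b - b')\<^sup>2) \<le> 16 / 81 * (X - Y)\<^sup>2" using num by simp
    also have "\<dots> = (X - Y)\<^sup>2 / (81 / 16)" by simp
    also have "\<dots> \<le> (X - Y)\<^sup>2 / ((1 + b) * (1 + b'))\<^sup>2" using den by (intro divide_left_mono) auto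
    also have "\<dots> = (post D t (q u) t y - post D t (q v) t y)\<^sup>2" unfolding eq power_divide ..
    finally have "f0 y * (16 / 81 * (1 / 8 * (a - a')\<^sup>2 - (b - b')\<^sup>2)) \<le>
        f0 y * (post D t (q u) t y - post D t (q v) t y)\<^sup>2"
      using f0_pos[of y] by (intro mult_left_mono) auto
    then show "g y \<le> f0 y * (post D t (q u) t y - post D t (q v) t y)\<^sup>2"
      unfolding g_def c_def direction_diff[symmetric] ab[symmetric] by (simp add: algebra_simps)
  qed
  finally show ?thesis .
qed

text \<open>
  With \<open>a\<close> and \<open>b\<close> the two densities relative to \<open>f0\<close>, \<open>a\<^sup>2 / b = 2 a - b + (a - b)\<^sup>2 / b\<close>. The first two terms
  integrate to \<open>1\<close>, and the last is at most \<open>2 (a - b)\<^sup>2\<close>, where \<open>a - b\<close> is \<open>2 \<delta>\<close> times a unit vector up to sign.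
\<close>

lemma chi_square_toggle:
  assumes k: "k < m"
  shows "(\<integral>\<^sup>+ y. ennreal ((mix D t (q u) y)\<^sup>2 / mix D t (q (toggle k u)) y) \<partial>lborel) \<le> ennreal (1 + 8 * \<delta>\<^sup>2)"
proof -
  define v where "v = toggle k u"
  define c where "c = (\<lambda>k. signed_step u k - signed_step v k)"
  define g where "g = (\<lambda>y. 2 * mix D t (q u) y - mix D t (q v) y + 2 * ((E (direction c) y)\<^sup>2 * f0 y))"
  have "hamming m u v = (\<Sum>i<m. if i = k then 1 else 0)"
    unfolding hamming_def v_def toggle_def by (intro sum.cong) auto
  then have ham: "hamming m u v = 1" using k by simp
  have int: "integrable lborel (\<lambda>y. (E (direction c) y)\<^sup>2 * f0 y)"
    using integrable_post_times_post[of "direction c" "direction c"] by (simp add: power2_eq_square)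
  have mixi: "integrable lborel (mix D t (q u))" "(\<integral>y. mix D t (q u) y \<partial>lborel) = 1" for u
    using has_bochner_integral_mix[of D t "q u"] by (auto simp: has_bochner_integral_iff q_sum)
  have le: "(mix D t (q u) y)\<^sup>2 / mix D t (q v) y \<le> g y" for y
  proof -
    define a b where "a = 1 + E (R u) y" and "b = 1 + E (R v) y"
    have b: "b \<ge> 1 / 2" using abs_post_R_le[of v y] by (auto simp: b_def)
    have "a\<^sup>2 / b = 2 * a - b + (a - b)\<^sup>2 / b"
      using b by (simp add: field_simps power2_eq_square)
    also have "(a - b)\<^sup>2 / b \<le> (a - b)\<^sup>2 / (1 / 2)" using b by (intro divide_left_mono) auto
    finally have "f0 y * (a\<^sup>2 / b) \<le> f0 y * (2 * a - b + 2 * (a - b)\<^sup>2)"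
      using f0_pos[of y] by (intro mult_left_mono) auto
    moreover have "f0 y * (a\<^sup>2 / b) = (mix D t (q u) y)\<^sup>2 / mix D t (q v) y"
      using f0_pos[of y] by (simp add: mix_q a_def b_def power2_eq_square)
    moreover have ab: "a - b = E (direction c) y"
      by (simp add: a_def b_def c_def direction_diff[symmetric])
    then have "g y = f0 y * (2 * a - b + 2 * (a - b)\<^sup>2)"
      unfolding g_def mix_q a_def[symmetric] b_def[symmetric] ab[symmetric]
      by (simp add: algebra_simps)
    ultimately show ?thesis by simp
  qed
  have mpos: "mix D t (q u) y \<ge> 0" for u y
    using q_pos by (intro mix_nonneg) (auto intro: less_imp_le)
  have "g y \<ge> 0" for y
    using le[of y] mpos by (smt (verit, best) divide_nonneg_nonneg zero_le_power2)
  moreover have gint: "integrable lborel g"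
    unfolding g_def using int mixi(1) by auto
  moreover have "(\<integral>y. g y \<partial>lborel) = 2 * 1 - 1 + 2 * (\<Sum>k<m. (c k)\<^sup>2)"
    unfolding g_def using int mixi by (simp add: norm_direction)
  then have "(\<integral>y. g y \<partial>lborel) = 1 + 8 * \<delta>\<^sup>2"
    unfolding c_def sum_signed_step_diff ham by simp
  ultimately have "(\<integral>\<^sup>+ y. ennreal (g y) \<partial>lborel) = ennreal (1 + 8 * \<delta>\<^sup>2)"
    by (subst nn_integral_eq_integral) auto
  moreover have "(\<integral>\<^sup>+ y. ennreal ((mix D t (q u) y)\<^sup>2 / mix D t (q v) y) \<partial>lborel) \<le> (\<integral>\<^sup>+ y. ennreal (g y) \<partial>lborel)"
    using le by (intro nn_integral_mono ennreal_leI)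
  ultimately show ?thesis by (simp add: v_def)
qed

text \<open>
  The largest regret over the vertices of the hypercube is at least the average one. The value of \<open>\<delta>\<close>
  keeps the integral of \<open>a\<^sup>2 / b\<close>, for the likelihoods of the remaining observations at neighbouring
  vertices, below
  \<open>(1 + 1 / (2 n)) ^ n \<le> exp (1 / 2) \<le> 2\<close>.
\<close>

theorem tot_regret_ge:
  assumes m: "real m \<ge> 64 * exp 8" and n: "n > 0" and \<delta>: "16 * \<delta>\<^sup>2 * n = 1"
    and priors: "\<And>u. u \<subseteq> {..<m} \<Longrightarrow> atoms D t (q u) \<in> \<G>"
  shows "ereal ((real m)\<^sup>2 / (41472 * exp 8)) \<le> tot_regret normal_mean n \<G>"
proof -
  define \<kappa> where "\<kappa> = \<delta>\<^sup>2 * m / (81 * exp 8)"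
  define C where "C = (real m)\<^sup>2 / (41472 * exp 8)"
  have C: "C = n * m * \<kappa> / 32"
  proof -
    have "n * m * \<kappa> / 32 = (16 * \<delta>\<^sup>2 * n) * (m * m) / (41472 * exp 8)"
      by (simp add: \<kappa>_def field_simps)
    then show ?thesis unfolding \<delta> by (simp add: C_def power2_eq_square)
  qed
  define X where "X = (\<lambda>u f. \<Sum>i<n. gaussian_mixture.excess D t (q u) n f i)"
  have "ereal C \<le> (SUP G\<in>\<G>. enn2ereal (risk_n normal_mean n f G) - ereal (real n) * enn2ereal (mmse normal_mean G))"
    if f: "f \<in> vec_space n \<rightarrow>\<^sub>M vec_space n" for f
  proof -
    have coord: "ennreal (2 ^ m * real m * \<kappa> / 32) \<le> (\<Sum>u\<in>Pow {..<m}. gaussian_mixture.excess D t (q u) n f i)"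
      if i: "i < n" for i
    proof -
      have ins: "insert i ({..<n} - {i}) = {..<n}" using i by auto
      have setsL: "sets (\<Pi>\<^sub>M k\<in>{..<n}. lborel :: real measure) = sets (vec_space n)"
        by (intro sets_PiM_cong) auto
      have fi: "(\<lambda>y. f y i) \<in> borel_measurable (\<Pi>\<^sub>M k\<in>{..<n}. lborel)"
        using measurable_compose[OF f measurable_component_singleton, of i] i
        by (simp add: measurable_cong_sets[OF setsL refl])
      have "ennreal (2 ^ m * real m * \<kappa> / 32) \<le> (\<Sum>u\<in>Pow {..<m}.
        \<integral>\<^sup>+ y. (\<Prod>k\<in>insert i ({..<n} - {i}). ennreal (mix D t (q u) (y k))) *
          ennreal ((f y i - post D t (q u) t (y i))\<^sup>2) \<partial>(\<Pi>\<^sub>M k\<in>insert i ({..<n} - {i}). lborel))"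
      proof (rule assouad_product[where g = f0 and dens = "\<lambda>u. mix D t (q u)"
            and T = "\<lambda>u. post D t (q u) t" and e = "\<lambda>y. f y i"])
        show "post D t (q u) t \<in> borel_measurable borel" for u
          by (rule gaussian_mixture.borel_measurable_post[OF gaussian_mixture_q])
        show "mix D t (q u) x > 0" for u x
          by (rule gaussian_mixture.f0_pos[OF gaussian_mixture_q])
        show "(\<integral>\<^sup>+ x. ennreal (mix D t (q u) x) \<partial>lborel) = 1" for u
          by (rule gaussian_mixture.nn_integral_f0[OF gaussian_mixture_q])
        show "f0 x \<ge> 0" for x using f0_pos[of x] by simp
        show "f0 x \<le> 2 * mix D t (q u) x" for u x
        proof -
          have "1 \<le> 2 * (1 + E (R u) x)" using abs_post_R_le[of u x] by auto
          then have "f0 x * 1 \<le> f0 x * (2 * (1 + E (R u) x))"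
            using f0_pos[of x] by (intro mult_left_mono) auto
          then show ?thesis by (simp add: mix_q algebra_simps)
        qed
        show "ennreal (\<kappa> * hamming m u v) \<le>
            (\<integral>\<^sup>+ x. ennreal (f0 x * (post D t (q u) t x - post D t (q v) t x)\<^sup>2) \<partial>lborel)" for u v
          unfolding \<kappa>_def by (rule separation[OF m])
        show "(\<integral>\<^sup>+ x. ennreal ((mix D t (q u) x)\<^sup>2 / mix D t (q (toggle k u)) x) \<partial>lborel) ^ card ({..<n} - {i}) \<le> 2"
          if "k < m" for u k
        proof -
          have "(\<integral>\<^sup>+ x. ennreal ((mix D t (q u) x)\<^sup>2 / mix D t (q (toggle k u)) x) \<partial>lborel) ^ card ({..<n} - {i})
              \<le> ennreal (1 + 8 * \<delta>\<^sup>2) ^ card ({..<n} - {i})"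
            by (intro power_mono chi_square_toggle that) auto
          also have "\<dots> = ennreal ((1 + 8 * \<delta>\<^sup>2) ^ card ({..<n} - {i}))"
            by (rule ennreal_power) simp
          also have "\<dots> \<le> ennreal 2"
          proof (rule ennreal_leI)
            have "(1 + 8 * \<delta>\<^sup>2) ^ card ({..<n} - {i}) \<le> (1 + 8 * \<delta>\<^sup>2) ^ n"
              using i by (intro power_increasing) auto
            also have "\<dots> \<le> exp (8 * \<delta>\<^sup>2) ^ n"
              by (intro power_mono exp_ge_add_one_self) (simp add: add_nonneg_nonneg)
            also have "\<dots> = exp (1 / 2)"
              using \<delta> by (simp add: exp_of_nat_mult[symmetric] field_simps)
            also have "\<dots> \<le> 2" using exp_half_le2 by simp
            finally show "(1 + 8 * \<delta>\<^sup>2) ^ card ({..<n} - {i}) \<le> 2" .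
          qed
          finally show ?thesis by simp
        qed
        show "(\<lambda>y. f y i) \<in> borel_measurable (\<Pi>\<^sub>M k\<in>insert i ({..<n} - {i}). lborel)"
          unfolding ins by (rule fi)
      qed (use \<delta>_pos in \<open>auto simp: \<kappa>_def\<close>)
      then show ?thesis
        unfolding ins gaussian_mixture.excess_def[OF gaussian_mixture_q] .
    qed
    have "(\<Sum>i<n. ennreal (2 ^ m * real m * \<kappa> / 32)) \<le> (\<Sum>i<n. \<Sum>u\<in>Pow {..<m}. gaussian_mixture.excess D t (q u) n f i)"
      using coord by (intro sum_mono) auto
    also have "\<dots> = (\<Sum>u\<in>Pow {..<m}. X u f)"
      unfolding X_def by (rule sum.swap)
    also have "\<dots> \<le> of_nat (card (Pow {..<m})) * Max ((\<lambda>u. X u f) ` Pow {..<m})"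
      by (rule sum_bounded_above) auto
    also have "\<dots> = ennreal (2 ^ m) * Max ((\<lambda>u. X u f) ` Pow {..<m})"
      by (simp add: card_Pow ennreal_power[symmetric])
    also have "(\<Sum>i<n. ennreal (2 ^ m * real m * \<kappa> / 32)) = ennreal (2 ^ m * C)"
      using \<delta>_pos by (subst sum_ennreal) (auto simp: C \<kappa>_def)
    also have "\<dots> = ennreal (2 ^ m) * ennreal C"
      by (intro ennreal_mult) (auto simp: C_def)
    finally have "ennreal C \<le> Max ((\<lambda>u. X u f) ` Pow {..<m})"
      by (subst (asm) ennreal_mult_le_mult_iff) (auto simp: ennreal_eq_0_iff not_le)
    moreover have "Max ((\<lambda>u. X u f) ` Pow {..<m}) \<in> (\<lambda>u. X u f) ` Pow {..<m}"
      by (intro Max_in) auto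
    ultimately obtain u where u: "u \<subseteq> {..<m}" "ennreal C \<le> X u f" by auto
    have "ereal C = enn2ereal (ennreal C)" by (simp add: C_def enn2ereal_ennreal)
    also have "\<dots> \<le> enn2ereal (X u f)" using u(2) by (simp add: less_eq_ennreal.rep_eq)
    also have "\<dots> \<le> enn2ereal (risk_n normal_mean n f (atoms D t (q u))) -
        ereal (real n) * enn2ereal (mmse normal_mean (atoms D t (q u)))"
      unfolding X_def by (rule gaussian_mixture.regret_ge_excess[OF gaussian_mixture_q f])
    also have "\<dots> \<le> (SUP G\<in>\<G>. enn2ereal (risk_n normal_mean n f G) - ereal (real n) * enn2ereal (mmse normal_mean G))"
      using priors[OF u(1)] by (rule SUP_upper)
    finally show ?thesis .
  qed
  then show ?thesis
    unfolding tot_regret_def C_def by (intro INF_greatest)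
qed

end

section \<open>Choice of the dimension of the hypercube\<close>

text \<open>
  The mass away from the first atom, which will be at \<open>0\<close>, is \<open>\<epsilon>\<close>; the subgaussian tail bound dictates
  its size. It is spread evenly so that no weight is smaller than necessary.
\<close>

definition spike :: "nat \<Rightarrow> real \<Rightarrow> nat \<Rightarrow> real" where
  "spike D \<epsilon> j = (if j = 0 then 1 - \<epsilon> else \<epsilon> / real D)"

lemma spike_mixture:
  assumes D: "D > 0" and L: "L > 0" and \<epsilon>: "0 < \<epsilon>" "\<epsilon> \<le> 1 / 2"
  shows "gaussian_mixture D (\<lambda>j. real j * (L / D)) (spike D \<epsilon>) L"
proof
  show "(\<Sum>j\<le>D. spike D \<epsilon> j) = 1"
  proof -
    have "{..D} = insert 0 {1..D}" by auto
    then have "(\<Sum>j\<le>D. spike D \<epsilon> j) = spike D \<epsilon> 0 + (\<Sum>j=1..D. spike D \<epsilon> j)" by simp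
    also have "(\<Sum>j=1..D. spike D \<epsilon> j) = (\<Sum>j=1..D. \<epsilon> / real D)"
      by (intro sum.cong) (auto simp: spike_def)
    finally show ?thesis using D by (simp add: spike_def)
  qed
qed (use assms in \<open>auto simp: spike_def field_simps\<close>)

text \<open>
  Both classes contain every prior on \<open>[0, L]\<close> with an atom at \<open>0\<close> and a mass of at most
  \<open>exp (- L\<^sup>2 / (2 s))\<close> elsewhere, for suitable \<open>L\<close>, so the two parts share this construction.
\<close>

lemma tot_regret_ge_square:
  fixes m n :: nat and L s :: real
  assumes m: "real m \<ge> 64 * exp 8" and L: "L > 0" "L\<^sup>2 \<le> m" and s: "s > 0" and n: "n > 0"
    and growth: "(growth s * (m / L\<^sup>2) ^ 7) ^ m \<le> 2 * sqrt n"
    and priors: "\<And>D t q. gaussian_mixture D t q L \<Longrightarrow>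
      (\<Sum>j=1..D. q j) \<le> exp (- L\<^sup>2 / (2 * s)) \<Longrightarrow> t 0 = 0 \<Longrightarrow> atoms D t q \<in> \<G>"
  shows "ereal ((real m)\<^sup>2 / (41472 * exp 8)) \<le> tot_regret normal_mean n \<G>"
proof -
  have "real m > 0" using m exp_gt_zero[of "8 :: real"] by linarith
  then have m0: "m > 0" by simp
  define D where "D = 6 * m"
  define t where "t = (\<lambda>j. real j * (L / D))"
  define \<epsilon> where "\<epsilon> = exp (- L\<^sup>2 / (2 * s)) / 2"
  define p where "p = spike D \<epsilon>"
  define l where "l = L / (2 * real D + 2)"
  define pmin where "pmin = exp (- L\<^sup>2 / (2 * s)) / (2 * real D)"
  define \<Lambda> where "\<Lambda> = (real D + 1) * (3 * exp (L\<^sup>2) * (1 + exp (L\<^sup>2 / D)) ^ D * (2 * exp 1 / (L * l)) ^ D / pmin) * sqrt (1 / l)"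
  define \<delta> where "\<delta> = 1 / (4 * sqrt n)"
  have D: "D > 0" using m0 by (simp add: D_def)
  have \<epsilon>: "0 < \<epsilon>" "\<epsilon> \<le> 1 / 2" using s by (auto simp: \<epsilon>_def divide_le_0_iff)
  interpret gaussian_mixture D t p L
    unfolding t_def p_def by (rule spike_mixture[OF D L(1) \<epsilon>])
  have pm: "pmin > 0" using D by (simp add: pmin_def)
  have p_ge: "p j \<ge> pmin" if "j \<le> D" for j
  proof (cases "j = 0")
    case True
    have "pmin = \<epsilon> / real D" using D by (simp add: pmin_def \<epsilon>_def)
    also have "\<dots> \<le> \<epsilon> / 1" using D \<epsilon> by (intro divide_left_mono) auto
    finally show ?thesis using True \<epsilon> by (simp add: p_def spike_def)
  qed (simp add: p_def spike_def pmin_def \<epsilon>_def)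
  have "\<exists>r. (\<forall>k<m. (\<Sum>j\<le>D. p j * r k j) = 0) \<and>
    (\<forall>k<m. \<forall>i\<le>4 * m. E (r k) ((real i - 2 * real m) / sqrt m) = 0) \<and>
    (\<forall>k<m. \<forall>k'<m. (\<integral>y. E (r k) y * E (r k') y * f0 y \<partial>lborel) = (if k = k' then 1 else 0)) \<and>
    (\<forall>k<m. \<forall>j\<le>D. \<bar>r k j\<bar> \<le> \<Lambda>)"
    unfolding \<Lambda>_def l_def
    by (rule exists_orthonormal_directions[OF m0 D_def L(1) _ pm p_ge]) (simp_all add: t_def)
  then obtain r where r: "\<forall>k<m. (\<Sum>j\<le>D. p j * r k j) = 0"
    "\<forall>k<m. \<forall>i\<le>4 * m. E (r k) ((real i - 2 * real m) / sqrt m) = 0"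
    "\<forall>k<m. \<forall>k'<m. (\<integral>y. E (r k) y * E (r k') y * f0 y \<partial>lborel) = (if k = k' then 1 else 0)"
    "\<forall>k<m. \<forall>j\<le>D. \<bar>r k j\<bar> \<le> \<Lambda>"
    by (elim exE conjE) (rule that)
  have "(real m)\<^sup>2 * \<Lambda> \<le> 2 * sqrt n"
    using amplitude_bound[OF m0 L s] growth unfolding \<Lambda>_def l_def pmin_def D_def by (rule order_trans)
  then have small: "2 * (real m)\<^sup>2 * \<Lambda> * \<delta> \<le> 1"
    using n by (simp add: \<delta>_def field_simps)
  interpret perturbed_mixture D t p L m r \<Lambda> \<delta>
  proof
    show "L \<le> sqrt m" using L by (intro real_le_rsqrt) simp
    show "\<delta> > 0" using n by (simp add: \<delta>_def)
    show "(\<Sum>j\<le>D. p j * r k j) = 0" if "k < m" for k using r(1) that by blast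
    show "E (r k) ((real i - 2 * real m) / sqrt m) = 0" if "k < m" "i \<le> 4 * m" for k i
      using r(2) that by blast
    show "(\<integral>y. E (r k) y * E (r k') y * f0 y \<partial>lborel) = (if k = k' then 1 else 0)"
      if "k < m" "k' < m" for k k' using r(3) that by blast
    show "\<bar>r k j\<bar> \<le> \<Lambda>" if "k < m" "j \<le> D" for k j using r(4) that by blast
  qed (rule m0, rule small)
  show ?thesis
  proof (rule tot_regret_ge[OF m n])
    show "16 * \<delta>\<^sup>2 * n = 1" using n by (simp add: \<delta>_def power_divide power_mult_distrib)
    fix u
    have "(\<Sum>j=1..D. q u j) \<le> (\<Sum>j=1..D. 2 * (\<epsilon> / D))"
    proof (rule sum_mono)
      fix j assume "j \<in> {1..D}"
      then show "q u j \<le> 2 * (\<epsilon> / D)" using q_le[of j u] by (simp add: p_def spike_def)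
    qed
    also have "\<dots> = exp (- L\<^sup>2 / (2 * s))" using D by (simp add: \<epsilon>_def)
    finally show "atoms D t (q u) \<in> \<G>"
      by (intro priors gaussian_mixture_q) (simp_all add: t_def)
  qed
qed

lemma tot_regret_bounded_ge:
  assumes h: "h > 0" and m: "real m \<ge> 64 * exp 8" "h\<^sup>2 \<le> m" and n: "n > 0"
    and growth: "(growth 1 * (m / h\<^sup>2) ^ 7) ^ m \<le> 2 * sqrt n"
  shows "ereal ((real m)\<^sup>2 / (41472 * exp 8)) \<le> tot_regret normal_mean n (priors_on {-h..h})"
proof (rule tot_regret_ge_square[OF m(1) h m(2) _ n growth])
  fix D t q assume "gaussian_mixture D t q h"
  then interpret gaussian_mixture D t q h .
  have "measure (atoms D t q) {-h..h} = (\<Sum>j\<le>D. q j * indicator {-h..h} (t j))"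
    using p_pos by (intro measure_atoms) (auto intro: less_imp_le)
  also have "\<dots> = (\<Sum>j\<le>D. q j)"
  proof (intro sum.cong refl)
    fix j assume "j \<in> {..D}"
    then have "t j \<in> {-h..h}" using t_nonneg[of j] t_le[of j] h by auto
    then show "q j * indicator {-h..h} (t j) = q j" by simp
  qed
  finally show "atoms D t q \<in> priors_on {-h..h}"
    using prob_space_prior by (simp add: priors_on_def p_sum)
qed (rule zero_less_one)

text \<open>
  With all atoms in \<open>[0, L]\<close>, the tail bound only has to hold for \<open>t < L\<close>, and there the mass outside \<open>0\<close> is
  already below \<open>exp (- t\<^sup>2 / (2 s))\<close>. Taking \<open>L = sqrt m\<close> makes \<open>m / L\<^sup>2 = 1\<close>.
\<close>

lemma tot_regret_subgaussian_ge:
  assumes s: "s > 0" and m: "real m \<ge> 64 * exp 8" and n: "n > 0"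
    and growth: "growth s ^ m \<le> 2 * sqrt n"
  shows "ereal ((real m)\<^sup>2 / (41472 * exp 8)) \<le> tot_regret normal_mean n (SubG s)"
proof -
  define L where "L = sqrt m"
  have "real m > 0" using m exp_gt_zero[of "8 :: real"] by linarith
  then have "m > 0" by simp
  then have L: "L > 0" "L\<^sup>2 = m" by (auto simp: L_def)
  show ?thesis
  proof (rule tot_regret_ge_square[OF m L(1) _ s n])
    show "(growth s * (m / L\<^sup>2) ^ 7) ^ m \<le> 2 * sqrt n" using growth L \<open>m > 0\<close> by simp
    fix D t q assume "gaussian_mixture D t q L" and tail: "(\<Sum>j=1..D. q j) \<le> exp (- L\<^sup>2 / (2 * s))" and t0: "t 0 = 0"
    then interpret gaussian_mixture D t q L by simp
    have "measure (atoms D t q) (- {-x..x}) \<le> 2 * exp (- x\<^sup>2 / (2 * s))" if x: "x > 0" for x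
    proof -
      have eq: "measure (atoms D t q) (- {-x..x}) = (\<Sum>j\<le>D. q j * indicator (- {-x..x}) (t j))"
        using p_pos by (intro measure_atoms) (auto intro: less_imp_le)
      show ?thesis
      proof (cases "x < L")
        case True
        have "(\<Sum>j\<le>D. q j * indicator (- {-x..x}) (t j)) = (\<Sum>j\<in>insert 0 {1..D}. q j * indicator (- {-x..x}) (t j))"
          by (intro sum.cong) auto
        also have "\<dots> = (\<Sum>j=1..D. q j * indicator (- {-x..x}) (t j))"
          using x t0 by (subst sum.insert) simp_all
        also have "\<dots> \<le> (\<Sum>j=1..D. q j)"
          using p_pos by (intro sum_mono) (auto simp: indicator_def intro: less_imp_le)
        also have "\<dots> \<le> exp (- L\<^sup>2 / (2 * s))" by (rule tail)
        also have "\<dots> \<le> exp (- x\<^sup>2 / (2 * s))"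
          using True x s by (simp add: divide_right_mono power_mono)
        also have "\<dots> \<le> 2 * exp (- x\<^sup>2 / (2 * s))" by simp
        finally show ?thesis by (simp add: eq)
      next
        case False
        have "(\<Sum>j\<le>D. q j * indicator (- {-x..x}) (t j)) = 0"
        proof (intro sum.neutral ballI)
          fix j assume "j \<in> {..D}"
          then have "t j \<in> {-x..x}" using False x t_nonneg[of j] t_le[of j] by auto
          then show "q j * indicator (- {-x..x}) (t j) = 0" by simp
        qed
        then show ?thesis by (simp add: eq)
      qed
    qed
    then show "atoms D t q \<in> SubG s" using prob_space_prior by (simp add: SubG_def)
  qed (simp add: L)
qed

theorem theorem1:
  shows "(\<forall>h::real. h > 0 \<longrightarrow>
            (\<exists>c\<^sub>0::real. c\<^sub>0 > 0 \<and> (\<exists>n\<^sub>0::nat. \<forall>n\<ge>n\<^sub>0.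
               tot_regret normal_mean n (priors_on {-h..h})
                 \<ge> ereal (c\<^sub>0 * (ln (real n) / ln (ln (real n)))\<^sup>2)))) \<and>
         (\<forall>s::real. s > 0 \<longrightarrow>
            (\<exists>c\<^sub>1::real. c\<^sub>1 > 0 \<and> (\<exists>n\<^sub>0::nat. \<forall>n\<ge>n\<^sub>0.
               tot_regret normal_mean n (SubG s)
                 \<ge> ereal (c\<^sub>1 * (ln (real n))\<^sup>2))))"
proof (intro conjI allI impI)
  fix s :: real assume s: "s > 0"
  define \<gamma> where "\<gamma> = ln (growth s)"
  have "growth s \<ge> 3528 * 1 * 1"
    unfolding growth_def using s exp_ge_add_one_self[of 1]
    by (intro mult_mono one_le_power) (auto simp: one_le_exp_iff)
  then have \<gamma>: "\<gamma> > 0" "growth s = exp \<gamma>" by (auto simp: \<gamma>_def)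
  \<comment> \<open>With \<open>m\<close> between \<open>c ln n\<close> and \<open>2 c ln n\<close> the amplitude bound \<open>exp (m \<gamma>)\<close> is at most \<open>sqrt n\<close>.\<close>
  define c where "c = 1 / (4 * \<gamma>)"
  define C where "C = c\<^sup>2 / (41472 * exp 8)"
  have c: "c > 0" using \<gamma> by (simp add: c_def)
  have "filterlim (\<lambda>n. ln (real n)) at_top sequentially" by real_asymp
  then have "\<forall>\<^sub>F n in sequentially. ln (real n) \<ge> max (64 * exp 8) 1 / c"
    unfolding filterlim_at_top by blast
  then have "\<forall>\<^sub>F n in sequentially. ereal (C * (ln (real n))\<^sup>2) \<le> tot_regret normal_mean n (SubG s)"
    using eventually_gt_at_top[of "0::nat"]
  proof eventually_elim
    case (elim n)
    define m where "m = nat \<lfloor>2 * c * ln n\<rfloor>"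
    have ln: "c * ln n \<ge> 64 * exp 8" "c * ln n \<ge> 1" using elim c by (auto simp: divide_le_eq mult.commute)
    have m: "c * ln n \<le> m" "m \<le> 2 * c * ln n"
      unfolding m_def using ln by linarith+
    have "ereal (C * (ln n)\<^sup>2) \<le> ereal ((real m)\<^sup>2 / (41472 * exp 8))"
    proof -
      have "(c * ln n)\<^sup>2 \<le> (real m)\<^sup>2" using m(1) ln by (intro power_mono) auto
      then show ?thesis by (simp add: C_def power_mult_distrib divide_right_mono)
    qed
    also have "\<dots> \<le> tot_regret normal_mean n (SubG s)"
    proof (rule tot_regret_subgaussian_ge[OF s _ elim(2)])
      show "64 * exp 8 \<le> real m" using ln m by linarith
      have "growth s ^ m = exp (m * \<gamma>)" by (simp add: \<gamma> exp_of_nat_mult)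
      also have "m * \<gamma> \<le> 2 * c * ln n * \<gamma>" using m(2) \<gamma> by (intro mult_right_mono) auto
      also have "2 * c * ln n * \<gamma> = ln n / 2" using \<gamma> by (simp add: c_def)
      also have "exp (ln n / 2) = sqrt n"
        using elim by (simp add: powr_half_sqrt[symmetric] powr_def)
      also have "sqrt n \<le> 2 * sqrt n" by simp
      finally show "growth s ^ m \<le> 2 * sqrt n" by simp
    qed
    finally show ?case .
  qed
  moreover have "C > 0" using c by (simp add: C_def)
  ultimately show "\<exists>c\<^sub>1>0. \<exists>n\<^sub>0. \<forall>n\<ge>n\<^sub>0. ereal (c\<^sub>1 * (ln (real n))\<^sup>2) \<le> tot_regret normal_mean n (SubG s)"
    unfolding eventually_sequentially by blast
next
  fix h :: real assume h: "h > 0"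
  define K where "K = growth 1 / h ^ 14"
  have K: "K > 0" using h by (simp add: K_def growth_def)
  define C :: real where "C = (1 / 32)\<^sup>2 / (41472 * exp 8)"
  have "filterlim (\<lambda>n. ln (real n) / (32 * ln (ln (real n)))) at_top sequentially" by real_asymp
  then have "\<forall>\<^sub>F n in sequentially. ln (real n) / (32 * ln (ln (real n))) \<ge> max (max (64 * exp 8) (h\<^sup>2)) (max 1 K)"
    unfolding filterlim_at_top by blast
  moreover have "\<forall>\<^sub>F n in sequentially. ln (ln (real n)) \<ge> 1"
    by real_asymp
  ultimately have "\<forall>\<^sub>F n in sequentially.
      ereal (C * (ln (real n) / ln (ln (real n)))\<^sup>2) \<le> tot_regret normal_mean n (priors_on {-h..h})"
    using eventually_gt_at_top[of "0::nat"]
  proof eventually_elim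
    case (elim n)
    \<comment> \<open>For \<open>K \<le> x \<le> m \<le> 2 x\<close> the amplitude bound is at most \<open>m ^ (8 m) \<le> exp (ln n / 2)\<close>.\<close>
    define x where "x = ln n / (32 * ln (ln n))"
    define m where "m = nat \<lfloor>2 * x\<rfloor>"
    have x: "x \<ge> 64 * exp 8" "x \<ge> h\<^sup>2" "x \<ge> 1" "x \<ge> K" using elim by (auto simp: x_def)
    have m: "x \<le> m" "m \<le> 2 * x"
      unfolding m_def using x by linarith+
    have m1: "real m \<ge> 1" using m x by linarith
    have "ereal (C * (ln (real n) / ln (ln (real n)))\<^sup>2) \<le> ereal ((real m)\<^sup>2 / (41472 * exp 8))"
    proof -
      have "x\<^sup>2 \<le> (real m)\<^sup>2" using m(1) x by (intro power_mono) auto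
      moreover have "C * (ln (real n) / ln (ln (real n)))\<^sup>2 = x\<^sup>2 / (41472 * exp 8)"
        by (simp add: C_def x_def power_divide power_mult_distrib)
      ultimately show ?thesis by (simp add: divide_right_mono)
    qed
    also have "\<dots> \<le> tot_regret normal_mean n (priors_on {-h..h})"
    proof (rule tot_regret_bounded_ge[OF h _ _ elim(3)])
      show "64 * exp 8 \<le> real m" "h\<^sup>2 \<le> real m" using x m by linarith+
      have lnn: "ln n > 0"
      proof -
        have "ln n \<ge> 0" using elim(3) by (intro ln_ge_zero) simp
        moreover have "ln n \<noteq> 0" using elim(2) by auto
        ultimately show ?thesis by simp
      qed
      have mln: "m \<le> ln n"
      proof -
        have "ln n * 1 \<le> ln n * (16 * ln (ln n))" using elim(2) lnn by (intro mult_left_mono) auto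
        then have "2 * x \<le> ln n" using elim(2) by (simp add: x_def divide_le_eq del: ln_gt_zero_iff)
        then show ?thesis using m by simp
      qed
      have "growth 1 * (m / h\<^sup>2) ^ 7 = K * real m ^ 7"
        by (simp add: K_def power_divide power_mult[symmetric])
      also have "\<dots> \<le> real m * real m ^ 7" using x m by (intro mult_right_mono) auto
      also have "\<dots> = exp (8 * ln m)"
        using m1 by (simp add: exp_of_nat_mult[of 8, simplified] power_Suc[symmetric] del: power_Suc)
      finally have "(growth 1 * (m / h\<^sup>2) ^ 7) ^ m \<le> exp (8 * ln m) ^ m"
        using h by (intro power_mono) (auto simp: growth_def)
      also have "\<dots> = exp (m * (8 * ln m))" by (simp add: exp_of_nat_mult)
      also have "m * (8 * ln m) \<le> (2 * x) * (8 * ln (ln n))"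
        using m m1 mln x by (intro mult_mono) auto
      also have "\<dots> = ln n / 2" using elim(2) by (simp add: x_def)
      also have "exp (ln n / 2) = sqrt n"
        using elim by (simp add: powr_half_sqrt[symmetric] powr_def)
      also have "sqrt n \<le> 2 * sqrt n" by simp
      finally show "(growth 1 * (m / h\<^sup>2) ^ 7) ^ m \<le> 2 * sqrt n" by simp
    qed
    finally show ?case .
  qed
  moreover have "C > 0" by (simp add: C_def)
  ultimately show "\<exists>c\<^sub>0>0. \<exists>n\<^sub>0. \<forall>n\<ge>n\<^sub>0. ereal (c\<^sub>0 * (ln (real n) / ln (ln (real n)))\<^sup>2) \<le> tot_regret normal_mean n (priors_on {-h..h})"
    unfolding eventually_sequentially by blast
qed

end
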